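(* Let $A,B,C$ be vector bundles over $M$. (I) The bicrossproduct of a matched pair of $2$-representations is a split Lie $2$-algebroid. That is, given Lie algebroids $A,B$ over $M$ and a matched pair of $2$-representations, of $A$ on $\partial_B\colon C\to B$ and of $B$ on $\partial_A\colon C\to A$, the vector bundles $A\oplus B$ and $C$ with - the anchor $\rho_A\circ\mathrm{pr}_A+\rho_B\circ\mathrm{pr}_B\colon A\oplus B\to TM$, - $l=(\partial_A,-\partial_B)\colon C\to A\oplus B$, - the bracket $[\![(a,b),(a',b')]\!]=([a,a']+\nabla_ba'-\nabla_{b'}a,\ [b,b']+\nabla_ab'-\nabla_{a'}b)$, - the connection $\nabla_{(a,b)}c=\nabla_ac+\nabla_bc$ on $C$, - the form $\omega\in\Omega^3(A\oplus B,C)$, $$\omega((a_1,b_1),(a_2,b_2),(a_3,b_3))=R_A(a_1,a_2)b_3+R_A(a_2,a_3)b_1+R_A(a_3,a_1)b_2-R_B(b_1,b_2)a_3-R_B(b_2,b_3)a_1-R_B(b_3,b_1)a_2,$$ form a split Lie $2$-algebroid (called the bicrossproduct of the matched pair). (II) Conversely, suppose $(A\oplus B)\oplus C$ has a split Lie $2$-algebroid structure (with anchor $\rho_{A\oplus B}$, map $l\colon C\to A\oplus B$, bracket $[\![\cdot,\cdot]\!]$ on $\Gamma(A\oplus B)$, $(A\oplus B)$-connection $\nabla$ on $C$, and form $\omega$) such that 1. $[\![(a_1,0),(a_2,0)]\!]=([a_1,a_2],0)$ with a section $[a_1,a_2]\in\Gamma(A)$ for all $a_1,a_2\in\Gamma(A)$,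 and $[\![(0,b_1),(0,b_2)]\!]=(0,[b_1,b_2])$ with a section $[b_1,b_2]\in\Gamma(B)$ for all $b_1,b_2\in\Gamma(B)$; 2. $\omega((a_1,0),(a_2,0),(a_3,0))=0$ and $\omega((0,b_1),(0,b_2),(0,b_3))=0$ for all $a_i\in\Gamma(A)$, $b_i\in\Gamma(B)$. Then $A$ and $B$ are Lie subalgebroids of $(A\oplus B)\oplus C$ (i.e. they are Lie algebroids with these brackets and the restrictions of $\rho_{A\oplus B}$), and $(A\oplus B)\oplus C$ is the bicrossproduct of a matched pair of $2$-representations of $A$ on $\partial_B\colon C\to B$ and of $B$ on $\partial_A\colon C\to A$. The $2$-representation of $A$ is given by $$\partial_B(c)=-\mathrm{pr}_B(l(c)),\quad\nabla_ab=\mathrm{pr}_B[\![(a,0),(0,b)]\!],\quad\nabla_ac=\nabla_{(a,0)}c,\quad R_A(a_1,a_2)b=\omega((a_1,0),(a_2,0),(0,b)),$$ and the $2$-representation of $B$ is given by $$\partial_A(c)=\mathrm{pr}_A(l(c)),\quad\nabla_ba=\mathrm{pr}_A[\![(0,b),(a,0)]\!],\quad\nabla_bc=\nabla_{(0,b)}c,\quad R_B(b_1,b_2)a=-\omega((0,b_1),(0,b_2),(a,0)).$$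
   Context: **$2$-representation.** A $2$-representation (2-term representation up to homotopy) of a Lie algebroid $A\to M$ on a vector bundle map $\partial\colon E_0\to E_1$ consists of $A$-connections $\nabla^0,\nabla^1$ on $E_0,E_1$ with $\partial\circ\nabla^0=\nabla^1\circ\partial$ and $R\in\Omega^2(A,\mathrm{Hom}(E_1,E_0))$ with $R_{\nabla^0}=R\circ\partial$, $R_{\nabla^1}=\partial\circ R$ and $\mathbf d_{\nabla^{\mathrm{Hom}}}R=0$, where $\nabla^{\mathrm{Hom}}$ is the induced connection on $\mathrm{Hom}(E_1,E_0)$ and $\mathbf d_{\nabla^{\mathrm{Hom}}}$ is given by the Koszul formula. **Matched pair of $2$-representations.** Let $(A,\rho_A,[\cdot,\cdot])$ and $(B,\rho_B,[\cdot,\cdot])$ be Lie algebroids over $M$, let $A$ act up to homotopy on $\partial_B\colon C\to B$ with $A$-connections on $B$ and $C$ and curvature $R_A\in\Omega^2(A,\mathrm{Hom}(B,C))$, and let $B$ act up to homotopy on $\partial_A\colon C\to A$ with $B$-connections on $A$ and $C$ and $R_B\in\Omega^2(B,\mathrm{Hom}(A,C))$. All four connections are written $\nabla$. They form a matched pair if for all sections $a,a_i$ of $A$, $b,b_i$ of $B$, $c,c_i$ of $C$: (M1) $\nabla_{\partial_Ac_1}c_2-\nabla_{\partial_Bc_2}c_1=-(\nabla_{\partial_Ac_2}c_1-\nabla_{\partial_Bc_1}c_2)$; (M2) $[a,\partial_Ac]=\partial_A(\nabla_ac)-\nabla_{\partial_Bc}a$; (M3) $[b,\partial_Bc]=\partial_B(\nabla_bc)-\nabla_{\partial_Ac}b$;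 (M4) $\nabla_b\nabla_ac-\nabla_a\nabla_bc-\nabla_{\nabla_ba}c+\nabla_{\nabla_ab}c=R_B(b,\partial_Bc)a-R_A(a,\partial_Ac)b$; (M5) $\partial_A(R_A(a_1,a_2)b)=-\nabla_b[a_1,a_2]+[\nabla_ba_1,a_2]+[a_1,\nabla_ba_2]+\nabla_{\nabla_{a_2}b}a_1-\nabla_{\nabla_{a_1}b}a_2$; (M6) $\partial_B(R_B(b_1,b_2)a)=-\nabla_a[b_1,b_2]+[\nabla_ab_1,b_2]+[b_1,\nabla_ab_2]+\nabla_{\nabla_{b_2}a}b_1-\nabla_{\nabla_{b_1}a}b_2$; (M7) $\mathbf d_{\nabla^A}R_B=\mathbf d_{\nabla^B}R_A\in\Omega^2(A,\wedge^2B^*\otimes C)=\Omega^2(B,\wedge^2A^*\otimes C)$, where $R_B$ is seen as an element of $\Omega^1(A,\wedge^2B^*\otimes C)$, $R_A$ as an element of $\Omega^1(B,\wedge^2A^*\otimes C)$, $\nabla^A$ is the induced $A$-connection on $\wedge^2B^*\otimes C$ and $\nabla^B$ the induced $B$-connection on $\wedge^2A^*\otimes C$. **Split Lie $2$-algebroid on $Q\oplus C$** (here $Q=A\oplus B$): an anchor $\rho_Q\colon Q\to TM$ (vector bundle map), a vector bundle map $l\colon C\to Q$, a skew-symmetric dull bracket $[\![\cdot,\cdot]\!]$ on $\Gamma(Q)$ (i.e. $\mathbb R$-bilinear, skew-symmetric, $\rho_Q[\![q_1,q_2]\!]=[\rho_Q(q_1),\rho_Q(q_2)]$, $[\![q_1,fq_2]\!]=f[\![q_1,q_2]\!]+\rho_Q(q_1)(f)q_2$),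 a linear $Q$-connection $\nabla$ on $C$ with dual connection $\nabla^*$ on $C^*$, and $\omega\in\Omega^3(Q,C)$ such that for all sections: (i) $\nabla_{l(c_1)}c_2+\nabla_{l(c_2)}c_1=0$; (ii) $[\![q,l(c)]\!]=l(\nabla_qc)$; (iii) $\mathrm{Jac}=l\circ\omega$, where $\mathrm{Jac}(q_1,q_2,q_3)=[\![[\![q_1,q_2]\!],q_3]\!]+[\![q_2,[\![q_1,q_3]\!]]\!]-[\![q_1,[\![q_2,q_3]\!]]\!]$; (iv) $R_{\nabla^*}(q_1,q_2)\gamma=l^*\langle\omega(q_1,q_2,\cdot),\gamma\rangle$ for $\gamma\in\Gamma(C^* )$, where $R_{\nabla^*}(q_1,q_2)=\nabla^*_{q_1}\nabla^*_{q_2}-\nabla^*_{q_2}\nabla^*_{q_1}-\nabla^*_{[\![q_1,q_2]\!]}$; (v) $\mathbf d_\nabla\omega=0$ (Koszul formula with $[\![\cdot,\cdot]\!]$ and $\nabla$). *)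

theory Defs
  imports "HOL-Analysis.Analysis" "HOL-Library.Function_Algebras"
begin

text \<open>
  Conventions.  The base manifold \<open>M\<close> is a whole type \<open>'m\<close>, Hausdorff and second countable, with
  a smooth atlas.  Functions and sections are maps on \<open>'m\<close>, added and multiplied pointwise
  (theory \<open>Function_Algebras\<close>).  Vector bundle maps and forms are families of (multi)linear
  maps on the fibres that send smooth sections to smooth sections; differential operators
  (brackets, connections, covariant differentials) act on sections.
\<close>

section \<open>Smooth manifolds\<close>

text \<open>
  The model space is the \<open>n\<close>-dimensional \<open>Euclidean_space n\<close> of the library, that is the set of
  \<open>y :: nat \<Rightarrow> real\<close> with \<open>y i = 0\<close> for \<open>i \<ge> n\<close>; unlike types of class \<open>euclidean_space\<close> it allows
  dimension 0 (Lie algebroids over a point).  \<open>C_k n W k f\<close>: all iterated partial derivatives of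
  \<open>f\<close> of order at most \<open>k\<close> exist and are continuous on the open subset \<open>W\<close> of the model space.
\<close>

primrec C_k :: "nat \<Rightarrow> (nat \<Rightarrow> real) set \<Rightarrow> nat \<Rightarrow> ((nat \<Rightarrow> real) \<Rightarrow> real) \<Rightarrow> bool" where
  "C_k n W 0 f \<longleftrightarrow> continuous_on W f"
| "C_k n W (Suc k) f \<longleftrightarrow> continuous_on W f \<and>
     (\<forall>i<n. \<exists>g. (\<forall>y\<in>W. ((\<lambda>t. f (y(i := t))) has_real_derivative g y) (at (y i))) \<and> C_k n W k g)"

definition smooth_Eucl :: "nat \<Rightarrow> (nat \<Rightarrow> real) set \<Rightarrow> ((nat \<Rightarrow> real) \<Rightarrow> real) \<Rightarrow> bool" where
  "smooth_Eucl n W f \<longleftrightarrow> (\<forall>k. C_k n W k f)"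

record 'm manifold =
  mdim :: nat
  charts :: "('m set \<times> ('m \<Rightarrow> nat \<Rightarrow> real)) set"

definition smooth_manifold :: "('m::{t2_space,second_countable_topology}) manifold \<Rightarrow> bool" where
  "smooth_manifold M \<longleftrightarrow>
     (\<Union>(U, \<phi>)\<in>charts M. U) = UNIV \<and>
     (\<forall>(U, \<phi>)\<in>charts M. open U \<and> openin (Euclidean_space (mdim M)) (\<phi> ` U) \<and>
        homeomorphism U (\<phi> ` U) \<phi> (inv_into U \<phi>)) \<and>
     (\<forall>(U, \<phi>)\<in>charts M. \<forall>(V, \<psi>)\<in>charts M. \<forall>i<mdim M.
        smooth_Eucl (mdim M) (\<phi> ` (U \<inter> V)) (\<lambda>y. \<psi> (inv_into U \<phi> y) i))"

definition smooth_on_mfd :: "'m manifold \<Rightarrow> 'm set \<Rightarrow> ('m \<Rightarrow> real) \<Rightarrow> bool" where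
  "smooth_on_mfd M W f \<longleftrightarrow>
     (\<forall>(U, \<phi>)\<in>charts M. smooth_Eucl (mdim M) (\<phi> ` (U \<inter> W)) (\<lambda>y. f (inv_into U \<phi> y)))"

definition C_inf :: "'m manifold \<Rightarrow> ('m \<Rightarrow> real) set" where
  "C_inf M = {f. smooth_on_mfd M UNIV f}"

text \<open>
  Tangent vectors at \<open>x\<close> are the derivations at \<open>x\<close> of the algebra of smooth functions; their
  values outside \<open>C_inf M\<close> carry no information and are never used.
\<close>

definition tangent_space :: "'m manifold \<Rightarrow> 'm \<Rightarrow> (('m \<Rightarrow> real) \<Rightarrow> real) set" where
  "tangent_space M x = {D.
     (\<forall>f\<in>C_inf M. \<forall>g\<in>C_inf M. D (f + g) = D f + D g) \<and>
     (\<forall>k. \<forall>f\<in>C_inf M. D (\<lambda>y. k * f y) = k * D f) \<and>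
     (\<forall>f\<in>C_inf M. \<forall>g\<in>C_inf M. D (f * g) = f x * D g + g x * D f)}"


section \<open>Vector bundles\<close>

text \<open>
  The fibres of a vector bundle are subspaces of one real vector space \<open>'v\<close>, which is arbitrary
  (possibly infinite-dimensional), so that this is no restriction: take for \<open>'v\<close> the direct
  sum of all the fibres.  A local trivialisation over the open set \<open>U\<close> is given as a frame:
  \<open>(U, r, e)\<close> stands for \<open>U \<times> \<real>\<^sup>r \<rightarrow> E|\<^sub>U\<close>, \<open>(x, t) \<mapsto> \<Sum>i<r. t\<^sub>i e\<^sub>i(x)\<close>.
  The rank may be 0.
\<close>

record ('m, 'v) vbundle =
  fib :: "'m \<Rightarrow> 'v set"
  frames :: "('m set \<times> nat \<times> (nat \<Rightarrow> 'm \<Rightarrow> 'v)) set"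

definition vector_bundle ::
  "('m::topological_space) manifold \<Rightarrow> ('m, 'v::real_vector) vbundle \<Rightarrow> bool" where
  "vector_bundle M E \<longleftrightarrow>
     (\<forall>x. subspace (fib E x)) \<and>
     (\<Union>(U, r, e)\<in>frames E. U) = UNIV \<and>
     (\<forall>(U, r, e)\<in>frames E. open U \<and>
        (\<forall>x\<in>U. inj_on (\<lambda>i. e i x) {..<r} \<and> independent ((\<lambda>i. e i x) ` {..<r}) \<and>
               span ((\<lambda>i. e i x) ` {..<r}) = fib E x)) \<and>
     (\<forall>(U, r, e)\<in>frames E. \<forall>(V, s, d)\<in>frames E.
        \<exists>g. (\<forall>i<r. \<forall>j<s. smooth_on_mfd M (U \<inter> V) (g i j)) \<and>
            (\<forall>x\<in>U \<inter> V. \<forall>j<s. d j x = (\<Sum>i<r. g i j x *\<^sub>R e i x)))"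

definition sections :: "'m manifold \<Rightarrow> ('m, 'v::real_vector) vbundle \<Rightarrow> ('m \<Rightarrow> 'v) set" where
  "sections M E = {s. (\<forall>x. s x \<in> fib E x) \<and>
     (\<forall>(U, r, e)\<in>frames E. \<exists>c. (\<forall>i<r. smooth_on_mfd M U (c i)) \<and>
        (\<forall>x\<in>U. s x = (\<Sum>i<r. c i x *\<^sub>R e i x)))}"

definition scl :: "('m \<Rightarrow> real) \<Rightarrow> ('m \<Rightarrow> 'v::real_vector) \<Rightarrow> ('m \<Rightarrow> 'v)" (infixr \<open>\<cdot>\<close> 75) where
  "f \<cdot> s = (\<lambda>x. f x *\<^sub>R s x)"

definition pair_sec :: "('m \<Rightarrow> 'a) \<Rightarrow> ('m \<Rightarrow> 'b) \<Rightarrow> ('m \<Rightarrow> 'a \<times> 'b)" where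
  "pair_sec a b = (\<lambda>x. (a x, b x))"

definition whitney_sum ::
  "('m, 'a::real_vector) vbundle \<Rightarrow> ('m, 'b::real_vector) vbundle \<Rightarrow> ('m, 'a \<times> 'b) vbundle"
  (infixr \<open>\<oplus>\<^sub>V\<close> 65) where
  "A \<oplus>\<^sub>V B = \<lparr> fib = (\<lambda>x. fib A x \<times> fib B x),
     frames = {(U \<inter> V, r + s, \<lambda>i x. if i < r then (e i x, 0) else (0, d (i - r) x)) | U r e V s d.
                 (U, r, e) \<in> frames A \<and> (V, s, d) \<in> frames B} \<rparr>"

definition fibre_linear :: "'v::real_vector set \<Rightarrow> 'w::real_vector set \<Rightarrow> ('v \<Rightarrow> 'w) \<Rightarrow> bool" where
  "fibre_linear S T f \<longleftrightarrow> (\<forall>v\<in>S. f v \<in> T) \<and>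
     (\<forall>v\<in>S. \<forall>w\<in>S. f (v + w) = f v + f w) \<and> (\<forall>k. \<forall>v\<in>S. f (k *\<^sub>R v) = k *\<^sub>R f v)"

text \<open>The maps on sections induced by fibrewise maps.\<close>

definition app1 :: "('m \<Rightarrow> 'v \<Rightarrow> 'w) \<Rightarrow> ('m \<Rightarrow> 'v) \<Rightarrow> ('m \<Rightarrow> 'w)" where
  "app1 \<phi> s = (\<lambda>x. \<phi> x (s x))"

definition app3 :: "('m \<Rightarrow> 'u \<Rightarrow> 'v \<Rightarrow> 'w \<Rightarrow> 'z) \<Rightarrow>
    ('m \<Rightarrow> 'u) \<Rightarrow> ('m \<Rightarrow> 'v) \<Rightarrow> ('m \<Rightarrow> 'w) \<Rightarrow> ('m \<Rightarrow> 'z)" where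
  "app3 \<omega> s1 s2 s3 = (\<lambda>x. \<omega> x (s1 x) (s2 x) (s3 x))"

definition bundle_map :: "'m manifold \<Rightarrow> ('m, 'v::real_vector) vbundle \<Rightarrow>
    ('m, 'w::real_vector) vbundle \<Rightarrow> ('m \<Rightarrow> 'v \<Rightarrow> 'w) \<Rightarrow> bool" where
  "bundle_map M E F \<phi> \<longleftrightarrow> (\<forall>x. fibre_linear (fib E x) (fib F x) (\<phi> x)) \<and>
     (\<forall>s\<in>sections M E. app1 \<phi> s \<in> sections M F)"

text \<open>Vector bundle maps \<open>E \<rightarrow> TM\<close>.\<close>

definition anchor_map :: "'m manifold \<Rightarrow> ('m, 'v::real_vector) vbundle \<Rightarrow>
    ('m \<Rightarrow> 'v \<Rightarrow> ('m \<Rightarrow> real) \<Rightarrow> real) \<Rightarrow> bool" where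
  "anchor_map M E \<rho> \<longleftrightarrow>
     (\<forall>x. \<forall>v\<in>fib E x. \<rho> x v \<in> tangent_space M x) \<and>
     (\<forall>x. \<forall>f\<in>C_inf M. fibre_linear (fib E x) UNIV (\<lambda>v. \<rho> x v f)) \<and>
     (\<forall>s\<in>sections M E. \<forall>f\<in>C_inf M. (\<lambda>x. \<rho> x (s x) f) \<in> C_inf M)"

text \<open>Smooth sections of the dual bundle \<open>E\<^sup>*\<close>.\<close>

definition dual_sections ::
  "'m manifold \<Rightarrow> ('m, 'v::real_vector) vbundle \<Rightarrow> ('m \<Rightarrow> 'v \<Rightarrow> real) set" where
  "dual_sections M E = {\<gamma>. (\<forall>x. fibre_linear (fib E x) UNIV (\<gamma> x)) \<and>
     (\<forall>s\<in>sections M E. app1 \<gamma> s \<in> C_inf M)}"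

text \<open>\<open>\<Omega>\<^sup>2(A, Hom(E, F))\<close> and \<open>\<Omega>\<^sup>3(A, E)\<close>.\<close>

definition Omega2_Hom :: "'m manifold \<Rightarrow> ('m, 'a::real_vector) vbundle \<Rightarrow>
    ('m, 'v::real_vector) vbundle \<Rightarrow> ('m, 'w::real_vector) vbundle \<Rightarrow>
    ('m \<Rightarrow> 'a \<Rightarrow> 'a \<Rightarrow> 'v \<Rightarrow> 'w) set" where
  "Omega2_Hom M A E F = {R.
     (\<forall>x. \<forall>a1\<in>fib A x. \<forall>a2\<in>fib A x. \<forall>e\<in>fib E x.
        fibre_linear (fib A x) (fib F x) (\<lambda>a. R x a a2 e) \<and>
        fibre_linear (fib A x) (fib F x) (\<lambda>a. R x a1 a e) \<and>
        fibre_linear (fib E x) (fib F x) (R x a1 a2) \<and>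
        R x a1 a2 e = - R x a2 a1 e) \<and>
     (\<forall>a1\<in>sections M A. \<forall>a2\<in>sections M A. \<forall>e\<in>sections M E. app3 R a1 a2 e \<in> sections M F)}"

definition Omega3 :: "'m manifold \<Rightarrow> ('m, 'a::real_vector) vbundle \<Rightarrow>
    ('m, 'v::real_vector) vbundle \<Rightarrow> ('m \<Rightarrow> 'a \<Rightarrow> 'a \<Rightarrow> 'a \<Rightarrow> 'v) set" where
  "Omega3 M A E = {\<omega>.
     (\<forall>x. \<forall>a1\<in>fib A x. \<forall>a2\<in>fib A x. \<forall>a3\<in>fib A x.
        fibre_linear (fib A x) (fib E x) (\<lambda>a. \<omega> x a a2 a3) \<and>
        fibre_linear (fib A x) (fib E x) (\<lambda>a. \<omega> x a1 a a3) \<and>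
        fibre_linear (fib A x) (fib E x) (\<omega> x a1 a2) \<and>
        \<omega> x a1 a2 a3 = - \<omega> x a2 a1 a3 \<and> \<omega> x a1 a2 a3 = - \<omega> x a1 a3 a2) \<and>
     (\<forall>a1\<in>sections M A. \<forall>a2\<in>sections M A. \<forall>a3\<in>sections M A. app3 \<omega> a1 a2 a3 \<in> sections M E)}"


section \<open>Brackets, connections and the Koszul formula\<close>

record ('m, 'a) algebroid =
  anchor :: "'m \<Rightarrow> 'a \<Rightarrow> ('m \<Rightarrow> real) \<Rightarrow> real"
  bracket :: "('m \<Rightarrow> 'a) \<Rightarrow> ('m \<Rightarrow> 'a) \<Rightarrow> ('m \<Rightarrow> 'a)"

definition act :: "('m, 'a, 'z) algebroid_scheme \<Rightarrow> ('m \<Rightarrow> 'a) \<Rightarrow> ('m \<Rightarrow> real) \<Rightarrow> ('m \<Rightarrow> real)" where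
  "act L q f = (\<lambda>x. anchor L x (q x) f)"

definition skew_dull_algebroid :: "('m::topological_space) manifold \<Rightarrow>
    ('m, 'a::real_vector) vbundle \<Rightarrow> ('m, 'a, 'z) algebroid_scheme \<Rightarrow> bool" where
  "skew_dull_algebroid M Q L \<longleftrightarrow>
     vector_bundle M Q \<and> anchor_map M Q (anchor L) \<and>
     (\<forall>q\<in>sections M Q. \<forall>q1\<in>sections M Q. \<forall>q2\<in>sections M Q.
        bracket L q1 q2 \<in> sections M Q \<and>
        bracket L (q1 + q2) q = bracket L q1 q + bracket L q2 q \<and>
        bracket L q (q1 + q2) = bracket L q q1 + bracket L q q2 \<and>
        (\<forall>k. bracket L ((\<lambda>_. k) \<cdot> q1) q2 = (\<lambda>_. k) \<cdot> bracket L q1 q2) \<and>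
        (\<forall>k. bracket L q1 ((\<lambda>_. k) \<cdot> q2) = (\<lambda>_. k) \<cdot> bracket L q1 q2) \<and>
        bracket L q1 q2 = - bracket L q2 q1 \<and>
        (\<forall>f\<in>C_inf M. act L (bracket L q1 q2) f = act L q1 (act L q2 f) - act L q2 (act L q1 f)) \<and>
        (\<forall>f\<in>C_inf M. bracket L q1 (f \<cdot> q2) = f \<cdot> bracket L q1 q2 + act L q1 f \<cdot> q2))"

definition Jac :: "('s \<Rightarrow> 's \<Rightarrow> 's) \<Rightarrow> 's \<Rightarrow> 's \<Rightarrow> 's \<Rightarrow> 's::ab_group_add" where
  "Jac br q1 q2 q3 = br (br q1 q2) q3 + br q2 (br q1 q3) - br q1 (br q2 q3)"

definition lie_algebroid :: "('m::topological_space) manifold \<Rightarrow>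
    ('m, 'a::real_vector) vbundle \<Rightarrow> ('m, 'a, 'z) algebroid_scheme \<Rightarrow> bool" where
  "lie_algebroid M A L \<longleftrightarrow> skew_dull_algebroid M A L \<and>
     (\<forall>a1\<in>sections M A. \<forall>a2\<in>sections M A. \<forall>a3\<in>sections M A. Jac (bracket L) a1 a2 a3 = 0)"

definition connection :: "'m manifold \<Rightarrow> ('m, 'a::real_vector) vbundle \<Rightarrow>
    ('m, 'a, 'z) algebroid_scheme \<Rightarrow> ('m, 'v::real_vector) vbundle \<Rightarrow>
    (('m \<Rightarrow> 'a) \<Rightarrow> ('m \<Rightarrow> 'v) \<Rightarrow> ('m \<Rightarrow> 'v)) \<Rightarrow> bool" where
  "connection M A L E nab \<longleftrightarrow>
     (\<forall>a\<in>sections M A. \<forall>a'\<in>sections M A. \<forall>e\<in>sections M E. \<forall>e'\<in>sections M E.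
        nab a e \<in> sections M E \<and>
        nab (a + a') e = nab a e + nab a' e \<and>
        nab a (e + e') = nab a e + nab a e' \<and>
        (\<forall>f\<in>C_inf M. nab (f \<cdot> a) e = f \<cdot> nab a e) \<and>
        (\<forall>k. nab a ((\<lambda>_. k) \<cdot> e) = (\<lambda>_. k) \<cdot> nab a e) \<and>
        (\<forall>f\<in>C_inf M. nab a (f \<cdot> e) = f \<cdot> nab a e + act L a f \<cdot> e))"

definition curvature :: "('s \<Rightarrow> 's \<Rightarrow> 's) \<Rightarrow> ('s \<Rightarrow> 't \<Rightarrow> 't) \<Rightarrow> 's \<Rightarrow> 's \<Rightarrow> 't \<Rightarrow> 't::ab_group_add" where
  "curvature br nab q1 q2 t = nab q1 (nab q2 t) - nab q2 (nab q1 t) - nab (br q1 q2) t"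

text \<open>
  The induced connections on \<open>E\<^sup>*\<close>, \<open>Hom(E, F)\<close> and \<open>\<wedge>\<^sup>2E\<^sup>* \<otimes> F\<close>.  Sections of these bundles enter
  as the maps they induce on sections of \<open>E\<close>.
\<close>

definition dual_conn :: "('m, 'a, 'z) algebroid_scheme \<Rightarrow>
    (('m \<Rightarrow> 'a) \<Rightarrow> ('m \<Rightarrow> 'v) \<Rightarrow> ('m \<Rightarrow> 'v)) \<Rightarrow>
    ('m \<Rightarrow> 'a) \<Rightarrow> (('m \<Rightarrow> 'v) \<Rightarrow> ('m \<Rightarrow> real)) \<Rightarrow> (('m \<Rightarrow> 'v) \<Rightarrow> ('m \<Rightarrow> real))" where
  "dual_conn L nab q \<xi> = (\<lambda>c. act L q (\<xi> c) - \<xi> (nab q c))"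

definition Hom_conn :: "('s \<Rightarrow> 't \<Rightarrow> 't) \<Rightarrow> ('s \<Rightarrow> 'u \<Rightarrow> 'u) \<Rightarrow> 's \<Rightarrow> ('t \<Rightarrow> 'u) \<Rightarrow> ('t \<Rightarrow> 'u::ab_group_add)"
  where "Hom_conn nabE nabF a \<Phi> = (\<lambda>e. nabF a (\<Phi> e) - \<Phi> (nabE a e))"

definition wedge2_conn :: "('s \<Rightarrow> 't \<Rightarrow> 't) \<Rightarrow> ('s \<Rightarrow> 'u \<Rightarrow> 'u) \<Rightarrow>
    's \<Rightarrow> ('t \<Rightarrow> 't \<Rightarrow> 'u) \<Rightarrow> ('t \<Rightarrow> 't \<Rightarrow> 'u::ab_group_add)" where
  "wedge2_conn nabE nabF a \<xi> = (\<lambda>e1 e2. nabF a (\<xi> e1 e2) - \<xi> (nabE a e1) e2 - \<xi> e1 (nabE a e2))"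

text \<open>The Koszul formula for \<open>d\<^sub>\<nabla>\<close> on forms of degree 1, 2 and 3.\<close>

definition d1 :: "('s \<Rightarrow> 's \<Rightarrow> 's) \<Rightarrow> ('s \<Rightarrow> 't \<Rightarrow> 't) \<Rightarrow> ('s \<Rightarrow> 't) \<Rightarrow> 's \<Rightarrow> 's \<Rightarrow> 't::ab_group_add" where
  "d1 br nab \<omega> q1 q2 = nab q1 (\<omega> q2) - nab q2 (\<omega> q1) - \<omega> (br q1 q2)"

definition d2 :: "('s \<Rightarrow> 's \<Rightarrow> 's) \<Rightarrow> ('s \<Rightarrow> 't \<Rightarrow> 't) \<Rightarrow> ('s \<Rightarrow> 's \<Rightarrow> 't) \<Rightarrow>
    's \<Rightarrow> 's \<Rightarrow> 's \<Rightarrow> 't::ab_group_add" where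
  "d2 br nab \<omega> q1 q2 q3 =
     nab q1 (\<omega> q2 q3) - nab q2 (\<omega> q1 q3) + nab q3 (\<omega> q1 q2)
     - \<omega> (br q1 q2) q3 + \<omega> (br q1 q3) q2 - \<omega> (br q2 q3) q1"

definition d3 :: "('s \<Rightarrow> 's \<Rightarrow> 's) \<Rightarrow> ('s \<Rightarrow> 't \<Rightarrow> 't) \<Rightarrow> ('s \<Rightarrow> 's \<Rightarrow> 's \<Rightarrow> 't) \<Rightarrow>
    's \<Rightarrow> 's \<Rightarrow> 's \<Rightarrow> 's \<Rightarrow> 't::ab_group_add" where
  "d3 br nab \<omega> q1 q2 q3 q4 =
     nab q1 (\<omega> q2 q3 q4) - nab q2 (\<omega> q1 q3 q4) + nab q3 (\<omega> q1 q2 q4) - nab q4 (\<omega> q1 q2 q3)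
     - \<omega> (br q1 q2) q3 q4 + \<omega> (br q1 q3) q2 q4 - \<omega> (br q1 q4) q2 q3
     - \<omega> (br q2 q3) q1 q4 + \<omega> (br q2 q4) q1 q3 - \<omega> (br q3 q4) q1 q2"


section \<open>2-representations and matched pairs\<close>

record ('m, 'a, 'v, 'w) rep2 =
  bdry :: "'m \<Rightarrow> 'v \<Rightarrow> 'w"
  conn0 :: "('m \<Rightarrow> 'a) \<Rightarrow> ('m \<Rightarrow> 'v) \<Rightarrow> ('m \<Rightarrow> 'v)"
  conn1 :: "('m \<Rightarrow> 'a) \<Rightarrow> ('m \<Rightarrow> 'w) \<Rightarrow> ('m \<Rightarrow> 'w)"
  curv :: "'m \<Rightarrow> 'a \<Rightarrow> 'a \<Rightarrow> 'w \<Rightarrow> 'v"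

definition two_representation :: "('m::topological_space) manifold \<Rightarrow>
    ('m, 'a::real_vector) vbundle \<Rightarrow> ('m, 'a) algebroid \<Rightarrow>
    ('m, 'v::real_vector) vbundle \<Rightarrow> ('m, 'w::real_vector) vbundle \<Rightarrow>
    ('m, 'a, 'v, 'w) rep2 \<Rightarrow> bool" where
  "two_representation M A L E0 E1 r \<longleftrightarrow>
     lie_algebroid M A L \<and> vector_bundle M E0 \<and> vector_bundle M E1 \<and>
     bundle_map M E0 E1 (bdry r) \<and>
     connection M A L E0 (conn0 r) \<and> connection M A L E1 (conn1 r) \<and>
     (\<forall>a\<in>sections M A. \<forall>e\<in>sections M E0. app1 (bdry r) (conn0 r a e) = conn1 r a (app1 (bdry r) e)) \<and>
     curv r \<in> Omega2_Hom M A E1 E0 \<and>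
     (\<forall>a1\<in>sections M A. \<forall>a2\<in>sections M A. \<forall>e\<in>sections M E0.
        curvature (bracket L) (conn0 r) a1 a2 e = app3 (curv r) a1 a2 (app1 (bdry r) e)) \<and>
     (\<forall>a1\<in>sections M A. \<forall>a2\<in>sections M A. \<forall>e\<in>sections M E1.
        curvature (bracket L) (conn1 r) a1 a2 e = app1 (bdry r) (app3 (curv r) a1 a2 e)) \<and>
     (\<forall>a1\<in>sections M A. \<forall>a2\<in>sections M A. \<forall>a3\<in>sections M A. \<forall>e\<in>sections M E1.
        d2 (bracket L) (Hom_conn (conn1 r) (conn0 r)) (app3 (curv r)) a1 a2 a3 e = 0)"

definition matched_pair :: "('m::topological_space) manifold \<Rightarrow>
    ('m, 'a::real_vector) vbundle \<Rightarrow> ('m, 'b::real_vector) vbundle \<Rightarrow> ('m, 'c::real_vector) vbundle \<Rightarrow>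
    ('m, 'a) algebroid \<Rightarrow> ('m, 'b) algebroid \<Rightarrow>
    ('m, 'a, 'c, 'b) rep2 \<Rightarrow> ('m, 'b, 'c, 'a) rep2 \<Rightarrow> bool" where
  "matched_pair M A B C LA LB rA rB \<longleftrightarrow>
     two_representation M A LA C B rA \<and> two_representation M B LB C A rB \<and>
     (let dB = app1 (bdry rA); dA = app1 (bdry rB);
          AC = conn0 rA; AB = conn1 rA; BC = conn0 rB; BA = conn1 rB;
          RA = app3 (curv rA); RB = app3 (curv rB);
          brA = bracket LA; brB = bracket LB
      in
       (\<forall>c1\<in>sections M C. \<forall>c2\<in>sections M C.
          AC (dA c1) c2 - BC (dB c2) c1 = - (AC (dA c2) c1 - BC (dB c1) c2)) \<and>
       (\<forall>a\<in>sections M A. \<forall>c\<in>sections M C. brA a (dA c) = dA (AC a c) - BA (dB c) a) \<and>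
       (\<forall>b\<in>sections M B. \<forall>c\<in>sections M C. brB b (dB c) = dB (BC b c) - AB (dA c) b) \<and>
       (\<forall>a\<in>sections M A. \<forall>b\<in>sections M B. \<forall>c\<in>sections M C.
          BC b (AC a c) - AC a (BC b c) - AC (BA b a) c + BC (AB a b) c
            = RB b (dB c) a - RA a (dA c) b) \<and>
       (\<forall>a1\<in>sections M A. \<forall>a2\<in>sections M A. \<forall>b\<in>sections M B.
          dA (RA a1 a2 b) = - BA b (brA a1 a2) + brA (BA b a1) a2 + brA a1 (BA b a2)
            + BA (AB a2 b) a1 - BA (AB a1 b) a2) \<and>
       (\<forall>b1\<in>sections M B. \<forall>b2\<in>sections M B. \<forall>a\<in>sections M A.
          dB (RB b1 b2 a) = - AB a (brB b1 b2) + brB (AB a b1) b2 + brB b1 (AB a b2)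
            + AB (BA b2 a) b1 - AB (BA b1 a) b2) \<and>
       (\<forall>a1\<in>sections M A. \<forall>a2\<in>sections M A. \<forall>b1\<in>sections M B. \<forall>b2\<in>sections M B.
          d1 brA (wedge2_conn AB AC) (\<lambda>a b b'. RB b b' a) a1 a2 b1 b2
            = d1 brB (wedge2_conn BA BC) (\<lambda>b a a'. RA a a' b) b1 b2 a1 a2))"


section \<open>Split Lie 2-algebroids and the bicrossproduct\<close>

record ('m, 'q, 'c) split2 = "('m, 'q) algebroid" +
  lmap :: "'m \<Rightarrow> 'c \<Rightarrow> 'q"
  conn :: "('m \<Rightarrow> 'q) \<Rightarrow> ('m \<Rightarrow> 'c) \<Rightarrow> ('m \<Rightarrow> 'c)"
  omega :: "'m \<Rightarrow> 'q \<Rightarrow> 'q \<Rightarrow> 'q \<Rightarrow> 'c"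

text \<open>
  In the clause on the dual connection both sides, sections of \<open>C\<^sup>*\<close>, are evaluated on \<open>c \<in> \<Gamma>(C)\<close>; the right-hand side
  \<open>l\<^sup>*\<langle>\<omega>(q1, q2, \<cdot>), \<gamma>\<rangle>\<close> is then \<open>\<langle>\<omega>(q1, q2, l c), \<gamma>\<rangle>\<close>.
\<close>

definition split_Lie_2_algebroid :: "('m::topological_space) manifold \<Rightarrow>
    ('m, 'q::real_vector) vbundle \<Rightarrow> ('m, 'c::real_vector) vbundle \<Rightarrow> ('m, 'q, 'c) split2 \<Rightarrow> bool" where
  "split_Lie_2_algebroid M Q C S \<longleftrightarrow>
     skew_dull_algebroid M Q S \<and> vector_bundle M C \<and>
     bundle_map M C Q (lmap S) \<and> connection M Q S C (conn S) \<and> omega S \<in> Omega3 M Q C \<and>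
     (\<forall>c1\<in>sections M C. \<forall>c2\<in>sections M C.
        conn S (app1 (lmap S) c1) c2 + conn S (app1 (lmap S) c2) c1 = 0) \<and>
     (\<forall>q\<in>sections M Q. \<forall>c\<in>sections M C.
        bracket S q (app1 (lmap S) c) = app1 (lmap S) (conn S q c)) \<and>
     (\<forall>q1\<in>sections M Q. \<forall>q2\<in>sections M Q. \<forall>q3\<in>sections M Q.
        Jac (bracket S) q1 q2 q3 = app1 (lmap S) (app3 (omega S) q1 q2 q3)) \<and>
     (\<forall>q1\<in>sections M Q. \<forall>q2\<in>sections M Q. \<forall>\<gamma>\<in>dual_sections M C. \<forall>c\<in>sections M C.
        curvature (bracket S) (dual_conn S (conn S)) q1 q2 (app1 \<gamma>) c
          = app1 \<gamma> (app3 (omega S) q1 q2 (app1 (lmap S) c))) \<and>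
     (\<forall>q1\<in>sections M Q. \<forall>q2\<in>sections M Q. \<forall>q3\<in>sections M Q. \<forall>q4\<in>sections M Q.
        d3 (bracket S) (conn S) (app3 (omega S)) q1 q2 q3 q4 = 0)"

text \<open>Two structures on the same bundles are equal when all their components agree.\<close>

definition same_split2 :: "'m manifold \<Rightarrow> ('m, 'q::real_vector) vbundle \<Rightarrow>
    ('m, 'c::real_vector) vbundle \<Rightarrow> ('m, 'q, 'c) split2 \<Rightarrow> ('m, 'q, 'c) split2 \<Rightarrow> bool" where
  "same_split2 M Q C S T \<longleftrightarrow>
     (\<forall>x. \<forall>q\<in>fib Q x. \<forall>f\<in>C_inf M. anchor S x q f = anchor T x q f) \<and>
     (\<forall>q1\<in>sections M Q. \<forall>q2\<in>sections M Q. bracket S q1 q2 = bracket T q1 q2) \<and>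
     (\<forall>x. \<forall>c\<in>fib C x. lmap S x c = lmap T x c) \<and>
     (\<forall>q\<in>sections M Q. \<forall>c\<in>sections M C. conn S q c = conn T q c) \<and>
     (\<forall>x. \<forall>q1\<in>fib Q x. \<forall>q2\<in>fib Q x. \<forall>q3\<in>fib Q x. omega S x q1 q2 q3 = omega T x q1 q2 q3)"

definition bicrossproduct ::
  "('m, 'a::real_vector) algebroid \<Rightarrow> ('m, 'b::real_vector) algebroid \<Rightarrow>
   ('m, 'a, 'c::real_vector, 'b) rep2 \<Rightarrow> ('m, 'b, 'c, 'a) rep2 \<Rightarrow> ('m, 'a \<times> 'b, 'c) split2" where
  "bicrossproduct LA LB rA rB = \<lparr>
     anchor = (\<lambda>x (a, b) f. anchor LA x a f + anchor LB x b f),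
     bracket = (\<lambda>q q'. let a = fst \<circ> q; b = snd \<circ> q; a' = fst \<circ> q'; b' = snd \<circ> q' in
        pair_sec (bracket LA a a' + conn1 rB b a' - conn1 rB b' a)
                 (bracket LB b b' + conn1 rA a b' - conn1 rA a' b)),
     lmap = (\<lambda>x c. (bdry rB x c, - bdry rA x c)),
     conn = (\<lambda>q c. conn0 rA (fst \<circ> q) c + conn0 rB (snd \<circ> q) c),
     omega = (\<lambda>x (a1, b1) (a2, b2) (a3, b3).
        curv rA x a1 a2 b3 + curv rA x a2 a3 b1 + curv rA x a3 a1 b2
        - curv rB x b1 b2 a3 - curv rB x b2 b3 a1 - curv rB x b3 b1 a2) \<rparr>"

text \<open>The structures that a split Lie 2-algebroid on \<open>(A \<oplus> B) \<oplus> C\<close> induces on \<open>A\<close> and \<open>B\<close>.\<close>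

definition restrict_A :: "('m, 'a \<times> 'b::real_vector, 'c) split2 \<Rightarrow> ('m, 'a) algebroid" where
  "restrict_A S = \<lparr> anchor = (\<lambda>x a. anchor S x (a, 0)),
     bracket = (\<lambda>a1 a2. fst \<circ> bracket S (pair_sec a1 0) (pair_sec a2 0)) \<rparr>"

definition restrict_B :: "('m, 'a::real_vector \<times> 'b, 'c) split2 \<Rightarrow> ('m, 'b) algebroid" where
  "restrict_B S = \<lparr> anchor = (\<lambda>x b. anchor S x (0, b)),
     bracket = (\<lambda>b1 b2. snd \<circ> bracket S (pair_sec 0 b1) (pair_sec 0 b2)) \<rparr>"

definition rep_A ::
  "('m, 'a::real_vector \<times> 'b::real_vector, 'c) split2 \<Rightarrow> ('m, 'a, 'c, 'b) rep2" where
  "rep_A S = \<lparr> bdry = (\<lambda>x c. - snd (lmap S x c)),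
     conn0 = (\<lambda>a c. conn S (pair_sec a 0) c),
     conn1 = (\<lambda>a b. snd \<circ> bracket S (pair_sec a 0) (pair_sec 0 b)),
     curv = (\<lambda>x a1 a2 b. omega S x (a1, 0) (a2, 0) (0, b)) \<rparr>"

definition rep_B ::
  "('m, 'a::real_vector \<times> 'b::real_vector, 'c::real_vector) split2 \<Rightarrow> ('m, 'b, 'c, 'a) rep2" where
  "rep_B S = \<lparr> bdry = (\<lambda>x c. fst (lmap S x c)),
     conn0 = (\<lambda>b c. conn S (pair_sec 0 b) c),
     conn1 = (\<lambda>b a. fst \<circ> bracket S (pair_sec 0 b) (pair_sec a 0)),
     curv = (\<lambda>x b1 b2 a. - omega S x (0, b1) (0, b2) (a, 0)) \<rparr>"

end

theory Submission
  imports Defs "HOL-Computational_Algebra.Polynomial"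
begin

text \<open>
  On sections, both structures are governed by the same multilinear identities. The defects of the
  split Lie 2-algebroid axioms (Jacobiator, curvature, \<open>d\<^sub>\<nabla>\<omega>\<close>) are additive and alternating in sections
  of \<open>A \<oplus> B\<close>, so they vanish as soon as they vanish on arguments that lie purely in \<open>A\<close> or purely in
  \<open>B\<close>; evaluated there, they are exactly the axioms of the two 2-representations and (M1)--(M7).
  Outside this algebra, analysis enters through bump functions: sections exist through
  every vector, and sections of \<open>C\<^sup>*\<close> separate points, which turns the axiom on the dual connection into
  \<open>R\<^sub>\<nabla>(q1, q2) c = - \<omega>(q1, q2, l c)\<close>. That the anchor of the bicrossproduct preserves brackets is not
  among the axioms of a matched pair but follows from (M5) and (M6) by the Leibniz rule.
\<close>


section \<open>Smooth functions\<close>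

text \<open>One equivalence serves both directions: for data of the right types, the bicrossproduct
  satisfies the identities of a split Lie 2-algebroid if and only if the data form a matched pair.
  In (II) the given structure must therefore be recognised as the bicrossproduct of its own
  restrictions. The two hypotheses of (II) do exactly this: they remove the components of bracket
  and form for which a bicrossproduct has no room. Brackets and connections are total functions on
  arbitrary maps and are controlled on smooth sections only. Hence the algebra runs relative to
  additive subgroups, with sums and signs but no scalars, and every rewriting step carries
  membership conditions. Functions reenter through the Leibniz rules, notably for the anchor. That
  argument divides by a nonzero vector of one fibre, so points where both fibres are zero are
  treated apart: there both anchors vanish. Vector bundle maps and forms are fibrewise objects,
  whereas the identities speak of sections. Sections through prescribed vectors carry the hypotheses
  on the 3-form from sections to fibres.\<close>

abbreviation eucl_sp :: "nat \<Rightarrow> (nat \<Rightarrow> real) set" where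
  "eucl_sp n \<equiv> {y. \<forall>i\<ge>n. y i = 0}"

section \<open>Iterated partial derivatives on open subsets of the model space\<close>

lemma Euclidean_space_eq: "Euclidean_space n = top_of_set (eucl_sp n)"
  by (simp add: Euclidean_space_def euclidean_product_topology)

lemma C_k_imp_continuous: "C_k n W k f \<Longrightarrow> continuous_on W f"
  by (cases k) auto

lemma C_k_SucE:
  assumes "C_k n W (Suc k) f" "i < n"
  obtains g where "\<forall>y\<in>W. ((\<lambda>t. f (y(i := t))) has_real_derivative g y) (at (y i))"
    and "C_k n W k g"
proof -
  have "\<forall>i<n. \<exists>g. (\<forall>y\<in>W. ((\<lambda>t. f (y(i := t))) has_real_derivative g y) (at (y i))) \<and> C_k n W k g"
    using assms(1) by simp
  then show thesis using assms(2) that by blast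
qed

lemma C_k_SucI:
  assumes "continuous_on W f"
    and "\<And>i. i < n \<Longrightarrow> \<exists>g. (\<forall>y\<in>W. ((\<lambda>t. f (y(i := t))) has_real_derivative g y) (at (y i))) \<and> C_k n W k g"
  shows "C_k n W (Suc k) f"
  using assms by simp

lemma C_k_subset: "C_k n W k f \<Longrightarrow> W' \<subseteq> W \<Longrightarrow> C_k n W' k f"
proof (induction k arbitrary: f)
  case 0
  then show ?case by (auto intro: continuous_on_subset)
next
  case (Suc k)
  have "\<exists>g. (\<forall>y\<in>W'. ((\<lambda>t. f (y(i := t))) has_real_derivative g y) (at (y i))) \<and> C_k n W' k g"
    if i: "i < n" for i
  proof -
    obtain g where "\<forall>y\<in>W. ((\<lambda>t. f (y(i := t))) has_real_derivative g y) (at (y i))" "C_k n W k g"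
      by (rule C_k_SucE[OF Suc.prems(1) i])
    then show ?thesis using Suc.IH[of g] Suc.prems(2) by blast
  qed
  then show ?case
    by (intro C_k_SucI continuous_on_subset[OF C_k_imp_continuous[OF Suc.prems(1)] Suc.prems(2)]) blast
qed

text \<open>The recursion in \<open>C_k\<close> peels off the outermost derivative, whereas the
  order has to drop at the innermost one. Hence the induction with \<open>f\<close>
  arbitrary.\<close>

lemma C_k_Suc_imp: "C_k n W (Suc k) f \<Longrightarrow> C_k n W k f"
proof (induction k arbitrary: f)
  case (Suc k)
  have "\<exists>g. (\<forall>y\<in>W. ((\<lambda>t. f (y(i := t))) has_real_derivative g y) (at (y i))) \<and> C_k n W k g"
    if i: "i < n" for i
  proof -
    obtain g where "\<forall>y\<in>W. ((\<lambda>t. f (y(i := t))) has_real_derivative g y) (at (y i))"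
      and "C_k n W (Suc k) g"
      by (rule C_k_SucE[OF Suc.prems i])
    then show ?thesis using Suc.IH by blast
  qed
  moreover have "continuous_on W f" using Suc.prems by (rule C_k_imp_continuous)
  ultimately show ?case by (intro C_k_SucI) blast+
qed auto

lemma C_k_const: "C_k n W k (\<lambda>_. c)"
proof (induction k arbitrary: c)
  case (Suc k)
  show ?case
  proof (rule C_k_SucI)
    show "\<exists>g. (\<forall>y\<in>W. ((\<lambda>_. c) has_real_derivative g y) (at (y i))) \<and> C_k n W k g" for i
      using Suc[of 0] by (intro exI[of _ "\<lambda>_. 0"]) auto
  qed auto
qed auto

lemma C_k_add: "C_k n W k f \<Longrightarrow> C_k n W k g \<Longrightarrow> C_k n W k (\<lambda>y. f y + g y)"
proof (induction k arbitrary: f g)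
  case (Suc k)
  have "\<exists>h. (\<forall>y\<in>W. ((\<lambda>t. f (y(i := t)) + g (y(i := t))) has_real_derivative h y) (at (y i))) \<and> C_k n W k h"
    if i: "i < n" for i
  proof -
    obtain f' where f': "\<forall>y\<in>W. ((\<lambda>t. f (y(i := t))) has_real_derivative f' y) (at (y i))" "C_k n W k f'"
      by (rule C_k_SucE[OF Suc.prems(1) i])
    obtain g' where g': "\<forall>y\<in>W. ((\<lambda>t. g (y(i := t))) has_real_derivative g' y) (at (y i))" "C_k n W k g'"
      by (rule C_k_SucE[OF Suc.prems(2) i])
    show ?thesis
      using f' g' Suc.IH[of f' g'] by (intro exI[of _ "\<lambda>y. f' y + g' y"]) (simp add: DERIV_add del: fun_upd_apply)
  qed
  then show ?case
    by (intro C_k_SucI continuous_on_add Suc.prems[THEN C_k_imp_continuous]) blast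
qed (auto intro: continuous_on_add)

lemma C_k_mult: "C_k n W k f \<Longrightarrow> C_k n W k g \<Longrightarrow> C_k n W k (\<lambda>y. f y * g y)"
proof (induction k arbitrary: f g)
  case (Suc k)
  have "\<exists>h. (\<forall>y\<in>W. ((\<lambda>t. f (y(i := t)) * g (y(i := t))) has_real_derivative h y) (at (y i))) \<and> C_k n W k h"
    if i: "i < n" for i
  proof -
    obtain f' where f': "\<forall>y\<in>W. ((\<lambda>t. f (y(i := t))) has_real_derivative f' y) (at (y i))" "C_k n W k f'"
      by (rule C_k_SucE[OF Suc.prems(1) i])
    obtain g' where g': "\<forall>y\<in>W. ((\<lambda>t. g (y(i := t))) has_real_derivative g' y) (at (y i))" "C_k n W k g'"
      by (rule C_k_SucE[OF Suc.prems(2) i])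
    \<comment> \<open>In the product rule each summand pairs a derivative of order k with an
      undifferentiated factor of order k + 1. Lowering the latter brings both factors to order k,
      where the induction hypothesis applies.\<close>
    have "C_k n W k (\<lambda>y. f y * g' y + f' y * g y)"
      by (intro C_k_add Suc.IH C_k_Suc_imp[OF Suc.prems(1)] C_k_Suc_imp[OF Suc.prems(2)] f'(2) g'(2))
    moreover have "\<forall>y\<in>W. ((\<lambda>t. f (y(i := t)) * g (y(i := t))) has_real_derivative f y * g' y + f' y * g y) (at (y i))"
    proof
      fix y assume y: "y \<in> W"
      show "((\<lambda>t. f (y(i := t)) * g (y(i := t))) has_real_derivative f y * g' y + f' y * g y) (at (y i))"
        using DERIV_mult'[OF f'(1)[rule_format, OF y] g'(1)[rule_format, OF y]] by (simp only: fun_upd_triv)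
    qed
    ultimately show ?thesis by (intro exI[of _ "\<lambda>y. f y * g' y + f' y * g y"] conjI)
  qed
  then show ?case
    by (intro C_k_SucI continuous_on_mult Suc.prems[THEN C_k_imp_continuous]) blast
qed (auto intro: continuous_on_mult)

text \<open>Moving a coordinate below \<open>n\<close> does not leave the model space, so a
  relatively open set contains a piece of each coordinate line through its points. Partial
  derivatives on \<open>W\<close> thus depend on the values of the function on \<open>W\<close>
  alone, although they are two-sided derivatives of a function on all sequences.\<close>

lemma eventually_coordinate_line:
  assumes "openin (Euclidean_space n) W" "y \<in> W" "i < n"
  shows "eventually (\<lambda>t. y(i := t) \<in> W) (nhds (y i))"
proof -
  obtain T where T: "open T" "W = T \<inter> eucl_sp n"
    using assms(1) unfolding Euclidean_space_eq openin_open by blast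
  have "continuous_on UNIV (\<lambda>t. (y(i := t)) j)" for j
    by (cases "j = i") auto
  then have "continuous_on UNIV (\<lambda>t. y(i := t))"
    by (rule continuous_on_coordinatewise_then_product)
  then have "open ((\<lambda>t. y(i := t)) -` T)"
    using T(1) by (simp add: open_vimage)
  moreover have "y i \<in> (\<lambda>t. y(i := t)) -` T" using T assms by auto
  ultimately have "eventually (\<lambda>t. t \<in> (\<lambda>t. y(i := t)) -` T) (nhds (y i))"
    by (rule eventually_nhds_in_open)
  then show ?thesis
    by eventually_elim (use T assms in auto)
qed

text \<open>The obstacle is that \<open>C_k\<close> asks for one derivative on all of
  \<open>W\<close>, while the neighbourhoods supply only local ones. Uniqueness of derivatives glues
  them.\<close>

lemma C_k_local:
  assumes "openin (Euclidean_space n) W"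
    and "\<And>y. y \<in> W \<Longrightarrow> \<exists>W' f'. openin (Euclidean_space n) W' \<and> y \<in> W' \<and> W' \<subseteq> W \<and>
          C_k n W' k f' \<and> (\<forall>z\<in>W'. f z = f' z)"
  shows "C_k n W k f"
  using assms(2)
proof (induction k arbitrary: f)
  case cont: 0
  have "continuous (at y within W) f" if y: "y \<in> W" for y
  proof -
    obtain W' f' where W': "openin (Euclidean_space n) W'" "y \<in> W'" "W' \<subseteq> W"
      "continuous_on W' f'" "\<forall>z\<in>W'. f z = f' z"
      using cont[OF y] by auto
    obtain T where T: "open T" "W' = T \<inter> eucl_sp n"
      using W'(1) unfolding Euclidean_space_eq openin_open by blast
    have "W \<subseteq> eucl_sp n"
      using assms(1) unfolding Euclidean_space_eq openin_open by blast
    then have "at y within W = at y within W'"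
      using T W' by (intro at_within_nhd[of y T]) auto
    moreover have "continuous_on W' f" using W' continuous_on_cong by metis
    ultimately show ?thesis using W'(2) by (simp add: continuous_on_eq_continuous_within)
  qed
  then show ?case by (simp add: continuous_on_eq_continuous_within)
next
  case (Suc k)
  have "C_k n W k f"
  proof (rule Suc.IH)
    fix y assume "y \<in> W"
    then obtain W' f' where W': "openin (Euclidean_space n) W'" "y \<in> W'" "W' \<subseteq> W"
      "C_k n W' (Suc k) f'" "\<forall>z\<in>W'. f z = f' z"
      using Suc.prems by metis
    show "\<exists>W' f'. openin (Euclidean_space n) W' \<and> y \<in> W' \<and> W' \<subseteq> W \<and> C_k n W' k f' \<and>
        (\<forall>z\<in>W'. f z = f' z)"
      by (intro exI[of _ W'] exI[of _ f'] conjI W' C_k_Suc_imp[OF W'(4)])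
  qed
  then have "continuous_on W f" by (rule C_k_imp_continuous)
  moreover have "\<exists>g. (\<forall>y\<in>W. ((\<lambda>t. f (y(i := t))) has_real_derivative g y) (at (y i))) \<and> C_k n W k g"
    if i: "i < n" for i
  proof -
    \<comment> \<open>The candidate is the partial derivative itself, picked by \<open>THE\<close>.
      It agrees with every local derivative \<open>g'\<close>, so it has order k by the induction
      hypothesis.\<close>
    define D where "D y d \<longleftrightarrow> ((\<lambda>t. f (y(i := t))) has_real_derivative d) (at (y i))" for y d
    define g where "g y = (THE d. D y d)" for y
    have g_eq: "g y = d" if "D y d" for y d
      unfolding g_def using that by (rule the_equality) (use that in \<open>auto simp: D_def intro: DERIV_unique\<close>)
    have loc: "\<exists>W' g'. openin (Euclidean_space n) W' \<and> y \<in> W' \<and> W' \<subseteq> W \<and> C_k n W' k g' \<and>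
        (\<forall>z\<in>W'. D z (g' z))"
      if y: "y \<in> W" for y
    proof -
      obtain W' f' where W': "openin (Euclidean_space n) W'" "y \<in> W'" "W' \<subseteq> W"
        "C_k n W' (Suc k) f'" "\<forall>z\<in>W'. f z = f' z"
        using Suc.prems[OF y] by metis
      obtain g' where g': "\<forall>z\<in>W'. ((\<lambda>t. f' (z(i := t))) has_real_derivative g' z) (at (z i))"
        "C_k n W' k g'"
        by (rule C_k_SucE[OF W'(4) i])
      have "D z (g' z)" if z: "z \<in> W'" for z
      proof -
        have "eventually (\<lambda>t. f (z(i := t)) = f' (z(i := t))) (nhds (z i))"
          using eventually_coordinate_line[OF W'(1) z i] by eventually_elim (use W'(5) in blast)
        from DERIV_cong_ev[OF refl this refl] show ?thesis
          using g'(1) z unfolding D_def by simp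
      qed
      then show ?thesis using W' g'(2) by metis
    qed
    have "C_k n W k g"
    proof (rule Suc.IH)
      fix y assume "y \<in> W"
      then obtain W' g' where "openin (Euclidean_space n) W'" "y \<in> W'" "W' \<subseteq> W" "C_k n W' k g'"
        "\<forall>z\<in>W'. D z (g' z)"
        using loc by metis
      then show "\<exists>W' g'. openin (Euclidean_space n) W' \<and> y \<in> W' \<and> W' \<subseteq> W \<and> C_k n W' k g' \<and>
          (\<forall>z\<in>W'. g z = g' z)"
        using g_eq by (intro exI[of _ W'] exI[of _ g']) blast
    qed
    moreover have "\<forall>y\<in>W. D y (g y)"
      using loc g_eq by metis
    ultimately show ?thesis unfolding D_def by (intro exI[of _ g] conjI)
  qed
  ultimately show ?case by (rule C_k_SucI)
qed

section \<open>Smooth functions on open subsets of the manifold\<close>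

lemma smooth_on_mfd_iff:
  "smooth_on_mfd M W f \<longleftrightarrow> (\<forall>U \<phi> k. (U, \<phi>) \<in> charts M \<longrightarrow>
     C_k (mdim M) (\<phi> ` (U \<inter> W)) k (\<lambda>y. f (inv_into U \<phi> y)))"
  by (auto simp: smooth_on_mfd_def smooth_Eucl_def)

lemma smooth_on_mfd_subset: "smooth_on_mfd M W f \<Longrightarrow> W' \<subseteq> W \<Longrightarrow> smooth_on_mfd M W' f"
  unfolding smooth_on_mfd_iff by (auto intro: C_k_subset[OF _ image_mono[OF Int_mono[OF order_refl]]])

lemma smooth_on_mfd_const [simp]: "smooth_on_mfd M W (\<lambda>_. k)"
  by (simp add: smooth_on_mfd_iff C_k_const)

lemma smooth_on_mfd_add:
  "smooth_on_mfd M W f \<Longrightarrow> smooth_on_mfd M W g \<Longrightarrow> smooth_on_mfd M W (\<lambda>x. f x + g x)"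
  by (simp add: smooth_on_mfd_iff C_k_add)

lemma smooth_on_mfd_mult:
  "smooth_on_mfd M W f \<Longrightarrow> smooth_on_mfd M W g \<Longrightarrow> smooth_on_mfd M W (\<lambda>x. f x * g x)"
  by (simp add: smooth_on_mfd_iff C_k_mult)

lemma smooth_on_mfd_sum:
  "(\<And>i. i \<in> I \<Longrightarrow> smooth_on_mfd M W (f i)) \<Longrightarrow> smooth_on_mfd M W (\<lambda>x. \<Sum>i\<in>I. f i x)"
  by (induction I rule: infinite_finite_induct) (auto intro: smooth_on_mfd_add)

lemma smooth_on_mfd_prod:
  "(\<And>i. i \<in> I \<Longrightarrow> smooth_on_mfd M W (f i)) \<Longrightarrow> smooth_on_mfd M W (\<lambda>x. \<Prod>i\<in>I. f i x)"
  by (induction I rule: infinite_finite_induct) (auto intro: smooth_on_mfd_mult)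

lemma chartD:
  assumes "smooth_manifold M" "(U, \<phi>) \<in> charts M"
  shows "open U" "openin (Euclidean_space (mdim M)) (\<phi> ` U)"
    "homeomorphism U (\<phi> ` U) \<phi> (inv_into U \<phi>)"
proof -
  have "\<forall>(U, \<phi>)\<in>charts M. open U \<and> openin (Euclidean_space (mdim M)) (\<phi> ` U) \<and>
        homeomorphism U (\<phi> ` U) \<phi> (inv_into U \<phi>)"
    using assms(1) unfolding smooth_manifold_def by (elim conjE)
  from bspec[OF this assms(2)]
  show "open U" "openin (Euclidean_space (mdim M)) (\<phi> ` U)"
    "homeomorphism U (\<phi> ` U) \<phi> (inv_into U \<phi>)"
    by simp_all
qed

lemma openin_chart_image:
  assumes "smooth_manifold M" "(U, \<phi>) \<in> charts M" "open V"
  shows "openin (Euclidean_space (mdim M)) (\<phi> ` (U \<inter> V))"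
proof -
  have "openin (top_of_set U) (U \<inter> V)"
    using assms(3) by (auto simp: openin_open)
  then have "openin (top_of_set (\<phi> ` U)) (\<phi> ` (U \<inter> V))"
    by (rule homeomorphism_imp_open_map[OF chartD(3)[OF assms(1,2)]])
  then show ?thesis
    using chartD(2)[OF assms(1,2)] unfolding Euclidean_space_eq by (rule openin_trans)
qed

lemma chart_inj:
  assumes "smooth_manifold M" "(U, \<phi>) \<in> charts M"
  shows "inj_on \<phi> U"
  using homeomorphism_apply1[OF chartD(3)[OF assms]] by (metis inj_onI)

text \<open>This is how functions defined by cases, such as cutoffs extended by zero, are recognised
  as smooth. Charts map open sets to open sets of the model space, so locality there
  suffices.\<close>

lemma smooth_on_mfd_local:
  assumes "smooth_manifold M" "open W"
    and loc: "\<And>x. x \<in> W \<Longrightarrow> \<exists>V g. open V \<and> x \<in> V \<and> V \<subseteq> W \<and> smooth_on_mfd M V g \<and> (\<forall>z\<in>V. f z = g z)"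
  shows "smooth_on_mfd M W f"
  unfolding smooth_on_mfd_iff
proof (intro allI impI)
  fix U \<phi> k assume chart: "(U, \<phi>) \<in> charts M"
  note inj = chart_inj[OF assms(1) chart]
  show "C_k (mdim M) (\<phi> ` (U \<inter> W)) k (\<lambda>y. f (inv_into U \<phi> y))"
  proof (rule C_k_local[OF openin_chart_image[OF assms(1) chart assms(2)]])
    fix y assume "y \<in> \<phi> ` (U \<inter> W)"
    then obtain x where x: "x \<in> U" "x \<in> W" "y = \<phi> x" by auto
    obtain V g where V: "open V" "x \<in> V" "V \<subseteq> W" "smooth_on_mfd M V g" "\<forall>z\<in>V. f z = g z"
      using loc[OF x(2)] by metis
    have "C_k (mdim M) (\<phi> ` (U \<inter> V)) k (\<lambda>y. g (inv_into U \<phi> y))"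
      using V(4) chart by (simp add: smooth_on_mfd_iff)
    moreover have "\<forall>z\<in>\<phi> ` (U \<inter> V). f (inv_into U \<phi> z) = g (inv_into U \<phi> z)"
      using V inj by auto
    ultimately show "\<exists>W' f'. openin (Euclidean_space (mdim M)) W' \<and> y \<in> W' \<and> W' \<subseteq> \<phi> ` (U \<inter> W) \<and>
          C_k (mdim M) W' k f' \<and> (\<forall>z\<in>W'. f (inv_into U \<phi> z) = f' z)"
      using openin_chart_image[OF assms(1) chart V(1)] x V(2,3)
      by (intro exI[of _ "\<phi> ` (U \<inter> V)"] exI[of _ "\<lambda>y. g (inv_into U \<phi> y)"] conjI) auto
  qed
qed

lemma smooth_on_mfd_cong:
  assumes "smooth_manifold M" "open W" "smooth_on_mfd M W g" "\<And>x. x \<in> W \<Longrightarrow> f x = g x"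
  shows "smooth_on_mfd M W f"
  using assms by (intro smooth_on_mfd_local exI[of _ W] exI[of _ g]) auto

lemma C_inf_const [simp]: "(\<lambda>_. k) \<in> C_inf M"
  by (simp add: C_inf_def)

lemma C_inf_add [simp]: "f \<in> C_inf M \<Longrightarrow> g \<in> C_inf M \<Longrightarrow> f + g \<in> C_inf M"
  using smooth_on_mfd_add[of M UNIV f g] by (simp add: C_inf_def plus_fun_def)

lemma C_inf_minus [simp]: "f \<in> C_inf M \<Longrightarrow> - f \<in> C_inf M"
  using smooth_on_mfd_mult[of M UNIV "\<lambda>_. -1" f] by (simp add: C_inf_def fun_Compl_def)

lemma C_inf_diff [simp]: "f \<in> C_inf M \<Longrightarrow> g \<in> C_inf M \<Longrightarrow> f - g \<in> C_inf M"
  using C_inf_add[of f M "- g"] by simp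


section \<open>Bump functions\<close>

text \<open>The family of all \<open>t \<mapsto> p(1/t) e\<^bsup>-1/t\<^esup>\<close>, extended by 0 to \<open>t \<le> 0\<close>, is closed under derivatives.\<close>

definition flat_exp :: "real poly \<Rightarrow> real \<Rightarrow> real" where
  "flat_exp p t = (if t > 0 then poly p (1 / t) * exp (- 1 / t) else 0)"

lemma flat_exp_pos: "t > 0 \<Longrightarrow> flat_exp 1 t > 0"
  by (simp add: flat_exp_def)

text \<open>Exponential decay beats every polynomial. With s = 1/t this makes each member of the
  family, divided by t, tend to 0 at the origin.\<close>

lemma poly_mult_exp_minus_tendsto: "((\<lambda>s. poly p s * exp (- s)) \<longlongrightarrow> (0::real)) at_top"
proof -
  have "((\<lambda>s. \<Sum>i\<le>degree p. coeff p i * (s ^ i / exp s)) \<longlongrightarrow> (\<Sum>i\<le>degree p. coeff p i * 0)) at_top"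
    by (intro tendsto_sum tendsto_mult tendsto_const tendsto_power_div_exp_0)
  then show ?thesis
    by (simp add: poly_altdef sum_distrib_right exp_minus divide_inverse mult.assoc)
qed

text \<open>With s = 1/t one has ds/dt = -s^2, so p(s) exp(-s) has the derivative s^2 (p - p')(s)
  exp(-s). The factor \<open>[:0, 0, 1:]\<close> is s^2.\<close>

lemma flat_exp_has_derivative:
  "(flat_exp p has_real_derivative flat_exp ([:0, 0, 1:] * (p - pderiv p)) t) (at t)"
proof (cases t "0 :: real" rule: linorder_cases)
  case less
  have "eventually (\<lambda>s. s \<in> {..<0}) (nhds t)"
    using less by (intro eventually_nhds_in_open) auto
  then have "eventually (\<lambda>s. flat_exp p s = 0) (nhds t)"
    by eventually_elim (auto simp: flat_exp_def)
  then show ?thesis using less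
    by (subst DERIV_cong_ev[OF refl _ refl, of _ "\<lambda>_. 0"]) (auto simp: flat_exp_def)
next
  case greater
  have "eventually (\<lambda>s. s \<in> {0<..}) (nhds t)"
    using greater by (intro eventually_nhds_in_open) auto
  then have ev: "eventually (\<lambda>s. flat_exp p s = poly p (1 / s) * exp (- 1 / s)) (nhds t)"
    by eventually_elim (auto simp: flat_exp_def)
  have inv: "((\<lambda>s. 1 / s) has_real_derivative (- ((1 / t) ^ 2))) (at t)"
    using greater by (auto intro!: derivative_eq_intros simp: power2_eq_square)
  have 1: "((\<lambda>s. poly p (1 / s)) has_real_derivative poly (pderiv p) (1 / t) * (- ((1 / t) ^ 2))) (at t)"
    using DERIV_chain2[OF poly_DERIV inv] .
  have 2: "((\<lambda>s. exp (- 1 / s)) has_real_derivative exp (- 1 / t) * (1 / t) ^ 2) (at t)"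
    using greater by (auto intro!: derivative_eq_intros simp: power2_eq_square)
  have "((\<lambda>s. poly p (1 / s) * exp (- 1 / s)) has_real_derivative
      flat_exp ([:0, 0, 1:] * (p - pderiv p)) t) (at t)"
    using DERIV_mult[OF 1 2] greater
    by (simp add: flat_exp_def algebra_simps power2_eq_square)
  then show ?thesis
    by (subst DERIV_cong_ev[OF refl ev refl])
next
  case equal
  have "((\<lambda>h. flat_exp p h / h) \<longlongrightarrow> 0) (at 0)"
  proof (rule filterlim_split_at_real)
    have "eventually (\<lambda>h. flat_exp p h / h = 0) (at_left (0::real))"
      by (simp add: eventually_at_filter flat_exp_def)
    then show "((\<lambda>h. flat_exp p h / h) \<longlongrightarrow> 0) (at_left 0)"
      by (rule tendsto_eventually)
    \<comment> \<open>For h > 0, dividing by h multiplies p(1/h) by 1/h; \<open>pCons 0 p\<close> is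
      the polynomial s p(s). The difference quotient at 0 therefore stays in the family.\<close>
    have "((\<lambda>h. poly (pCons 0 p) (inverse h) * exp (- inverse h)) \<longlongrightarrow> 0) (at_right 0)"
      by (rule filterlim_compose[OF poly_mult_exp_minus_tendsto filterlim_inverse_at_top_right])
    moreover have "eventually (\<lambda>h. poly (pCons 0 p) (inverse h) * exp (- inverse h) = flat_exp p h / h)
        (at_right (0::real))"
      by (simp add: eventually_at_filter flat_exp_def field_simps)
    ultimately show "((\<lambda>h. flat_exp p h / h) \<longlongrightarrow> 0) (at_right 0)"
      by (rule Lim_transform_eventually)
  qed
  then show ?thesis using equal
    by (simp add: DERIV_def flat_exp_def)
qed

text \<open>The chain rule replaces \<open>p\<close> by the polynomial of the derivative, so the
  induction has to keep \<open>p\<close> arbitrary.\<close>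

lemma C_k_flat_exp: "C_k n W k f \<Longrightarrow> C_k n W k (\<lambda>y. flat_exp p (f y))"
proof (induction k arbitrary: p)
  case 0
  have "continuous_on UNIV (flat_exp p)"
    using flat_exp_has_derivative by (intro DERIV_continuous_on) (auto intro: has_field_derivative_at_within)
  then show ?case using 0 by (auto intro: continuous_on_compose2)
next
  case (Suc k)
  let ?q = "[:0, 0, 1:] * (p - pderiv p)"
  have "continuous_on UNIV (flat_exp p)"
    using flat_exp_has_derivative by (intro DERIV_continuous_on) (auto intro: has_field_derivative_at_within)
  then have "continuous_on W (\<lambda>y. flat_exp p (f y))"
    using C_k_imp_continuous[OF Suc.prems] by (auto intro: continuous_on_compose2)
  moreover have "\<exists>h. (\<forall>y\<in>W. ((\<lambda>t. flat_exp p (f (y(i := t)))) has_real_derivative h y) (at (y i))) \<and> C_k n W k h"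
    if i: "i < n" for i
  proof -
    obtain f' where f': "\<forall>y\<in>W. ((\<lambda>t. f (y(i := t))) has_real_derivative f' y) (at (y i))" "C_k n W k f'"
      by (rule C_k_SucE[OF Suc.prems(1) i])
    have "C_k n W k (\<lambda>y. flat_exp ?q (f y) * f' y)"
      using f' Suc.IH C_k_Suc_imp[OF Suc.prems] by (intro C_k_mult)
    moreover have "\<forall>y\<in>W. ((\<lambda>t. flat_exp p (f (y(i := t)))) has_real_derivative flat_exp ?q (f y) * f' y) (at (y i))"
    proof
      fix y assume y: "y \<in> W"
      have "(flat_exp p has_real_derivative flat_exp ?q (f (y(i := y i)))) (at (f (y(i := y i))))"
        by (rule flat_exp_has_derivative)
      from DERIV_chain2[OF this f'(1)[rule_format, OF y]]
      show "((\<lambda>t. flat_exp p (f (y(i := t)))) has_real_derivative flat_exp ?q (f y) * f' y) (at (y i))"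
        by (simp only: fun_upd_triv)
    qed
    ultimately show ?thesis by (intro exI[of _ "\<lambda>y. flat_exp ?q (f y) * f' y"] conjI)
  qed
  ultimately show ?case by (intro C_k_SucI) blast+
qed

lemma smooth_on_mfd_flat_exp:
  "smooth_on_mfd M W f \<Longrightarrow> smooth_on_mfd M W (\<lambda>x. flat_exp p (f x))"
  by (simp add: smooth_on_mfd_iff C_k_flat_exp)

section \<open>Cutoff functions supported in a chart\<close>

lemma smooth_on_mfd_chart:
  assumes M: "smooth_manifold M" and U: "(U, \<phi>) \<in> charts M" and i: "i < mdim M"
  shows "smooth_on_mfd M U (\<lambda>x. \<phi> x i)"
proof -
  have "smooth_Eucl (mdim M) (\<psi> ` (V \<inter> U)) (\<lambda>y. \<phi> (inv_into V \<psi> y) i)"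
    if "(V, \<psi>) \<in> charts M" for V \<psi>
    using M U i that unfolding smooth_manifold_def by blast
  then show ?thesis by (auto simp: smooth_on_mfd_def)
qed

text \<open>A basic open set of the product topology constrains coordinates one by one. Beyond
  \<open>n\<close> all points of the model space have coordinate 0, so the minimum of the first
  \<open>n\<close> radii is enough.\<close>

lemma eucl_sp_box:
  assumes "openin (Euclidean_space n) W" "y \<in> W"
  obtains \<delta> where "\<delta> > 0" "{z \<in> eucl_sp n. \<forall>i<n. \<bar>z i - y i\<bar> \<le> \<delta>} \<subseteq> W"
proof -
  obtain T where T: "open T" "W = T \<inter> eucl_sp n"
    using assms(1) unfolding Euclidean_space_eq openin_open by blast
  have "openin (product_topology (\<lambda>_. euclidean) UNIV) T"
    unfolding euclidean_product_topology using T(1) by simp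
  moreover have "y \<in> T" using T(2) assms(2) by blast
  ultimately have "\<exists>X. y \<in> Pi\<^sub>E UNIV X \<and> (\<forall>i. openin euclidean (X i)) \<and>
      finite {i. X i \<noteq> topspace euclidean} \<and> Pi\<^sub>E UNIV X \<subseteq> T"
    by (rule product_topology_open_contains_basis)
  then obtain X where X: "y \<in> Pi\<^sub>E UNIV X" "\<And>i. openin euclidean (X i)" "Pi\<^sub>E UNIV X \<subseteq> T"
    by (elim exE conjE) simp
  have "\<exists>d>0. \<forall>t. \<bar>t - y i\<bar> \<le> d \<longrightarrow> t \<in> X i" for i
  proof -
    have "open (X i)" "y i \<in> X i" using X(1,2) by (auto simp: PiE_iff)
    then obtain d where "d > 0" "cball (y i) d \<subseteq> X i"
      using open_contains_cball by blast
    then show ?thesis by (intro exI[of _ d]) (auto simp: dist_real_def abs_minus_commute)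
  qed
  then obtain d where d: "\<And>i. d i > 0" "\<And>i t. \<bar>t - y i\<bar> \<le> d i \<Longrightarrow> t \<in> X i"
    by metis
  \<comment> \<open>The extra 1 keeps the minimum meaningful in dimension 0.\<close>
  define \<delta> where "\<delta> = Min (insert 1 (d ` {..<n}))"
  have \<delta>: "\<delta> > 0" "\<And>i. i < n \<Longrightarrow> \<delta> \<le> d i"
    unfolding \<delta>_def using d(1) by auto
  have "z \<in> W" if z: "z \<in> eucl_sp n" "\<forall>i<n. \<bar>z i - y i\<bar> \<le> \<delta>" for z
  proof -
    have "z i \<in> X i" for i
    proof (cases "i < n")
      case True
      then show ?thesis using z(2) \<delta>(2)[of i] by (intro d(2)) force
    next
      case False
      then have "z i = y i" using z(1) T(2) assms(2) by auto
      then show ?thesis using X(1) by (auto simp: PiE_iff)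
    qed
    then have "z \<in> T" using X(3) by (auto simp: PiE_iff)
    then show ?thesis using T(2) z(1) by blast
  qed
  then show thesis using that[of \<delta>] \<delta>(1) by blast
qed

text \<open>Seen among all sequences, the box is a product of \<open>n\<close> closed intervals and
  infinitely many singletons {0}, so it is compact by Tychonoff's theorem.\<close>

lemma compact_eucl_sp_box:
  assumes "y \<in> eucl_sp n"
  shows "compact {z \<in> eucl_sp n. \<forall>i<n. \<bar>z i - y i\<bar> \<le> \<delta>}"
proof -
  have "compactin (product_topology (\<lambda>_. euclidean) UNIV)
      (Pi\<^sub>E UNIV (\<lambda>i. if i < n then {y i - \<delta>..y i + \<delta>} else {0::real}))"
    by (auto simp: compactin_PiE)
  moreover have "Pi\<^sub>E UNIV (\<lambda>i. if i < n then {y i - \<delta>..y i + \<delta>} else {0::real}) =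
      {z \<in> eucl_sp n. \<forall>i<n. \<bar>z i - y i\<bar> \<le> \<delta>}"
  proof (intro set_eqI)
    fix z :: "nat \<Rightarrow> real"
    have "z i \<in> (if i < n then {y i - \<delta>..y i + \<delta>} else {0}) \<longleftrightarrow>
        (if i < n then \<bar>z i - y i\<bar> \<le> \<delta> else z i = 0)" for i
      by auto
    then have "z \<in> Pi\<^sub>E UNIV (\<lambda>i. if i < n then {y i - \<delta>..y i + \<delta>} else {0}) \<longleftrightarrow>
        (\<forall>i. if i < n then \<bar>z i - y i\<bar> \<le> \<delta> else z i = 0)"
      unfolding PiE_UNIV_domain Pi_iff by simp
    then show "z \<in> Pi\<^sub>E UNIV (\<lambda>i. if i < n then {y i - \<delta>..y i + \<delta>} else {0}) \<longleftrightarrow>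
        z \<in> {z \<in> eucl_sp n. \<forall>i<n. \<bar>z i - y i\<bar> \<le> \<delta>}"
      by (auto simp: not_less[symmetric])
  qed
  ultimately show ?thesis by (simp add: euclidean_product_topology)
qed

text \<open>\<open>K\<close> is the preimage of a compact box in a chart. It is compact, hence
  closed in the Hausdorff space \<open>M\<close>, and the complement of \<open>K\<close> is an open
  set on which the function is 0. This is what makes the extension by zero smooth, and later
  extensions of local sections use \<open>K\<close> in the same way.\<close>

lemma bump_function:
  fixes M :: "('m::{t2_space,second_countable_topology}) manifold"
  assumes M: "smooth_manifold M" and U: "open U" "x \<in> U"
  obtains \<beta> K where "\<beta> \<in> C_inf M" "\<beta> x = 1" "closed K" "K \<subseteq> U" "\<forall>p. p \<notin> K \<longrightarrow> \<beta> p = 0"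
proof -
  have "x \<in> (\<Union>(U, \<phi>)\<in>charts M. U)"
    using M unfolding smooth_manifold_def by simp
  then obtain V \<phi> where V: "(V, \<phi>) \<in> charts M" "x \<in> V" by auto
  let ?n = "mdim M" and ?y = "\<phi> x"
  note ch = chartD[OF M V(1)]
  have W: "openin (Euclidean_space ?n) (\<phi> ` (V \<inter> U))" "?y \<in> \<phi> ` (V \<inter> U)"
    using openin_chart_image[OF M V(1) U(1)] V U by auto
  obtain \<delta> where \<delta>: "\<delta> > 0" "{z \<in> eucl_sp ?n. \<forall>i<?n. \<bar>z i - ?y i\<bar> \<le> \<delta>} \<subseteq> \<phi> ` (V \<inter> U)"
    by (rule eucl_sp_box[OF W])
  have VE: "\<phi> ` V \<subseteq> eucl_sp ?n"
    using ch(2) unfolding Euclidean_space_eq by (rule openin_imp_subset)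
  define D where "D = {z \<in> eucl_sp ?n. \<forall>i<?n. \<bar>z i - ?y i\<bar> \<le> \<delta>}"
  have D_sub: "D \<subseteq> \<phi> ` (V \<inter> U)" using \<delta>(2) unfolding D_def .
  then have D_sub': "D \<subseteq> \<phi> ` V" by (rule order_trans) (intro image_mono Int_lower1)
  define K where "K = inv_into V \<phi> ` D"
  have "compact D"
    unfolding D_def using VE V(2) by (intro compact_eucl_sp_box) blast
  moreover have "continuous_on D (inv_into V \<phi>)"
    by (rule continuous_on_subset[OF homeomorphism_cont2[OF ch(3)] D_sub'])
  ultimately have "closed K"
    unfolding K_def by (intro compact_imp_closed compact_continuous_image)
  have K_sub: "K \<subseteq> V \<inter> U"
  proof -
    have "inv_into V \<phi> ` \<phi> ` (V \<inter> U) = V \<inter> U"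
      using chart_inj[OF M V(1)] by (intro inv_into_image_cancel) auto
    then show ?thesis using image_mono[OF D_sub, of "inv_into V \<phi>"] unfolding K_def by simp
  qed
  \<comment> \<open>On the chart, the factors are all positive exactly inside the open box of
    half-width \<delta> around the image of \<open>x\<close>. The argument is written with sums and
    products only, for which closure rules are at hand. In dimension 0 the product is 1.\<close>
  define \<beta> where "\<beta> p = (if p \<in> V then (\<Prod>i<?n. flat_exp 1 (\<delta>\<^sup>2 + - 1 * ((\<phi> p i + - ?y i) * (\<phi> p i + - ?y i)))) else 0)" for p
  have \<beta>_out: "\<beta> p = 0" if "p \<notin> K" for p
  proof (cases "p \<in> V")
    case True
    have "\<phi> p \<notin> D"
      using that True chart_inj[OF M V(1)] unfolding K_def by (metis image_eqI inv_into_f_f)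
    then obtain i where i: "i < ?n" "\<bar>\<phi> p i - ?y i\<bar> > \<delta>"
      using VE True unfolding D_def by force
    then have "\<delta>\<^sup>2 < (\<phi> p i - ?y i)\<^sup>2"
      using \<delta>(1) by (metis abs_le_square_iff abs_of_pos not_le)
    then have "flat_exp 1 (\<delta>\<^sup>2 + - 1 * ((\<phi> p i + - ?y i) * (\<phi> p i + - ?y i))) = 0"
      by (simp add: flat_exp_def power2_eq_square)
    then show ?thesis using i(1) True unfolding \<beta>_def by (auto intro!: prod_zero)
  qed (simp add: \<beta>_def)
  have "\<beta> x > 0"
    unfolding \<beta>_def using V(2) \<delta>(1) by (simp add: flat_exp_pos)
  have "smooth_on_mfd M V (\<lambda>p. \<Prod>i<?n. flat_exp 1 (\<delta>\<^sup>2 + - 1 * ((\<phi> p i + - ?y i) * (\<phi> p i + - ?y i))))"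
    by (intro smooth_on_mfd_prod smooth_on_mfd_flat_exp smooth_on_mfd_add smooth_on_mfd_mult
        smooth_on_mfd_const smooth_on_mfd_chart[OF M V(1)]) auto
  then have smV: "smooth_on_mfd M V \<beta>"
    by (rule smooth_on_mfd_cong[OF M ch(1)]) (simp add: \<beta>_def)
  have "smooth_on_mfd M UNIV \<beta>"
  proof (rule smooth_on_mfd_local[OF M open_UNIV])
    fix p
    show "\<exists>V g. open V \<and> p \<in> V \<and> V \<subseteq> UNIV \<and> smooth_on_mfd M V g \<and> (\<forall>z\<in>V. \<beta> z = g z)"
    proof (cases "p \<in> V")
      case True
      then show ?thesis using ch(1) smV by (intro exI[of _ V] exI[of _ \<beta>]) simp
    next
      case False
      then show ?thesis using \<open>closed K\<close> K_sub \<beta>_out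
        by (intro exI[of _ "- K"] exI[of _ "\<lambda>_. 0"]) auto
    qed
  qed
  then have "smooth_on_mfd M UNIV (\<lambda>p. (1 / \<beta> x) * \<beta> p)"
    by (intro smooth_on_mfd_mult smooth_on_mfd_const)
  then have "(\<lambda>p. (1 / \<beta> x) * \<beta> p) \<in> C_inf M" by (simp add: C_inf_def)
  then show thesis
    using that[of "\<lambda>p. (1 / \<beta> x) * \<beta> p" K] \<open>\<beta> x > 0\<close> \<open>closed K\<close> K_sub \<beta>_out by simp
qed


section \<open>Frames and sections\<close>

text \<open>The fibrewise part of the frame condition in \<open>vector_bundle\<close>, detached from
  the base point so that linear algebra takes place in a single space.\<close>

definition frame_of :: "nat \<Rightarrow> (nat \<Rightarrow> 'v::real_vector) \<Rightarrow> 'v set \<Rightarrow> bool" where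
  "frame_of r e S \<longleftrightarrow> inj_on e {..<r} \<and> independent (e ` {..<r}) \<and> span (e ` {..<r}) = S"

text \<open>Passes between combinations over a set of vectors, the form in which span and
  independence are treated, and combinations over indices, the form used for sections.\<close>

lemma sum_frame_image:
  assumes "inj_on e {..<r::nat}"
  shows "(\<Sum>v\<in>e ` {..<r}. u v *\<^sub>R v) = (\<Sum>i<r. u (e i) *\<^sub>R e i)"
  using assms by (simp add: sum.reindex)

lemma frame_of_imp_indep:
  assumes "frame_of r e S" "(\<Sum>i<r. t i *\<^sub>R e i) = 0" "i < r"
  shows "t i = 0"
proof -
  have inj: "inj_on e {..<r}" and ind: "independent (e ` {..<r})"
    using assms(1) by (auto simp: frame_of_def)
  define u where "u v = t (inv_into {..<r} e v)" for v
  have u: "u (e j) = t j" if "j < r" for j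
    using inj that by (simp add: u_def)
  have "(\<Sum>v\<in>e ` {..<r}. u v *\<^sub>R v) = 0"
    using assms(2) u by (simp add: sum_frame_image[OF inj])
  then have "u (e i) = 0"
    using ind assms(3) by (intro independentD[OF ind]) auto
  then show ?thesis using u assms(3) by simp
qed

lemma frame_of_imp_span:
  assumes "frame_of r e S"
  shows "v \<in> S \<longleftrightarrow> (\<exists>t. v = (\<Sum>i<r. t i *\<^sub>R e i))"
proof -
  have inj: "inj_on e {..<r}" and S: "S = span (e ` {..<r})"
    using assms by (auto simp: frame_of_def)
  show ?thesis
  proof
    assume "v \<in> S"
    then obtain u where "v = (\<Sum>v\<in>e ` {..<r}. u v *\<^sub>R v)"
      unfolding S by (subst (asm) span_finite) auto
    then show "\<exists>t. v = (\<Sum>i<r. t i *\<^sub>R e i)"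
      unfolding sum_frame_image[OF inj] by (rule exI[of _ "\<lambda>i. u (e i)"])
  next
    assume "\<exists>t. v = (\<Sum>i<r. t i *\<^sub>R e i)"
    then obtain t where "v = (\<Sum>i<r. t i *\<^sub>R e i)" ..
    moreover have "(\<Sum>i<r. t i *\<^sub>R e i) \<in> S"
      unfolding S by (intro span_sum span_scale) (simp add: span_base)
    ultimately show "v \<in> S" by simp
  qed
qed

lemma frame_ofI:
  assumes indep: "\<And>t i. (\<Sum>i<r. t i *\<^sub>R e i) = 0 \<Longrightarrow> i < r \<Longrightarrow> t i = 0"
    and span: "\<And>v. v \<in> S \<longleftrightarrow> (\<exists>t. v = (\<Sum>i<r. t i *\<^sub>R e i))"
  shows "frame_of r e S"
proof -
  have inj: "inj_on e {..<r}"
  proof (rule inj_onI, rule ccontr)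
    fix i j assume ij: "i \<in> {..<r}" "j \<in> {..<r}" "e i = e j" "i \<noteq> j"
    \<comment> \<open>If two frame vectors coincided, their difference would be a nontrivial
      relation; \<open>t\<close> lists its coefficients.\<close>
    define t :: "nat \<Rightarrow> real" where "t k = (if k = i then 1 else 0) - (if k = j then 1 else 0)" for k
    have "(\<Sum>k<r. t k *\<^sub>R e k) = (\<Sum>k<r. (if k = i then e k else 0) - (if k = j then e k else 0))"
      unfolding t_def by (intro sum.cong) (auto simp: scaleR_diff_left)
    also have "\<dots> = 0"
      using ij by (simp add: sum_subtractf sum.delta)
    finally have "t i = 0" using ij(1) by (intro indep) auto
    then show False using ij(4) by (simp add: t_def)
  qed
  have "independent (e ` {..<r})"
  proof
    assume "dependent (e ` {..<r})"
    then obtain u where u: "\<exists>v\<in>e ` {..<r}. u v \<noteq> 0" "(\<Sum>v\<in>e ` {..<r}. u v *\<^sub>R v) = 0"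
      by (subst (asm) dependent_finite) auto
    then show False
      using indep[of "\<lambda>i. u (e i)"] by (auto simp: sum_frame_image[OF inj])
  qed
  moreover have "span (e ` {..<r}) = S"
  proof (rule set_eqI)
    fix v
    show "v \<in> span (e ` {..<r}) \<longleftrightarrow> v \<in> S"
      using frame_of_imp_span[of r e "span (e ` {..<r})" v] \<open>independent (e ` {..<r})\<close> inj
      by (simp add: frame_of_def span)
  qed
  ultimately show ?thesis using inj by (simp add: frame_of_def)
qed

text \<open>A choice rather than a definite description: the sum determines the coefficients only
  below \<open>r\<close>.\<close>

definition coords :: "nat \<Rightarrow> (nat \<Rightarrow> 'v::real_vector) \<Rightarrow> 'v \<Rightarrow> nat \<Rightarrow> real" where
  "coords r e v = (SOME t. v = (\<Sum>i<r. t i *\<^sub>R e i))"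

lemma coords_sum:
  assumes "frame_of r e S" "v \<in> S"
  shows "(\<Sum>i<r. coords r e v i *\<^sub>R e i) = v"
proof -
  have "\<exists>t. v = (\<Sum>i<r. t i *\<^sub>R e i)"
    using assms frame_of_imp_span by blast
  from someI_ex[OF this] show ?thesis unfolding coords_def by simp
qed

lemma coords_unique:
  assumes "frame_of r e S" "v = (\<Sum>i<r. t i *\<^sub>R e i)" "i < r"
  shows "coords r e v i = t i"
proof -
  have "v \<in> S" using assms(2) frame_of_imp_span[OF assms(1)] by blast
  then have "(\<Sum>i<r. (coords r e v i - t i) *\<^sub>R e i) = 0"
    using coords_sum[OF assms(1), of v] assms(2) by (simp add: scaleR_diff_left sum_subtractf)
  then have "coords r e v i - t i = 0"
    by (rule frame_of_imp_indep[OF assms(1) _ assms(3)])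
  then show ?thesis by simp
qed

lemma coords_add:
  assumes "frame_of r e S" "v \<in> S" "w \<in> S" "i < r"
  shows "coords r e (v + w) i = coords r e v i + coords r e w i"
  by (rule coords_unique[OF assms(1) _ assms(4)])
    (simp add: scaleR_add_left sum.distrib coords_sum[OF assms(1)] assms(2,3))

lemma coords_scale:
  assumes "frame_of r e S" "v \<in> S" "i < r"
  shows "coords r e (k *\<^sub>R v) i = k * coords r e v i"
  by (rule coords_unique[OF assms(1) _ assms(3)])
    (simp add: scaleR_sum_right[symmetric] coords_sum[OF assms(1)] assms(2) flip: scaleR_scaleR)

lemma vector_bundle_subspace: "vector_bundle M E \<Longrightarrow> subspace (fib E x)"
  by (simp add: vector_bundle_def)

lemma vector_bundle_frame_at:
  assumes "vector_bundle M E"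
  obtains U r e where "(U, r, e) \<in> frames E" "x \<in> U"
proof -
  have "x \<in> (\<Union>(U, r, e)\<in>frames E. U)"
    using assms unfolding vector_bundle_def by simp
  then show thesis using that by auto
qed

lemma vector_bundle_frameD:
  assumes "vector_bundle M E" "(U, r, e) \<in> frames E"
  shows "open U" and "\<And>x. x \<in> U \<Longrightarrow> frame_of r (\<lambda>i. e i x) (fib E x)"
proof -
  have "\<forall>(U, r, e)\<in>frames E. open U \<and>
        (\<forall>x\<in>U. inj_on (\<lambda>i. e i x) {..<r} \<and> independent ((\<lambda>i. e i x) ` {..<r}) \<and>
               span ((\<lambda>i. e i x) ` {..<r}) = fib E x)"
    using assms(1) unfolding vector_bundle_def by (elim conjE)
  from bspec[OF this assms(2)]
  show "open U" and "\<And>x. x \<in> U \<Longrightarrow> frame_of r (\<lambda>i. e i x) (fib E x)"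
    by (simp_all add: frame_of_def)
qed

lemma vector_bundle_transition:
  assumes "vector_bundle M E" "(U, r, e) \<in> frames E" "(V, s, d) \<in> frames E"
  obtains g where "\<forall>i<r. \<forall>j<s. smooth_on_mfd M (U \<inter> V) (g i j)"
    "\<forall>x\<in>U \<inter> V. \<forall>j<s. d j x = (\<Sum>i<r. g i j x *\<^sub>R e i x)"
proof -
  have "\<forall>(U, r, e)\<in>frames E. \<forall>(V, s, d)\<in>frames E.
        \<exists>g. (\<forall>i<r. \<forall>j<s. smooth_on_mfd M (U \<inter> V) (g i j)) \<and>
            (\<forall>x\<in>U \<inter> V. \<forall>j<s. d j x = (\<Sum>i<r. g i j x *\<^sub>R e i x))"
    using assms(1) unfolding vector_bundle_def by (elim conjE)
  from bspec[OF this assms(2)]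
  have "\<forall>(V, s, d)\<in>frames E. \<exists>g. (\<forall>i<r. \<forall>j<s. smooth_on_mfd M (U \<inter> V) (g i j)) \<and>
            (\<forall>x\<in>U \<inter> V. \<forall>j<s. d j x = (\<Sum>i<r. g i j x *\<^sub>R e i x))"
    by (simp only: prod.case)
  from bspec[OF this assms(3)]
  obtain g where g: "\<forall>i<r. \<forall>j<s. smooth_on_mfd M (U \<inter> V) (g i j)"
    "\<forall>x\<in>U \<inter> V. \<forall>j<s. d j x = (\<Sum>i<r. g i j x *\<^sub>R e i x)"
    unfolding prod.case by (elim exE conjE)
  show thesis
    by (rule that[OF g])
qed

lemma sections_fib: "s \<in> sections M E \<Longrightarrow> s x \<in> fib E x"
  by (simp add: sections_def)

lemma sections_frameE:
  assumes "s \<in> sections M E" "(U, r, e) \<in> frames E"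
  obtains c where "\<forall>i<r. smooth_on_mfd M U (c i)"
    "\<forall>x\<in>U. s x = (\<Sum>i<r. c i x *\<^sub>R e i x)"
proof -
  have "\<forall>(U, r, e)\<in>frames E. \<exists>c. (\<forall>i<r. smooth_on_mfd M U (c i)) \<and>
        (\<forall>x\<in>U. s x = (\<Sum>i<r. c i x *\<^sub>R e i x))"
    using assms(1) by (simp add: sections_def)
  from bspec[OF this assms(2)]
  obtain c where c: "\<forall>i<r. smooth_on_mfd M U (c i)" "\<forall>x\<in>U. s x = (\<Sum>i<r. c i x *\<^sub>R e i x)"
    unfolding prod.case by (elim exE conjE)
  show thesis
    by (rule that[OF c])
qed

lemma sectionsI:
  assumes "\<And>x. s x \<in> fib E x"
    and "\<And>U r e. (U, r, e) \<in> frames E \<Longrightarrow> \<exists>c. (\<forall>i<r. smooth_on_mfd M U (c i)) \<and>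
        (\<forall>x\<in>U. s x = (\<Sum>i<r. c i x *\<^sub>R e i x))"
  shows "s \<in> sections M E"
  unfolding sections_def
proof (intro CollectI conjI allI assms(1) ballI)
  fix z assume "z \<in> frames E"
  then show "case z of (U, r, e) \<Rightarrow> \<exists>c. (\<forall>i<r. smooth_on_mfd M U (c i)) \<and>
        (\<forall>x\<in>U. s x = (\<Sum>i<r. c i x *\<^sub>R e i x))"
    by (cases z) (simp only: prod.case assms(2))
qed

text \<open>A section has some smooth coefficients in each frame; by uniqueness they are its
  coordinates. Coordinates thus become smooth functions attached canonically to the section and the
  frame.\<close>

lemma sections_coords_smooth:
  assumes M: "smooth_manifold M" and E: "vector_bundle M E" and s: "s \<in> sections M E"
    and U: "(U, r, e) \<in> frames E" and i: "i < r"
  shows "smooth_on_mfd M U (\<lambda>x. coords r (\<lambda>i. e i x) (s x) i)"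
proof -
  obtain c where c [rule_format]: "\<forall>i<r. smooth_on_mfd M U (c i)"
    "\<forall>x\<in>U. s x = (\<Sum>i<r. c i x *\<^sub>R e i x)"
    by (rule sections_frameE[OF s U])
  show ?thesis
  proof (rule smooth_on_mfd_cong[OF M vector_bundle_frameD(1)[OF E U] c(1)[OF i]])
    fix x assume x: "x \<in> U"
    show "coords r (\<lambda>i. e i x) (s x) i = c i x"
      by (rule coords_unique[OF vector_bundle_frameD(2)[OF E U x] c(2)[OF x] i])
  qed
qed

lemma sections_zero [simp]:
  assumes "vector_bundle M E"
  shows "0 \<in> sections M E"
proof (rule sectionsI)
  show "0 x \<in> fib E x" for x
    using vector_bundle_subspace[OF assms] by (simp add: subspace_0)
  show "\<exists>c. (\<forall>i<r. smooth_on_mfd M U (c i)) \<and> (\<forall>x\<in>U. 0 x = (\<Sum>i<r. c i x *\<^sub>R e i x))"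
    if "(U, r, e) \<in> frames E" for U r e
    by (rule exI[of _ "\<lambda>_ _. 0"]) simp
qed

lemma sections_add [simp]:
  assumes E: "vector_bundle M E" and s: "s \<in> sections M E" and s': "s' \<in> sections M E"
  shows "s + s' \<in> sections M E"
proof (rule sectionsI)
  show "(s + s') x \<in> fib E x" for x
    using vector_bundle_subspace[OF E, of x] sections_fib[OF s, of x] sections_fib[OF s', of x]
    by (simp add: subspace_add)
  fix U r e assume U: "(U, r, e) \<in> frames E"
  obtain c where c [rule_format]: "\<forall>i<r. smooth_on_mfd M U (c i)"
    "\<forall>x\<in>U. s x = (\<Sum>i<r. c i x *\<^sub>R e i x)"
    by (rule sections_frameE[OF s U])
  obtain c' where c' [rule_format]: "\<forall>i<r. smooth_on_mfd M U (c' i)"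
    "\<forall>x\<in>U. s' x = (\<Sum>i<r. c' i x *\<^sub>R e i x)"
    by (rule sections_frameE[OF s' U])
  show "\<exists>c. (\<forall>i<r. smooth_on_mfd M U (c i)) \<and> (\<forall>x\<in>U. (s + s') x = (\<Sum>i<r. c i x *\<^sub>R e i x))"
    by (rule exI[of _ "\<lambda>i x. c i x + c' i x"])
      (simp add: c c' smooth_on_mfd_add scaleR_add_left sum.distrib)
qed

lemma sections_scl [simp]:
  assumes E: "vector_bundle M E" and f: "f \<in> C_inf M" and s: "s \<in> sections M E"
  shows "f \<cdot> s \<in> sections M E"
proof (rule sectionsI)
  show "(f \<cdot> s) x \<in> fib E x" for x
    using vector_bundle_subspace[OF E, of x] sections_fib[OF s, of x]
    by (simp add: scl_def subspace_scale)
  fix U r e assume U: "(U, r, e) \<in> frames E"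
  obtain c where c [rule_format]: "\<forall>i<r. smooth_on_mfd M U (c i)"
    "\<forall>x\<in>U. s x = (\<Sum>i<r. c i x *\<^sub>R e i x)"
    by (rule sections_frameE[OF s U])
  have "smooth_on_mfd M U f"
    using f smooth_on_mfd_subset[of M UNIV f U] by (simp add: C_inf_def)
  then show "\<exists>c. (\<forall>i<r. smooth_on_mfd M U (c i)) \<and> (\<forall>x\<in>U. (f \<cdot> s) x = (\<Sum>i<r. c i x *\<^sub>R e i x))"
    by (intro exI[of _ "\<lambda>i x. f x * c i x"])
      (simp add: c smooth_on_mfd_mult scl_def scaleR_sum_right)
qed

lemma sections_uminus [simp]:
  assumes "vector_bundle M E" "s \<in> sections M E"
  shows "- s \<in> sections M E"
proof -
  have "- s = (\<lambda>_. - 1) \<cdot> s" by (simp add: scl_def fun_eq_iff)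
  then show ?thesis using assms by simp
qed

lemma sections_diff [simp]:
  assumes "vector_bundle M E" "s \<in> sections M E" "s' \<in> sections M E"
  shows "s - s' \<in> sections M E"
  using sections_add[OF assms(1,2) sections_uminus[OF assms(1,3)]] by simp

text \<open>The vector is extended with constant coefficients in a frame around \<open>x\<close>,
  multiplied by a cutoff and continued by zero. Smoothness has to be verified in every frame, not
  only in the chosen one.\<close>

lemma section_through:
  fixes M :: "('m::{t2_space,second_countable_topology}) manifold"
  assumes M: "smooth_manifold M" and E: "vector_bundle M E" and v: "v \<in> fib E x"
  obtains s where "s \<in> sections M E" "s x = v"
proof -
  obtain U r e where U: "(U, r, e) \<in> frames E" "x \<in> U"
    by (rule vector_bundle_frame_at[OF E])
  note frU = vector_bundle_frameD[OF E U(1)]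
  obtain b K where b [rule_format]: "b \<in> C_inf M" "b x = 1" "closed K" "K \<subseteq> U" "\<forall>p. p \<notin> K \<longrightarrow> b p = 0"
    by (rule bump_function[OF M frU(1) U(2)])
  define t where "t = coords r (\<lambda>i. e i x) v"
  define s where "s p = (if p \<in> U then \<Sum>j<r. (b p * t j) *\<^sub>R e j p else 0)" for p
  have "s \<in> sections M E"
  proof (rule sectionsI)
    show "s p \<in> fib E p" for p
    proof (cases "p \<in> U")
      case True
      then have "s p = (\<Sum>j<r. (b p * t j) *\<^sub>R e j p)" by (simp add: s_def)
      then show ?thesis
        unfolding frame_of_imp_span[OF frU(2)[OF True]] by (rule exI[of _ "\<lambda>j. b p * t j"])
    next
      case False
      then show ?thesis
        using vector_bundle_subspace[OF E] by (simp add: s_def subspace_0)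
    qed
    fix V n d assume V: "(V, n, d) \<in> frames E"
    note frV = vector_bundle_frameD[OF E V]
    obtain g where g [rule_format]: "\<forall>i<n. \<forall>j<r. smooth_on_mfd M (V \<inter> U) (g i j)"
      "\<forall>p\<in>V \<inter> U. \<forall>j<r. e j p = (\<Sum>i<n. g i j p *\<^sub>R d i p)"
      by (rule vector_bundle_transition[OF E V U(1)])
    \<comment> \<open>The coefficients in the frame \<open>d\<close>: the transition matrix applied
      to the constants \<open>t\<close>, times the cutoff, and 0 off \<open>U\<close>.\<close>
    define c where "c i p = (if p \<in> U then \<Sum>j<r. b p * (t j * g i j p) else 0)" for i p
    have "smooth_on_mfd M V (c i)" if i: "i < n" for i
    proof (rule smooth_on_mfd_local[OF M frV(1)])
      fix p assume p: "p \<in> V"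
      show "\<exists>W h. open W \<and> p \<in> W \<and> W \<subseteq> V \<and> smooth_on_mfd M W h \<and> (\<forall>z\<in>W. c i z = h z)"
      proof (cases "p \<in> U")
        case True
        have "smooth_on_mfd M (V \<inter> U) b"
          using b(1) smooth_on_mfd_subset[of M UNIV b "V \<inter> U"] by (simp add: C_inf_def)
        then have "smooth_on_mfd M (V \<inter> U) (\<lambda>p. \<Sum>j<r. b p * (t j * g i j p))"
          using i by (intro smooth_on_mfd_sum smooth_on_mfd_mult smooth_on_mfd_const g(1)) auto
        then show ?thesis
          using True p frU(1) frV(1)
          by (intro exI[of _ "V \<inter> U"] exI[of _ "\<lambda>p. \<Sum>j<r. b p * (t j * g i j p)"] conjI)
            (simp_all add: c_def open_Int)
      next
        case False
        then show ?thesis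
          using p b(3,4,5) frV(1)
          by (intro exI[of _ "V - K"] exI[of _ "\<lambda>_. 0"] conjI) (auto simp: c_def open_Diff)
      qed
    qed
    moreover have "s p = (\<Sum>i<n. c i p *\<^sub>R d i p)" if p: "p \<in> V" for p
    proof (cases "p \<in> U")
      case True
      then have "s p = (\<Sum>j<r. (b p * t j) *\<^sub>R (\<Sum>i<n. g i j p *\<^sub>R d i p))"
        using g(2) p by (simp add: s_def)
      also have "\<dots> = (\<Sum>j<r. \<Sum>i<n. (b p * (t j * g i j p)) *\<^sub>R d i p)"
        by (simp add: scaleR_sum_right mult.assoc)
      also have "\<dots> = (\<Sum>i<n. \<Sum>j<r. (b p * (t j * g i j p)) *\<^sub>R d i p)"
        by (rule sum.swap)
      also have "\<dots> = (\<Sum>i<n. c i p *\<^sub>R d i p)"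
        using True by (simp add: c_def scaleR_sum_left)
      finally show ?thesis .
    qed (simp add: s_def c_def)
    ultimately show "\<exists>c. (\<forall>i<n. smooth_on_mfd M V (c i)) \<and> (\<forall>p\<in>V. s p = (\<Sum>i<n. c i p *\<^sub>R d i p))"
      by (intro exI[of _ c]) simp
  qed
  moreover have "s x = v"
    using U(2) b(2) coords_sum[OF frU(2)[OF U(2)] v] by (simp add: s_def t_def)
  ultimately show thesis using that by blast
qed

text \<open>A nonzero vector has a nonzero coordinate in some frame. The corresponding coordinate
  functional, cut off, is a global section of the dual bundle.\<close>

lemma dual_sections_separate:
  fixes M :: "('m::{t2_space,second_countable_topology}) manifold"
  assumes M: "smooth_manifold M" and E: "vector_bundle M E" and v: "v \<in> fib E x" "v \<noteq> 0"
  obtains \<gamma> where "\<gamma> \<in> dual_sections M E" "\<gamma> x v \<noteq> 0"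
proof -
  obtain U r e where U: "(U, r, e) \<in> frames E" "x \<in> U"
    by (rule vector_bundle_frame_at[OF E])
  note frU = vector_bundle_frameD[OF E U(1)]
  have "(\<Sum>i<r. coords r (\<lambda>i. e i x) v i *\<^sub>R e i x) \<noteq> 0"
    using coords_sum[OF frU(2)[OF U(2)] v(1)] v(2) by simp
  then obtain i where i: "i < r" "coords r (\<lambda>i. e i x) v i \<noteq> 0"
    by (metis (no_types, lifting) lessThan_iff scaleR_zero_left sum.not_neutral_contains_not_neutral)
  obtain b K where b [rule_format]: "b \<in> C_inf M" "b x = 1" "closed K" "K \<subseteq> U" "\<forall>p. p \<notin> K \<longrightarrow> b p = 0"
    by (rule bump_function[OF M frU(1) U(2)])
  define \<gamma> where "\<gamma> p w = (if p \<in> U then b p * coords r (\<lambda>i. e i p) w i else 0)" for p w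
  have lin: "fibre_linear (fib E p) UNIV (\<gamma> p)" for p
    unfolding fibre_linear_def \<gamma>_def
    by (simp add: coords_add[OF frU(2) _ _ i(1)] coords_scale[OF frU(2) _ i(1)] distrib_left)
  have "app1 \<gamma> s \<in> C_inf M" if s: "s \<in> sections M E" for s
    unfolding C_inf_def mem_Collect_eq
  proof (rule smooth_on_mfd_local[OF M open_UNIV])
    fix p
    show "\<exists>V g. open V \<and> p \<in> V \<and> V \<subseteq> UNIV \<and> smooth_on_mfd M V g \<and> (\<forall>z\<in>V. app1 \<gamma> s z = g z)"
    proof (cases "p \<in> U")
      case True
      have "smooth_on_mfd M U b"
        using b(1) smooth_on_mfd_subset[of M UNIV b U] by (simp add: C_inf_def)
      then have "smooth_on_mfd M U (\<lambda>p. b p * coords r (\<lambda>i. e i p) (s p) i)"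
        by (intro smooth_on_mfd_mult sections_coords_smooth[OF M E s U(1) i(1)])
      then show ?thesis
        using True frU(1) by (intro exI[of _ U] exI[of _ "\<lambda>p. b p * coords r (\<lambda>i. e i p) (s p) i"])
          (simp add: app1_def \<gamma>_def)
    next
      case False
      then show ?thesis using b(3-5)
        by (intro exI[of _ "- K"] exI[of _ "\<lambda>_. 0"]) (auto simp: app1_def \<gamma>_def)
    qed
  qed
  then have "\<gamma> \<in> dual_sections M E" using lin by (simp add: dual_sections_def)
  moreover have "\<gamma> x v \<noteq> 0" using U(2) b(2) i(2) by (simp add: \<gamma>_def)
  ultimately show thesis using that by blast
qed


section \<open>Whitney sums\<close>

lemma sum_lessThan_add:
  fixes f :: "nat \<Rightarrow> 'a::comm_monoid_add"
  shows "(\<Sum>i<r + s. f i) = (\<Sum>i<r. f i) + (\<Sum>i<s. f (r + i))"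
proof -
  have "sum f {r..<r + s} = (\<Sum>i<s. f (r + i))"
    by (subst sum.shift_bounds_nat_ivl[of f 0 r s, simplified add_0 add.commute[of s r], symmetric, THEN sym])
      (simp add: atLeast0LessThan add.commute)
  then show ?thesis
    using sum.atLeastLessThan_concat[of 0 r "r + s" f] by (simp add: atLeast0LessThan)
qed

abbreviation sum_frame :: "nat \<Rightarrow> (nat \<Rightarrow> 'm \<Rightarrow> 'a) \<Rightarrow> (nat \<Rightarrow> 'm \<Rightarrow> 'b) \<Rightarrow> nat \<Rightarrow> 'm \<Rightarrow> 'a::zero \<times> 'b::zero" where
  "sum_frame r e d \<equiv> \<lambda>i x. if i < r then (e i x, 0) else (0, d (i - r) x)"

lemma sum_frame_combination:
  "(\<Sum>i<r + s. t i *\<^sub>R sum_frame r e d i x) =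
     ((\<Sum>i<r. t i *\<^sub>R e i x), (\<Sum>i<s. t (r + i) *\<^sub>R d i x))"
  by (simp add: sum_lessThan_add prod_eq_iff fst_sum snd_sum)

lemma frames_whitney_sumI:
  assumes "(U, r, e) \<in> frames A" "(V, s, d) \<in> frames B"
  shows "(U \<inter> V, r + s, sum_frame r e d) \<in> frames (A \<oplus>\<^sub>V B)"
  unfolding whitney_sum_def vbundle.simps mem_Collect_eq
  by (rule exI[of _ U], rule exI[of _ r], rule exI[of _ e], rule exI[of _ V], rule exI[of _ s],
      rule exI[of _ d]) (simp add: assms)

lemma frames_whitney_sumE:
  assumes "(W, n, h) \<in> frames (A \<oplus>\<^sub>V B)"
  obtains U r e V s d where "(U, r, e) \<in> frames A" "(V, s, d) \<in> frames B"
    "W = U \<inter> V" "n = r + s" "h = sum_frame r e d"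
proof -
  have "\<exists>U r e V s d. (W, n, h) = (U \<inter> V, r + s, sum_frame r e d) \<and>
      (U, r, e) \<in> frames A \<and> (V, s, d) \<in> frames B"
    using assms unfolding whitney_sum_def vbundle.simps mem_Collect_eq .
  then show thesis
    by (elim exE conjE Pair_inject) (rule that)
qed

lemma fib_whitney_sum [simp]: "fib (A \<oplus>\<^sub>V B) x = fib A x \<times> fib B x"
  by (simp add: whitney_sum_def)

lemma frame_of_sum_frame:
  assumes "frame_of r (\<lambda>i. e i x) S" "frame_of s (\<lambda>i. d i x) T"
  shows "frame_of (r + s) (\<lambda>i. sum_frame r e d i x) (S \<times> T)"
proof (rule frame_ofI)
  fix t i assume 0: "(\<Sum>i<r + s. t i *\<^sub>R sum_frame r e d i x) = 0" and i: "i < r + s"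
  then have "(\<Sum>i<r. t i *\<^sub>R e i x) = 0" "(\<Sum>i<s. t (r + i) *\<^sub>R d i x) = 0"
    unfolding sum_frame_combination by (simp_all add: prod_eq_iff)
  note z = frame_of_imp_indep[OF assms(1) this(1)] frame_of_imp_indep[OF assms(2) this(2)]
  show "t i = 0"
    using z(1)[of i] z(2)[of "i - r"] i by (cases "i < r") auto
next
  fix v
  show "v \<in> S \<times> T \<longleftrightarrow> (\<exists>t. v = (\<Sum>i<r + s. t i *\<^sub>R sum_frame r e d i x))"
  proof
    assume "v \<in> S \<times> T"
    then obtain t u where "fst v = (\<Sum>i<r. t i *\<^sub>R e i x)" "snd v = (\<Sum>i<s. u i *\<^sub>R d i x)"
      using frame_of_imp_span[OF assms(1)] frame_of_imp_span[OF assms(2)] by (metis mem_Times_iff)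
    then show "\<exists>t. v = (\<Sum>i<r + s. t i *\<^sub>R sum_frame r e d i x)"
      unfolding sum_frame_combination
      by (intro exI[of _ "\<lambda>i. if i < r then t i else u (i - r)"]) (simp add: prod_eq_iff)
  next
    assume "\<exists>t. v = (\<Sum>i<r + s. t i *\<^sub>R sum_frame r e d i x)"
    then obtain t where "v = ((\<Sum>i<r. t i *\<^sub>R e i x), (\<Sum>i<s. t (r + i) *\<^sub>R d i x))"
      unfolding sum_frame_combination ..
    moreover have "(\<Sum>i<r. t i *\<^sub>R e i x) \<in> S"
      unfolding frame_of_imp_span[OF assms(1)] by (rule exI[of _ t]) simp
    moreover have "(\<Sum>i<s. t (r + i) *\<^sub>R d i x) \<in> T"
      unfolding frame_of_imp_span[OF assms(2)] by (rule exI[of _ "\<lambda>i. t (r + i)"]) simp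
    ultimately show "v \<in> S \<times> T" by simp
  qed
qed

lemma vector_bundle_whitney_sum:
  assumes A: "vector_bundle M A" and B: "vector_bundle M B"
  shows "vector_bundle M (A \<oplus>\<^sub>V B)"
  unfolding vector_bundle_def
proof (intro conjI)
  show "\<forall>x. subspace (fib (A \<oplus>\<^sub>V B) x)"
    using vector_bundle_subspace[OF A] vector_bundle_subspace[OF B] by (simp add: subspace_Times)
  show "(\<Union>(U, r, e)\<in>frames (A \<oplus>\<^sub>V B). U) = UNIV"
  proof (rule UNIV_eq_I[symmetric])
    fix x
    obtain U r e where U: "(U, r, e) \<in> frames A" "x \<in> U"
      by (rule vector_bundle_frame_at[OF A])
    obtain V s d where V: "(V, s, d) \<in> frames B" "x \<in> V"
      by (rule vector_bundle_frame_at[OF B])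
    have "(U \<inter> V, r + s, sum_frame r e d) \<in> frames (A \<oplus>\<^sub>V B)"
      by (rule frames_whitney_sumI[OF U(1) V(1)])
    then show "x \<in> (\<Union>(U, r, e)\<in>frames (A \<oplus>\<^sub>V B). U)"
      using U(2) V(2) by blast
  qed
  show "\<forall>(W, n, h)\<in>frames (A \<oplus>\<^sub>V B). open W \<and>
        (\<forall>x\<in>W. inj_on (\<lambda>i. h i x) {..<n} \<and> independent ((\<lambda>i. h i x) ` {..<n}) \<and>
               span ((\<lambda>i. h i x) ` {..<n}) = fib (A \<oplus>\<^sub>V B) x)"
  proof clarify
    fix W n h assume "(W, n, h) \<in> frames (A \<oplus>\<^sub>V B)"
    then obtain U r e V s d where UV: "(U, r, e) \<in> frames A" "(V, s, d) \<in> frames B"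
      "W = U \<inter> V" "n = r + s" "h = sum_frame r e d"
      by (rule frames_whitney_sumE)
    have "frame_of n (\<lambda>i. h i x) (fib (A \<oplus>\<^sub>V B) x)" if "x \<in> W" for x
      unfolding UV fib_whitney_sum using that UV(3)
      by (intro frame_of_sum_frame vector_bundle_frameD(2)[OF A UV(1)] vector_bundle_frameD(2)[OF B UV(2)]) auto
    then show "open W \<and> (\<forall>x\<in>W. inj_on (\<lambda>i. h i x) {..<n} \<and> independent ((\<lambda>i. h i x) ` {..<n}) \<and>
               span ((\<lambda>i. h i x) ` {..<n}) = fib (A \<oplus>\<^sub>V B) x)"
      using vector_bundle_frameD(1)[OF A UV(1)] vector_bundle_frameD(1)[OF B UV(2)]
      unfolding frame_of_def UV(3) by (simp add: open_Int)
  qed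
  show "\<forall>(W, n, h)\<in>frames (A \<oplus>\<^sub>V B). \<forall>(W', n', h')\<in>frames (A \<oplus>\<^sub>V B).
        \<exists>g. (\<forall>i<n. \<forall>j<n'. smooth_on_mfd M (W \<inter> W') (g i j)) \<and>
            (\<forall>x\<in>W \<inter> W'. \<forall>j<n'. h' j x = (\<Sum>i<n. g i j x *\<^sub>R h i x))"
  proof clarify
    fix W n h W' n' h'
    assume "(W, n, h) \<in> frames (A \<oplus>\<^sub>V B)"
    then obtain U r e V s d where UV: "(U, r, e) \<in> frames A" "(V, s, d) \<in> frames B"
      "W = U \<inter> V" "n = r + s" "h = sum_frame r e d"
      by (rule frames_whitney_sumE)
    assume "(W', n', h') \<in> frames (A \<oplus>\<^sub>V B)"
    then obtain U' r' e' V' s' d' where UV': "(U', r', e') \<in> frames A" "(V', s', d') \<in> frames B"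
      "W' = U' \<inter> V'" "n' = r' + s'" "h' = sum_frame r' e' d'"
      by (rule frames_whitney_sumE)
    obtain gA where gA [rule_format]: "\<forall>i<r. \<forall>j<r'. smooth_on_mfd M (U \<inter> U') (gA i j)"
      "\<forall>x\<in>U \<inter> U'. \<forall>j<r'. e' j x = (\<Sum>i<r. gA i j x *\<^sub>R e i x)"
      by (rule vector_bundle_transition[OF A UV(1) UV'(1)])
    obtain gB where gB [rule_format]: "\<forall>i<s. \<forall>j<s'. smooth_on_mfd M (V \<inter> V') (gB i j)"
      "\<forall>x\<in>V \<inter> V'. \<forall>j<s'. d' j x = (\<Sum>i<s. gB i j x *\<^sub>R d i x)"
      by (rule vector_bundle_transition[OF B UV(2) UV'(2)])
    \<comment> \<open>The transition matrix of a Whitney sum is block diagonal, with the blocks of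
      the two summands.\<close>
    define g where "g i j = (if i < r then (if j < r' then gA i j else (\<lambda>_. 0))
       else (if j < r' then (\<lambda>_. 0) else gB (i - r) (j - r')))" for i j
    have "smooth_on_mfd M (W \<inter> W') (g i j)" if "i < n" "j < n'" for i j
      unfolding g_def using that UV(3,4) UV'(3,4)
      by (auto intro: smooth_on_mfd_subset[OF gA(1)] smooth_on_mfd_subset[OF gB(1)])
    moreover have "h' j x = (\<Sum>i<n. g i j x *\<^sub>R h i x)" if x: "x \<in> W \<inter> W'" and j: "j < n'" for x j
    proof -
      have "x \<in> U \<inter> U'" "x \<in> V \<inter> V'" using x UV(3) UV'(3) by auto
      then show ?thesis
        unfolding UV(4,5) UV'(5) sum_frame_combination[where t = "\<lambda>i. g i j x" and r = r and s = s and e = e and d = d and x = x]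
        using j UV'(4) gA(2) gB(2) by (auto simp: g_def)
    qed
    ultimately show "\<exists>g. (\<forall>i<n. \<forall>j<n'. smooth_on_mfd M (W \<inter> W') (g i j)) \<and>
            (\<forall>x\<in>W \<inter> W'. \<forall>j<n'. h' j x = (\<Sum>i<n. g i j x *\<^sub>R h i x))"
      by (intro exI[of _ g]) simp
  qed
qed

section \<open>Sections of a Whitney sum as pairs of sections\<close>

lemma fst_pair_sec [simp]: "fst \<circ> pair_sec a b = a"
  by (simp add: pair_sec_def comp_def)

lemma snd_pair_sec [simp]: "snd \<circ> pair_sec a b = b"
  by (simp add: pair_sec_def comp_def)

lemma pair_sec_collapse: "pair_sec (fst \<circ> q) (snd \<circ> q) = q"
  by (simp add: pair_sec_def comp_def)

lemma pair_sec_in_sections: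
  assumes a: "a \<in> sections M A" and b: "b \<in> sections M B"
  shows "pair_sec a b \<in> sections M (A \<oplus>\<^sub>V B)"
proof (rule sectionsI)
  show "pair_sec a b x \<in> fib (A \<oplus>\<^sub>V B) x" for x
    using sections_fib[OF a] sections_fib[OF b] by (simp add: pair_sec_def)
  fix W n h assume "(W, n, h) \<in> frames (A \<oplus>\<^sub>V B)"
  then obtain U r e V s d where UV: "(U, r, e) \<in> frames A" "(V, s, d) \<in> frames B"
    "W = U \<inter> V" "n = r + s" "h = sum_frame r e d"
    by (rule frames_whitney_sumE)
  obtain c where c [rule_format]: "\<forall>i<r. smooth_on_mfd M U (c i)"
    "\<forall>x\<in>U. a x = (\<Sum>i<r. c i x *\<^sub>R e i x)"
    by (rule sections_frameE[OF a UV(1)])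
  obtain k where k [rule_format]: "\<forall>i<s. smooth_on_mfd M V (k i)"
    "\<forall>x\<in>V. b x = (\<Sum>i<s. k i x *\<^sub>R d i x)"
    by (rule sections_frameE[OF b UV(2)])
  define f where "f i = (if i < r then c i else k (i - r))" for i
  have "smooth_on_mfd M W (f i)" if "i < n" for i
    unfolding f_def using that UV(3,4)
    by (auto intro: smooth_on_mfd_subset[OF c(1)] smooth_on_mfd_subset[OF k(1)])
  moreover have "pair_sec a b x = (\<Sum>i<n. f i x *\<^sub>R h i x)" if "x \<in> W" for x
    unfolding UV(4,5) sum_frame_combination[where t = "\<lambda>i. f i x" and r = r and s = s and e = e and d = d and x = x]
    using that c(2) k(2) UV(3) by (simp add: pair_sec_def f_def)
  ultimately show "\<exists>c. (\<forall>i<n. smooth_on_mfd M W (c i)) \<and> (\<forall>x\<in>W. pair_sec a b x = (\<Sum>i<n. c i x *\<^sub>R h i x))"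
    by (intro exI[of _ f]) simp
qed

text \<open>A frame of one summand is completed to a frame of the sum only over its intersection
  with the domain of a frame of the other. Smooth coefficients of a component are therefore found
  locally, and uniqueness of coordinates glues them. Those of the second component come after the
  first \<open>r\<close> ones.\<close>

lemma sections_components_smooth:
  assumes M: "smooth_manifold M" and A: "vector_bundle M A" and B: "vector_bundle M B"
    and q: "q \<in> sections M (A \<oplus>\<^sub>V B)"
  shows "fst \<circ> q \<in> sections M A" "snd \<circ> q \<in> sections M B"
proof -
  have fib: "q x \<in> fib A x \<times> fib B x" for x
    using sections_fib[OF q, of x] by simp
  have comb: "\<exists>c. (\<forall>i<r + s. smooth_on_mfd M (U \<inter> V) (c i)) \<and>
      (\<forall>x\<in>U \<inter> V. fst (q x) = (\<Sum>i<r. c i x *\<^sub>R e i x) \<and> snd (q x) = (\<Sum>i<s. c (r + i) x *\<^sub>R d i x))"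
    if UV: "(U, r, e) \<in> frames A" "(V, s, d) \<in> frames B" for U r e V s d
  proof -
    have "(U \<inter> V, r + s, sum_frame r e d) \<in> frames (A \<oplus>\<^sub>V B)"
      by (rule frames_whitney_sumI[OF UV])
    then obtain c where c [rule_format]: "\<forall>i<r + s. smooth_on_mfd M (U \<inter> V) (c i)"
      "\<forall>x\<in>U \<inter> V. q x = (\<Sum>i<r + s. c i x *\<^sub>R sum_frame r e d i x)"
      by (rule sections_frameE[OF q])
    show ?thesis
      using c sum_frame_combination[where t = "\<lambda>i. c i x" and r = r and s = s and e = e and d = d and x = x for x]
      by (intro exI[of _ c]) simp
  qed
  show "fst \<circ> q \<in> sections M A"
  proof (rule sectionsI)
    show "(fst \<circ> q) x \<in> fib A x" for x using fib[of x] by auto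
    fix U r e assume U: "(U, r, e) \<in> frames A"
    note frU = vector_bundle_frameD[OF A U]
    define c where "c i x = coords r (\<lambda>i. e i x) (fst (q x)) i" for i x
    have "smooth_on_mfd M U (c i)" if i: "i < r" for i
    proof (rule smooth_on_mfd_local[OF M frU(1)])
      fix x assume x: "x \<in> U"
      obtain V s d where V: "(V, s, d) \<in> frames B" "x \<in> V"
        by (rule vector_bundle_frame_at[OF B])
      obtain k where k [rule_format]: "\<forall>i<r + s. smooth_on_mfd M (U \<inter> V) (k i)"
        "\<forall>x\<in>U \<inter> V. fst (q x) = (\<Sum>i<r. k i x *\<^sub>R e i x) \<and> snd (q x) = (\<Sum>i<s. k (r + i) x *\<^sub>R d i x)"
        using comb[OF U V(1)] by (elim exE conjE)
      have "c i z = k i z" if z: "z \<in> U \<inter> V" for z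
        unfolding c_def using k(2) z by (intro coords_unique[OF frU(2) _ i]) simp_all
      then show "\<exists>V g. open V \<and> x \<in> V \<and> V \<subseteq> U \<and> smooth_on_mfd M V g \<and> (\<forall>z\<in>V. c i z = g z)"
        using k(1) i x V(2) frU(1) vector_bundle_frameD(1)[OF B V(1)]
        by (intro exI[of _ "U \<inter> V"] exI[of _ "k i"] conjI) (simp_all add: open_Int)
    qed
    moreover have "(fst \<circ> q) x = (\<Sum>i<r. c i x *\<^sub>R e i x)" if x: "x \<in> U" for x
      unfolding c_def using coords_sum[OF frU(2)[OF x], of "fst (q x)"] fib[of x] by auto
    ultimately show "\<exists>c. (\<forall>i<r. smooth_on_mfd M U (c i)) \<and> (\<forall>x\<in>U. (fst \<circ> q) x = (\<Sum>i<r. c i x *\<^sub>R e i x))"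
      by (intro exI[of _ c]) simp
  qed
  show "snd \<circ> q \<in> sections M B"
  proof (rule sectionsI)
    show "(snd \<circ> q) x \<in> fib B x" for x using fib[of x] by auto
    fix V s d assume V: "(V, s, d) \<in> frames B"
    note frV = vector_bundle_frameD[OF B V]
    define c where "c i x = coords s (\<lambda>i. d i x) (snd (q x)) i" for i x
    have "smooth_on_mfd M V (c i)" if i: "i < s" for i
    proof (rule smooth_on_mfd_local[OF M frV(1)])
      fix x assume x: "x \<in> V"
      obtain U r e where U: "(U, r, e) \<in> frames A" "x \<in> U"
        by (rule vector_bundle_frame_at[OF A])
      obtain k where k [rule_format]: "\<forall>i<r + s. smooth_on_mfd M (U \<inter> V) (k i)"
        "\<forall>x\<in>U \<inter> V. fst (q x) = (\<Sum>i<r. k i x *\<^sub>R e i x) \<and> snd (q x) = (\<Sum>i<s. k (r + i) x *\<^sub>R d i x)"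
        using comb[OF U(1) V] by (elim exE conjE)
      have "c i z = k (r + i) z" if z: "z \<in> U \<inter> V" for z
        unfolding c_def using k(2) z by (intro coords_unique[OF frV(2) _ i]) simp_all
      then show "\<exists>W g. open W \<and> x \<in> W \<and> W \<subseteq> V \<and> smooth_on_mfd M W g \<and> (\<forall>z\<in>W. c i z = g z)"
        using k(1) i x U(2) frV(1) vector_bundle_frameD(1)[OF A U(1)]
        by (intro exI[of _ "U \<inter> V"] exI[of _ "k (r + i)"] conjI) (simp_all add: open_Int)
    qed
    moreover have "(snd \<circ> q) x = (\<Sum>i<s. c i x *\<^sub>R d i x)" if x: "x \<in> V" for x
      unfolding c_def using coords_sum[OF frV(2)[OF x], of "snd (q x)"] fib[of x] by auto
    ultimately show "\<exists>c. (\<forall>i<s. smooth_on_mfd M V (c i)) \<and> (\<forall>x\<in>V. (snd \<circ> q) x = (\<Sum>i<s. c i x *\<^sub>R d i x))"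
      by (intro exI[of _ c]) simp
  qed
qed

lemma pair_sec_add: "pair_sec a b + pair_sec a' b' = pair_sec (a + a') (b + b')"
  by (simp add: pair_sec_def fun_eq_iff)

lemma pair_sec_diff: "pair_sec a b - pair_sec a' b' = pair_sec (a - a') (b - b')"
  by (simp add: pair_sec_def fun_eq_iff)

lemma pair_sec_uminus: "- pair_sec a b = pair_sec (- a) (- b)"
  by (simp add: pair_sec_def fun_eq_iff)

lemma pair_sec_scl: "f \<cdot> pair_sec a b = pair_sec (f \<cdot> a) (f \<cdot> b)"
  by (simp add: pair_sec_def scl_def fun_eq_iff)

lemma pair_sec_eq_iff [simp]: "pair_sec a b = pair_sec a' b' \<longleftrightarrow> a = a' \<and> b = b'"
  by (auto simp: pair_sec_def fun_eq_iff)


section \<open>The algebra of a bicrossproduct\<close>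

text \<open>Smooth sections form a proper subgroup of the group of all maps, and nothing is known of
  brackets or connections outside it. Scalars are left out because the identities to be compared
  involve only sums and signs.\<close>

definition add_subgroup :: "'x::ab_group_add set \<Rightarrow> bool" where
  "add_subgroup S \<longleftrightarrow> 0 \<in> S \<and> (\<forall>x\<in>S. \<forall>y\<in>S. x - y \<in> S)"

definition additive_on :: "'x::ab_group_add set \<Rightarrow> ('x \<Rightarrow> 'y::ab_group_add) \<Rightarrow> bool" where
  "additive_on S f \<longleftrightarrow> (\<forall>x\<in>S. \<forall>y\<in>S. f (x + y) = f x + f y)"

lemma add_subgroup_simps:
  assumes "add_subgroup S"
  shows "0 \<in> S" "\<And>x y. x \<in> S \<Longrightarrow> y \<in> S \<Longrightarrow> x - y \<in> S" "\<And>x. x \<in> S \<Longrightarrow> - x \<in> S"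
    "\<And>x y. x \<in> S \<Longrightarrow> y \<in> S \<Longrightarrow> x + y \<in> S"
proof -
  show 0: "0 \<in> S" and d: "\<And>x y. x \<in> S \<Longrightarrow> y \<in> S \<Longrightarrow> x - y \<in> S"
    using assms by (auto simp: add_subgroup_def)
  show m: "- x \<in> S" if "x \<in> S" for x using d[OF 0 that] by simp
  show "x + y \<in> S" if "x \<in> S" "y \<in> S" for x y using d[OF that(1) m[OF that(2)]] by simp
qed

lemma additive_on_simps:
  assumes S: "add_subgroup S" and f: "additive_on S f"
  shows "x \<in> S \<Longrightarrow> y \<in> S \<Longrightarrow> f (x + y) = f x + f y" "f 0 = 0"
    "x \<in> S \<Longrightarrow> f (- x) = - f x" "x \<in> S \<Longrightarrow> y \<in> S \<Longrightarrow> f (x - y) = f x - f y"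
proof -
  note S' = add_subgroup_simps[OF S]
  have add: "f (x + y) = f x + f y" if "x \<in> S" "y \<in> S" for x y
    using f that by (simp add: additive_on_def)
  show "f (x + y) = f x + f y" if "x \<in> S" "y \<in> S" by (rule add[OF that])
  show 0: "f 0 = 0" using add[OF S'(1) S'(1)] by simp
  have m: "f (- x) = - f x" if "x \<in> S" for x
    using add[OF that S'(3)[OF that]] 0 by (simp add: eq_neg_iff_add_eq_0 add.commute)
  show "x \<in> S \<Longrightarrow> f (- x) = - f x" by (rule m)
  show "f (x - y) = f x - f y" if "x \<in> S" "y \<in> S"
    using add[OF that(1) S'(3)[OF that(2)]] m[OF that(2)] by simp
qed

section \<open>Alternating maps on a product of two subgroups\<close>

lemma add_subgroup_Times: "add_subgroup S \<Longrightarrow> add_subgroup T \<Longrightarrow> add_subgroup (S \<times> T)"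
  by (auto simp: add_subgroup_def zero_prod_def)

lemma alternating3_eq_0I:
  fixes F :: "'a::ab_group_add \<times> 'b::ab_group_add \<Rightarrow> 'a \<times> 'b \<Rightarrow> 'a \<times> 'b \<Rightarrow> 'd::ab_group_add"
  assumes S: "add_subgroup SA" "add_subgroup SB"
    and add: "\<And>x y q r. x \<in> SA \<times> SB \<Longrightarrow> y \<in> SA \<times> SB \<Longrightarrow> q \<in> SA \<times> SB \<Longrightarrow> r \<in> SA \<times> SB \<Longrightarrow>
        F (x + y) q r = F x q r + F y q r"
    and s12: "\<And>p q r. p \<in> SA \<times> SB \<Longrightarrow> q \<in> SA \<times> SB \<Longrightarrow> r \<in> SA \<times> SB \<Longrightarrow> F p q r = - F q p r"
    and s23: "\<And>p q r. p \<in> SA \<times> SB \<Longrightarrow> q \<in> SA \<times> SB \<Longrightarrow> r \<in> SA \<times> SB \<Longrightarrow> F p q r = - F p r q"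
    and aaa: "\<And>a1 a2 a3. a1 \<in> SA \<Longrightarrow> a2 \<in> SA \<Longrightarrow> a3 \<in> SA \<Longrightarrow> F (a1, 0) (a2, 0) (a3, 0) = 0"
    and aab: "\<And>a1 a2 b. a1 \<in> SA \<Longrightarrow> a2 \<in> SA \<Longrightarrow> b \<in> SB \<Longrightarrow> F (a1, 0) (a2, 0) (0, b) = 0"
    and bba: "\<And>b1 b2 a. b1 \<in> SB \<Longrightarrow> b2 \<in> SB \<Longrightarrow> a \<in> SA \<Longrightarrow> F (0, b1) (0, b2) (a, 0) = 0"
    and bbb: "\<And>b1 b2 b3. b1 \<in> SB \<Longrightarrow> b2 \<in> SB \<Longrightarrow> b3 \<in> SB \<Longrightarrow> F (0, b1) (0, b2) (0, b3) = 0"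
    and q: "q1 \<in> SA \<times> SB" "q2 \<in> SA \<times> SB" "q3 \<in> SA \<times> SB"
  shows "F q1 q2 q3 = 0"
proof -
  define P where "P = SA \<times> {0} \<union> {0} \<times> SB"
  note z = add_subgroup_simps(1)[OF S(1)] add_subgroup_simps(1)[OF S(2)]
  have P: "p \<in> SA \<times> SB" if "p \<in> P" for p using that z by (auto simp: P_def)
  have 0: "F p q r = 0" if "p \<in> P" "q \<in> P" "r \<in> P" for p q r
  proof -
    have aba: "F (a, 0) (0, b) (a', 0) = 0" if "a \<in> SA" "b \<in> SB" "a' \<in> SA" for a b a'
      using s23[of "(a, 0)" "(0, b)" "(a', 0)"] aab[of a a' b] that z by simp
    have bab: "F (0, b) (a, 0) (0, b') = 0" if "a \<in> SA" "b \<in> SB" "b' \<in> SB" for a b b'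
      using s23[of "(0, b)" "(a, 0)" "(0, b')"] bba[of b b' a] that z by simp
    have baa: "F (0, b) (a, 0) (a', 0) = 0" if "a \<in> SA" "b \<in> SB" "a' \<in> SA" for a b a'
      using s12[of "(0, b)" "(a, 0)" "(a', 0)"] aba that z by simp
    have abb: "F (a, 0) (0, b) (0, b') = 0" if "a \<in> SA" "b \<in> SB" "b' \<in> SB" for a b b'
      using s12[of "(a, 0)" "(0, b)" "(0, b')"] bab that z by simp
    show ?thesis
      using that unfolding P_def by (auto simp: aaa aab aba abb baa bab bba bbb)
  qed
  have parts: "(fst q, 0) \<in> P" "(0, snd q) \<in> P" if "q \<in> SA \<times> SB" for q
    using that by (auto simp: P_def)
  have split: "F q p r = F (fst q, 0) p r + F (0, snd q) p r"
    if "q \<in> SA \<times> SB" "p \<in> SA \<times> SB" "r \<in> SA \<times> SB" for q p r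
    using add[OF parts[OF that(1), THEN P] that(2,3)] by simp
  have gen1: "F q p r = 0" if "q \<in> SA \<times> SB" "p \<in> P" "r \<in> P" for q p r
    using split[OF that(1) P[OF that(2)] P[OF that(3)]] parts[OF that(1)] 0 that(2,3) by simp
  have gen1': "F p q r = 0" if "q \<in> SA \<times> SB" "p \<in> P" "r \<in> P" for q p r
    using s12[OF P[OF that(2)] that(1) P[OF that(3)]] gen1[OF that] by simp
  have gen2: "F q p r = 0" if "q \<in> SA \<times> SB" "p \<in> SA \<times> SB" "r \<in> P" for q p r
    using split[OF that(1,2) P[OF that(3)]] gen1'[OF that(2) _ that(3)] parts[OF that(1)] by simp
  have swap13: "F p q r = - F r q p" if "p \<in> SA \<times> SB" "q \<in> SA \<times> SB" "r \<in> SA \<times> SB" for p q r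
    using s12[OF that] s23[OF that(2,1,3)] s12[OF that(2,3,1)] by simp
  have gen2': "F p q2 q1 = 0" if "p \<in> P" for p
    using swap13[OF P[OF that] q(2,1)] gen2[OF q(1,2) that] by simp
  have "F q3 q2 q1 = 0"
    using split[OF q(3,2,1)] gen2'[OF parts(1)[OF q(3)]] gen2'[OF parts(2)[OF q(3)]] by simp
  then show ?thesis using swap13[OF q] by simp
qed

text \<open>The general last argument is exchanged with the first one, split there by additivity,
  and its two pure parts are moved back to the end. This reduces the claim to a pure last
  argument.\<close>

lemma alternating4_eq_0I:
  fixes F :: "'a::ab_group_add \<times> 'b::ab_group_add \<Rightarrow> 'a \<times> 'b \<Rightarrow> 'a \<times> 'b \<Rightarrow> 'a \<times> 'b \<Rightarrow> 'd::ab_group_add"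
  assumes S: "add_subgroup SA" "add_subgroup SB"
    and add: "\<And>x y q r s. x \<in> SA \<times> SB \<Longrightarrow> y \<in> SA \<times> SB \<Longrightarrow> q \<in> SA \<times> SB \<Longrightarrow> r \<in> SA \<times> SB \<Longrightarrow>
        s \<in> SA \<times> SB \<Longrightarrow> F (x + y) q r s = F x q r s + F y q r s"
    and s12: "\<And>p q r s. p \<in> SA \<times> SB \<Longrightarrow> q \<in> SA \<times> SB \<Longrightarrow> r \<in> SA \<times> SB \<Longrightarrow> s \<in> SA \<times> SB \<Longrightarrow>
        F p q r s = - F q p r s"
    and s23: "\<And>p q r s. p \<in> SA \<times> SB \<Longrightarrow> q \<in> SA \<times> SB \<Longrightarrow> r \<in> SA \<times> SB \<Longrightarrow> s \<in> SA \<times> SB \<Longrightarrow>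
        F p q r s = - F p r q s"
    and s34: "\<And>p q r s. p \<in> SA \<times> SB \<Longrightarrow> q \<in> SA \<times> SB \<Longrightarrow> r \<in> SA \<times> SB \<Longrightarrow> s \<in> SA \<times> SB \<Longrightarrow>
        F p q r s = - F p q s r"
    and aaaa: "\<And>a1 a2 a3 a4. a1 \<in> SA \<Longrightarrow> a2 \<in> SA \<Longrightarrow> a3 \<in> SA \<Longrightarrow> a4 \<in> SA \<Longrightarrow>
        F (a1, 0) (a2, 0) (a3, 0) (a4, 0) = 0"
    and aaab: "\<And>a1 a2 a3 b. a1 \<in> SA \<Longrightarrow> a2 \<in> SA \<Longrightarrow> a3 \<in> SA \<Longrightarrow> b \<in> SB \<Longrightarrow>
        F (a1, 0) (a2, 0) (a3, 0) (0, b) = 0"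
    and aabb: "\<And>a1 a2 b1 b2. a1 \<in> SA \<Longrightarrow> a2 \<in> SA \<Longrightarrow> b1 \<in> SB \<Longrightarrow> b2 \<in> SB \<Longrightarrow>
        F (a1, 0) (a2, 0) (0, b1) (0, b2) = 0"
    and bbba: "\<And>b1 b2 b3 a. b1 \<in> SB \<Longrightarrow> b2 \<in> SB \<Longrightarrow> b3 \<in> SB \<Longrightarrow> a \<in> SA \<Longrightarrow>
        F (0, b1) (0, b2) (0, b3) (a, 0) = 0"
    and bbbb: "\<And>b1 b2 b3 b4. b1 \<in> SB \<Longrightarrow> b2 \<in> SB \<Longrightarrow> b3 \<in> SB \<Longrightarrow> b4 \<in> SB \<Longrightarrow>
        F (0, b1) (0, b2) (0, b3) (0, b4) = 0"
    and q: "q1 \<in> SA \<times> SB" "q2 \<in> SA \<times> SB" "q3 \<in> SA \<times> SB" "q4 \<in> SA \<times> SB"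
  shows "F q1 q2 q3 q4 = 0"
proof -
  note z = add_subgroup_simps(1)[OF S(1)] add_subgroup_simps(1)[OF S(2)]
  have swap13: "F p q r s = - F r q p s"
    if "p \<in> SA \<times> SB" "q \<in> SA \<times> SB" "r \<in> SA \<times> SB" "s \<in> SA \<times> SB" for p q r s
    using s12[of p q r s] s23[of q p r s] s12[of q r p s] that by simp
  \<comment> \<open>Freezing a pure last argument reduces to the trilinear case.\<close>
  have a: "F p q r (a, 0) = 0" if "a \<in> SA" "p \<in> SA \<times> SB" "q \<in> SA \<times> SB" "r \<in> SA \<times> SB" for p q r a
  proof (rule alternating3_eq_0I[where F = "\<lambda>p q r. F p q r (a, 0)", OF S _ _ _ _ _ _ _ that(2-4)])
    fix a1 a2 b assume *: "a1 \<in> SA" "a2 \<in> SA" "b \<in> SB"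
    show "F (a1, 0) (a2, 0) (0, b) (a, 0) = 0"
      using s34[of "(a1, 0)" "(a2, 0)" "(0, b)" "(a, 0)"] aaab[of a1 a2 a b] * z that by simp
  next
    fix b1 b2 a1 assume *: "b1 \<in> SB" "b2 \<in> SB" "a1 \<in> SA"
    \<comment> \<open>The type BBAA is sorted into AABB by transpositions; the sign is irrelevant
      since the value is 0.\<close>
    have "F (0, b1) (a1, 0) (a, 0) (0, b2) = 0"
      using swap13[of "(0, b1)" "(a1, 0)" "(a, 0)" "(0, b2)"] s34[of "(a, 0)" "(a1, 0)" "(0, b1)" "(0, b2)"]
        aabb[of a a1 b1 b2] * z that by simp
    then show "F (0, b1) (0, b2) (a1, 0) (a, 0) = 0"
      using s23[of "(0, b1)" "(0, b2)" "(a1, 0)" "(a, 0)"] s34[of "(0, b1)" "(a1, 0)" "(0, b2)" "(a, 0)"] * z that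
      by simp
  qed (use that z in \<open>auto simp: aaaa bbba intro: add s12 s23\<close>)
  have b: "F p q r (0, b) = 0" if "b \<in> SB" "p \<in> SA \<times> SB" "q \<in> SA \<times> SB" "r \<in> SA \<times> SB" for p q r b
  proof (rule alternating3_eq_0I[where F = "\<lambda>p q r. F p q r (0, b)", OF S _ _ _ _ _ _ _ that(2-4)])
    fix b1 b2 a assume *: "b1 \<in> SB" "b2 \<in> SB" "a \<in> SA"
    show "F (0, b1) (0, b2) (a, 0) (0, b) = 0"
      using s34[of "(0, b1)" "(0, b2)" "(a, 0)" "(0, b)"] bbba[of b1 b2 b a] * z that by simp
  qed (use that z in \<open>auto simp: aaab aabb bbbb intro: add s12 s23\<close>)
  have swap14: "F p q r s = - F s q r p"
    if "p \<in> SA \<times> SB" "q \<in> SA \<times> SB" "r \<in> SA \<times> SB" "s \<in> SA \<times> SB" for p q r s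
    using swap13[of p q r s] s34[of r q p s] swap13[of r q s p] that by simp
  have parts: "(fst q4, 0) \<in> SA \<times> SB" "(0, snd q4) \<in> SA \<times> SB" "fst q4 \<in> SA" "snd q4 \<in> SB"
    using q(4) z by auto
  have "F q4 q2 q3 q1 = F (fst q4, 0) q2 q3 q1 + F (0, snd q4) q2 q3 q1"
    using add[OF parts(1,2) q(2,3,1)] by simp
  also have "\<dots> = 0"
    using swap14[OF parts(1) q(2,3,1)] swap14[OF parts(2) q(2,3,1)]
      a[OF parts(3) q(1-3)] b[OF parts(4) q(1-3)] by simp
  finally show ?thesis using swap14[OF q] by simp
qed

text \<open>Collects the typing, additivity and skew-symmetry of a split structure without the
  axioms that relate its pieces. Those axioms can then be studied as defects that may or may not
  vanish. Additivity in the remaining arguments of bracket and form follows from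
  skew-symmetry.\<close>

locale skew_bracket =
  fixes S :: "'q::ab_group_add set" and T :: "'c::ab_group_add set"
    and br :: "'q \<Rightarrow> 'q \<Rightarrow> 'q" and nab :: "'q \<Rightarrow> 'c \<Rightarrow> 'c" and l :: "'c \<Rightarrow> 'q"
    and om :: "'q \<Rightarrow> 'q \<Rightarrow> 'q \<Rightarrow> 'c"
  assumes S: "add_subgroup S" and T: "add_subgroup T"
    and br_in [simp]: "q \<in> S \<Longrightarrow> r \<in> S \<Longrightarrow> br q r \<in> S"
    and br_add1: "p \<in> S \<Longrightarrow> q \<in> S \<Longrightarrow> r \<in> S \<Longrightarrow> br (p + q) r = br p r + br q r"
    and br_skew: "q \<in> S \<Longrightarrow> r \<in> S \<Longrightarrow> br q r = - br r q"
    and nab_in [simp]: "q \<in> S \<Longrightarrow> c \<in> T \<Longrightarrow> nab q c \<in> T"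
    and nab_add1: "p \<in> S \<Longrightarrow> q \<in> S \<Longrightarrow> c \<in> T \<Longrightarrow> nab (p + q) c = nab p c + nab q c"
    and nab_add2: "q \<in> S \<Longrightarrow> c \<in> T \<Longrightarrow> c' \<in> T \<Longrightarrow> nab q (c + c') = nab q c + nab q c'"
    and l_in [simp]: "c \<in> T \<Longrightarrow> l c \<in> S"
    and l_add: "c \<in> T \<Longrightarrow> c' \<in> T \<Longrightarrow> l (c + c') = l c + l c'"
    and om_in [simp]: "p \<in> S \<Longrightarrow> q \<in> S \<Longrightarrow> r \<in> S \<Longrightarrow> om p q r \<in> T"
    and om_add1: "p \<in> S \<Longrightarrow> p' \<in> S \<Longrightarrow> q \<in> S \<Longrightarrow> r \<in> S \<Longrightarrow> om (p + p') q r = om p q r + om p' q r"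
    and om_skew12: "p \<in> S \<Longrightarrow> q \<in> S \<Longrightarrow> r \<in> S \<Longrightarrow> om p q r = - om q p r"
    and om_skew23: "p \<in> S \<Longrightarrow> q \<in> S \<Longrightarrow> r \<in> S \<Longrightarrow> om p q r = - om p r q"
begin

lemmas S_simps [simp] = add_subgroup_simps[OF S]
lemmas T_simps [simp] = add_subgroup_simps[OF T]

lemma br_add2: "p \<in> S \<Longrightarrow> q \<in> S \<Longrightarrow> r \<in> S \<Longrightarrow> br r (p + q) = br r p + br r q"
  using br_skew[of r "p + q"] br_skew[of r p] br_skew[of r q] by (simp add: br_add1)

lemma om_add2: "p \<in> S \<Longrightarrow> p' \<in> S \<Longrightarrow> q \<in> S \<Longrightarrow> r \<in> S \<Longrightarrow> om q (p + p') r = om q p r + om q p' r"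
  using om_skew12[of q "p + p'" r] om_skew12[of q p r] om_skew12[of q p' r] by (simp add: om_add1)

lemma om_add3: "p \<in> S \<Longrightarrow> p' \<in> S \<Longrightarrow> q \<in> S \<Longrightarrow> r \<in> S \<Longrightarrow> om q r (p + p') = om q r p + om q r p'"
  using om_skew23[of q r "p + p'"] om_skew23[of q r p] om_skew23[of q r p'] by (simp add: om_add2)

lemma br_minus [simp]: "q \<in> S \<Longrightarrow> r \<in> S \<Longrightarrow> br (- q) r = - br q r" "q \<in> S \<Longrightarrow> r \<in> S \<Longrightarrow> br r (- q) = - br r q"
  using additive_on_simps(3)[OF S, of "\<lambda>q. br q r" q] additive_on_simps(3)[OF S, of "br r" q]
  by (simp_all add: additive_on_def br_add1 br_add2)

lemma nab_minus [simp]: "q \<in> S \<Longrightarrow> c \<in> T \<Longrightarrow> nab (- q) c = - nab q c" "q \<in> S \<Longrightarrow> c \<in> T \<Longrightarrow> nab q (- c) = - nab q c"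
  using additive_on_simps(3)[OF S, of "\<lambda>q. nab q c" q] additive_on_simps(3)[OF T, of "nab q" c]
  by (simp_all add: additive_on_def nab_add1 nab_add2)

lemma l_minus [simp]: "c \<in> T \<Longrightarrow> l (- c) = - l c"
  using additive_on_simps(3)[OF T, of l c] by (simp add: additive_on_def l_add)

lemma om_minus [simp]:
  assumes "p \<in> S" "q \<in> S" "r \<in> S"
  shows "om (- p) q r = - om p q r" "om p (- q) r = - om p q r" "om p q (- r) = - om p q r"
  using assms additive_on_simps(3)[OF S, of "\<lambda>p. om p q r" p] additive_on_simps(3)[OF S, of "\<lambda>q. om p q r" q]
    additive_on_simps(3)[OF S, of "om p q" r]
  by (simp_all add: additive_on_def om_add1 om_add2 om_add3)

lemmas biadditive = br_add1 br_add2 nab_add1 nab_add2 l_add om_add1 om_add2 om_add3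

definition jac_defect :: "'q \<Rightarrow> 'q \<Rightarrow> 'q \<Rightarrow> 'q" where
  "jac_defect p q r = Jac br p q r - l (om p q r)"

text \<open>The plus sign comes from undoing the duality: on C^* the curvature is minus the
  transpose of the curvature on C.\<close>

definition curv_defect :: "'q \<Rightarrow> 'q \<Rightarrow> 'c \<Rightarrow> 'c" where
  "curv_defect p q c = curvature br nab p q c + om p q (l c)"

lemma jac_defect_add:
  assumes "p \<in> S" "p' \<in> S" "q \<in> S" "r \<in> S"
  shows "jac_defect (p + p') q r = jac_defect p q r + jac_defect p' q r"
  using assms by (simp add: jac_defect_def Jac_def biadditive algebra_simps)

text \<open>The Jacobiator of a skew-symmetric bracket is alternating whether or not the Jacobi
  identity holds, and \<open>om\<close> is alternating by assumption.\<close>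

lemma jac_defect_skew12:
  assumes "p \<in> S" "q \<in> S" "r \<in> S"
  shows "jac_defect p q r = - jac_defect q p r"
  using assms br_skew[of p q] om_skew12[of p q r] by (simp add: jac_defect_def Jac_def algebra_simps)

lemma jac_defect_skew23:
  assumes "p \<in> S" "q \<in> S" "r \<in> S"
  shows "jac_defect p q r = - jac_defect p r q"
  using assms br_skew[of q r] br_skew[of "br p q" r] br_skew[of "br p r" q] om_skew23[of p q r]
  by (simp add: jac_defect_def Jac_def algebra_simps)

lemma curv_defect_add:
  assumes "p \<in> S" "p' \<in> S" "q \<in> S" "c \<in> T"
  shows "curv_defect (p + p') q c = curv_defect p q c + curv_defect p' q c"
  using assms by (simp add: curv_defect_def curvature_def biadditive algebra_simps)

lemma curv_defect_skew:
  assumes "p \<in> S" "q \<in> S" "c \<in> T"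
  shows "curv_defect p q c = - curv_defect q p c"
  using assms br_skew[of p q] om_skew12[of p q "l c"]
  by (simp add: curv_defect_def curvature_def algebra_simps)

lemma d3_add:
  assumes "p \<in> S" "p' \<in> S" "q \<in> S" "r \<in> S" "s \<in> S"
  shows "d3 br nab om (p + p') q r s = d3 br nab om p q r s + d3 br nab om p' q r s"
  using assms by (simp add: d3_def biadditive algebra_simps)

text \<open>Exchanging neighbouring arguments permutes the ten Koszul terms up to sign;
  skew-symmetry of \<open>br\<close> and \<open>om\<close> accounts for the terms in which the
  exchanged arguments occur together.\<close>

lemma d3_skew12:
  assumes "p \<in> S" "q \<in> S" "r \<in> S" "s \<in> S"
  shows "d3 br nab om p q r s = - d3 br nab om q p r s"
  using assms br_skew[of p q] om_skew12[of p q r] om_skew12[of p q s] om_skew12[of p q "br r s"]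
    om_skew23[of "br r s" p q]
  by (simp add: d3_def algebra_simps)

lemma d3_skew23:
  assumes "p \<in> S" "q \<in> S" "r \<in> S" "s \<in> S"
  shows "d3 br nab om p q r s = - d3 br nab om p r q s"
  using assms br_skew[of q r] om_skew12[of q r s] om_skew23[of p q r] om_skew23[of "br p s" q r]
  by (simp add: d3_def algebra_simps)

lemma d3_skew34:
  assumes "p \<in> S" "q \<in> S" "r \<in> S" "s \<in> S"
  shows "d3 br nab om p q r s = - d3 br nab om p q s r"
  using assms br_skew[of r s] om_skew23[of p r s] om_skew23[of q r s] om_skew23[of "br p q" r s]
  by (simp add: d3_def algebra_simps)

end

text \<open>The data of two actions up to homotopy without their defining or compatibility
  identities, so that equivalences about these identities can be proved. Pairs in
  \<open>SA \<times> SB\<close> stand for sections of the sum.\<close>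

locale bicrossed =
  fixes SA :: "'a::ab_group_add set" and SB :: "'b::ab_group_add set" and SC :: "'c::ab_group_add set"
    and brA :: "'a \<Rightarrow> 'a \<Rightarrow> 'a" and brB :: "'b \<Rightarrow> 'b \<Rightarrow> 'b"
    and AB :: "'a \<Rightarrow> 'b \<Rightarrow> 'b" and BA :: "'b \<Rightarrow> 'a \<Rightarrow> 'a"
    and AC :: "'a \<Rightarrow> 'c \<Rightarrow> 'c" and BC :: "'b \<Rightarrow> 'c \<Rightarrow> 'c"
    and dA :: "'c \<Rightarrow> 'a" and dB :: "'c \<Rightarrow> 'b"
    and RA :: "'a \<Rightarrow> 'a \<Rightarrow> 'b \<Rightarrow> 'c" and RB :: "'b \<Rightarrow> 'b \<Rightarrow> 'a \<Rightarrow> 'c"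
  assumes SA: "add_subgroup SA" and SB: "add_subgroup SB" and SC: "add_subgroup SC"
    and in_sets [simp]:
      "\<And>a a'. a \<in> SA \<Longrightarrow> a' \<in> SA \<Longrightarrow> brA a a' \<in> SA" "\<And>b b'. b \<in> SB \<Longrightarrow> b' \<in> SB \<Longrightarrow> brB b b' \<in> SB"
      "\<And>a b. a \<in> SA \<Longrightarrow> b \<in> SB \<Longrightarrow> AB a b \<in> SB" "\<And>b a. b \<in> SB \<Longrightarrow> a \<in> SA \<Longrightarrow> BA b a \<in> SA"
      "\<And>a c. a \<in> SA \<Longrightarrow> c \<in> SC \<Longrightarrow> AC a c \<in> SC" "\<And>b c. b \<in> SB \<Longrightarrow> c \<in> SC \<Longrightarrow> BC b c \<in> SC"
      "\<And>c. c \<in> SC \<Longrightarrow> dA c \<in> SA" "\<And>c. c \<in> SC \<Longrightarrow> dB c \<in> SB"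
      "\<And>a a' b. a \<in> SA \<Longrightarrow> a' \<in> SA \<Longrightarrow> b \<in> SB \<Longrightarrow> RA a a' b \<in> SC"
      "\<And>b b' a. b \<in> SB \<Longrightarrow> b' \<in> SB \<Longrightarrow> a \<in> SA \<Longrightarrow> RB b b' a \<in> SC"
    and additive:
      "\<And>a. a \<in> SA \<Longrightarrow> additive_on SA (\<lambda>a'. brA a' a)" "\<And>b. b \<in> SB \<Longrightarrow> additive_on SB (\<lambda>b'. brB b' b)"
      "\<And>b. b \<in> SB \<Longrightarrow> additive_on SA (\<lambda>a. AB a b)" "\<And>a. a \<in> SA \<Longrightarrow> additive_on SB (AB a)"
      "\<And>a. a \<in> SA \<Longrightarrow> additive_on SB (\<lambda>b. BA b a)" "\<And>b. b \<in> SB \<Longrightarrow> additive_on SA (BA b)"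
      "\<And>c. c \<in> SC \<Longrightarrow> additive_on SA (\<lambda>a. AC a c)" "\<And>a. a \<in> SA \<Longrightarrow> additive_on SC (AC a)"
      "\<And>c. c \<in> SC \<Longrightarrow> additive_on SB (\<lambda>b. BC b c)" "\<And>b. b \<in> SB \<Longrightarrow> additive_on SC (BC b)"
      "additive_on SC dA" "additive_on SC dB"
      "\<And>a b. a \<in> SA \<Longrightarrow> b \<in> SB \<Longrightarrow> additive_on SA (\<lambda>a'. RA a' a b)"
      "\<And>a a'. a \<in> SA \<Longrightarrow> a' \<in> SA \<Longrightarrow> additive_on SB (RA a a')"
      "\<And>b a. b \<in> SB \<Longrightarrow> a \<in> SA \<Longrightarrow> additive_on SB (\<lambda>b'. RB b' b a)"
      "\<And>b b'. b \<in> SB \<Longrightarrow> b' \<in> SB \<Longrightarrow> additive_on SA (RB b b')"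
    and brA_skew: "\<And>a a'. a \<in> SA \<Longrightarrow> a' \<in> SA \<Longrightarrow> brA a a' = - brA a' a"
    and brB_skew: "\<And>b b'. b \<in> SB \<Longrightarrow> b' \<in> SB \<Longrightarrow> brB b b' = - brB b' b"
    and RA_skew: "\<And>a a' b. a \<in> SA \<Longrightarrow> a' \<in> SA \<Longrightarrow> b \<in> SB \<Longrightarrow> RA a a' b = - RA a' a b"
    and RB_skew: "\<And>b b' a. b \<in> SB \<Longrightarrow> b' \<in> SB \<Longrightarrow> a \<in> SA \<Longrightarrow> RB b b' a = - RB b' b a"
begin

lemmas set_simps [simp] = add_subgroup_simps[OF SA] add_subgroup_simps[OF SB] add_subgroup_simps[OF SC]

lemma additive_brA2: "a \<in> SA \<Longrightarrow> additive_on SA (brA a)"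
  unfolding additive_on_def
  using brA_skew[of a] additive_on_simps(1)[OF SA additive(1), of a] by simp

lemma additive_brB2: "b \<in> SB \<Longrightarrow> additive_on SB (brB b)"
  unfolding additive_on_def
  using brB_skew[of b] additive_on_simps(1)[OF SB additive(2), of b] by simp

lemma additive_RA2: "a \<in> SA \<Longrightarrow> b \<in> SB \<Longrightarrow> additive_on SA (\<lambda>a'. RA a a' b)"
  unfolding additive_on_def
  using RA_skew[of a _ b] additive_on_simps(1)[OF SA additive(13), of a b] by simp

lemma additive_RB2: "b \<in> SB \<Longrightarrow> a \<in> SA \<Longrightarrow> additive_on SB (\<lambda>b'. RB b b' a)"
  unfolding additive_on_def
  using RB_skew[of b _ a] additive_on_simps(1)[OF SB additive(15), of b a] by simp

text \<open>As rewrite rules these delete every term with a zero argument. Evaluation on pure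
  arguments, where most terms vanish, thereby becomes a matter of simplification.\<close>

lemmas add_simps [simp] =
  additive_on_simps[OF SA additive(1)] additive_on_simps[OF SB additive(2)]
  additive_on_simps[OF SA additive_brA2] additive_on_simps[OF SB additive_brB2]
  additive_on_simps[OF SA additive(3)] additive_on_simps[OF SB additive(4)]
  additive_on_simps[OF SB additive(5)] additive_on_simps[OF SA additive(6)]
  additive_on_simps[OF SA additive(7)] additive_on_simps[OF SC additive(8)]
  additive_on_simps[OF SB additive(9)] additive_on_simps[OF SC additive(10)]
  additive_on_simps[OF SC additive(11)] additive_on_simps[OF SC additive(12)]
  additive_on_simps[OF SA additive(13)] additive_on_simps[OF SB additive(14)]
  additive_on_simps[OF SB additive(15)] additive_on_simps[OF SA additive(16)]
  additive_on_simps[OF SA additive_RA2] additive_on_simps[OF SB additive_RB2]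

definition br :: "'a \<times> 'b \<Rightarrow> 'a \<times> 'b \<Rightarrow> 'a \<times> 'b" where
  "br p q = (brA (fst p) (fst q) + BA (snd p) (fst q) - BA (snd q) (fst p),
             brB (snd p) (snd q) + AB (fst p) (snd q) - AB (fst q) (snd p))"

definition nab :: "'a \<times> 'b \<Rightarrow> 'c \<Rightarrow> 'c" where
  "nab q c = AC (fst q) c + BC (snd q) c"

definition l :: "'c \<Rightarrow> 'a \<times> 'b" where
  "l c = (dA c, - dB c)"

definition om :: "'a \<times> 'b \<Rightarrow> 'a \<times> 'b \<Rightarrow> 'a \<times> 'b \<Rightarrow> 'c" where
  "om p q r = RA (fst p) (fst q) (snd r) + RA (fst q) (fst r) (snd p) + RA (fst r) (fst p) (snd q)
     - RB (snd p) (snd q) (fst r) - RB (snd q) (snd r) (fst p) - RB (snd r) (snd p) (fst q)"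

sublocale Q: skew_bracket "SA \<times> SB" SC br nab l om
proof
  show "add_subgroup (SA \<times> SB)" by (rule add_subgroup_Times[OF SA SB])
  show "add_subgroup SC" by (rule SC)
  show "br q r = - br r q" if "q \<in> SA \<times> SB" "r \<in> SA \<times> SB" for q r
    using that brA_skew[of "fst q" "fst r"] brB_skew[of "snd q" "snd r"]
    by (auto simp: br_def prod_eq_iff)
  show "om p q r = - om q p r" if "p \<in> SA \<times> SB" "q \<in> SA \<times> SB" "r \<in> SA \<times> SB" for p q r
    using that RA_skew[of "fst p" "fst q" "snd r"] RA_skew[of "fst q" "fst r" "snd p"] RA_skew[of "fst r" "fst p" "snd q"]
      RB_skew[of "snd p" "snd q" "fst r"] RB_skew[of "snd q" "snd r" "fst p"] RB_skew[of "snd r" "snd p" "fst q"]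
    by (auto simp: om_def algebra_simps)
  show "om p q r = - om p r q" if "p \<in> SA \<times> SB" "q \<in> SA \<times> SB" "r \<in> SA \<times> SB" for p q r
    using that RA_skew[of "fst p" "fst q" "snd r"] RA_skew[of "fst q" "fst r" "snd p"] RA_skew[of "fst r" "fst p" "snd q"]
      RB_skew[of "snd p" "snd q" "fst r"] RB_skew[of "snd q" "snd r" "fst p"] RB_skew[of "snd r" "snd p" "fst q"]
    by (auto simp: om_def algebra_simps)
qed (auto simp: br_def nab_def l_def om_def algebra_simps)

text \<open>On mixed triples each of the two components carries its own identity. For type AAB the
  A-component measures how far \<open>BA\<close> is from deriving the bracket of A up to
  \<open>RA\<close>, and the B-component compares the curvature of \<open>AB\<close> with
  \<open>dB\<close> after \<open>RA\<close>. The minus signs at \<open>dB\<close> in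
  \<open>l\<close> and at \<open>RB\<close> in \<open>om\<close> make type BBA the mirror
  image.\<close>

lemma jac_defect_pure:
  assumes "a1 \<in> SA" "a2 \<in> SA" "b1 \<in> SB" "b2 \<in> SB"
  shows "a3 \<in> SA \<Longrightarrow> Q.jac_defect (a1, 0) (a2, 0) (a3, 0) = (Jac brA a1 a2 a3, 0)"
    and "b3 \<in> SB \<Longrightarrow> Q.jac_defect (0, b1) (0, b2) (0, b3) = (0, Jac brB b1 b2 b3)"
    and "Q.jac_defect (a1, 0) (a2, 0) (0, b1) =
      (- BA b1 (brA a1 a2) + brA (BA b1 a1) a2 + brA a1 (BA b1 a2) + BA (AB a2 b1) a1 - BA (AB a1 b1) a2
         - dA (RA a1 a2 b1),
       dB (RA a1 a2 b1) - curvature brA AB a1 a2 b1)"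
    and "Q.jac_defect (0, b1) (0, b2) (a1, 0) =
      (dA (RB b1 b2 a1) - curvature brB BA b1 b2 a1,
       - AB a1 (brB b1 b2) + brB (AB a1 b1) b2 + brB b1 (AB a1 b2) + AB (BA b2 a1) b1 - AB (BA b1 a1) b2
         - dB (RB b1 b2 a1))"
  using assms brA_skew[of a2 "BA b1 a1"] brB_skew[of b2 "AB a1 b1"]
  by (simp_all add: Q.jac_defect_def Jac_def br_def l_def om_def curvature_def algebra_simps)

text \<open>The types AAA and BBB yield the two Jacobi identities. The types AAB and BBA have two
  components each and yield (M5), (M6) and the curvature identities on the terms B and A of the
  2-representations.\<close>

lemma Jac_br_iff:
  "(\<forall>q1\<in>SA \<times> SB. \<forall>q2\<in>SA \<times> SB. \<forall>q3\<in>SA \<times> SB. Jac br q1 q2 q3 = l (om q1 q2 q3)) \<longleftrightarrow>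
   (\<forall>a1\<in>SA. \<forall>a2\<in>SA. \<forall>a3\<in>SA. Jac brA a1 a2 a3 = 0) \<and>
   (\<forall>b1\<in>SB. \<forall>b2\<in>SB. \<forall>b3\<in>SB. Jac brB b1 b2 b3 = 0) \<and>
   (\<forall>a1\<in>SA. \<forall>a2\<in>SA. \<forall>b\<in>SB. dA (RA a1 a2 b) = - BA b (brA a1 a2) + brA (BA b a1) a2 + brA a1 (BA b a2)
      + BA (AB a2 b) a1 - BA (AB a1 b) a2) \<and>
   (\<forall>b1\<in>SB. \<forall>b2\<in>SB. \<forall>a\<in>SA. dB (RB b1 b2 a) = - AB a (brB b1 b2) + brB (AB a b1) b2 + brB b1 (AB a b2)
      + AB (BA b2 a) b1 - AB (BA b1 a) b2) \<and>
   (\<forall>a1\<in>SA. \<forall>a2\<in>SA. \<forall>b\<in>SB. curvature brA AB a1 a2 b = dB (RA a1 a2 b)) \<and>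
   (\<forall>b1\<in>SB. \<forall>b2\<in>SB. \<forall>a\<in>SA. curvature brB BA b1 b2 a = dA (RB b1 b2 a))"
  (is "?L \<longleftrightarrow> ?R")
proof -
  have L: "?L \<longleftrightarrow> (\<forall>q1\<in>SA \<times> SB. \<forall>q2\<in>SA \<times> SB. \<forall>q3\<in>SA \<times> SB. Q.jac_defect q1 q2 q3 = 0)"
    by (simp add: Q.jac_defect_def)
  show ?thesis
  proof
    assume ?L
    then have *: "Q.jac_defect q1 q2 q3 = 0" if "q1 \<in> SA \<times> SB" "q2 \<in> SA \<times> SB" "q3 \<in> SA \<times> SB" for q1 q2 q3
      using that unfolding L by blast
    show ?R
    proof (intro conjI ballI)
      fix a1 a2 b assume "a1 \<in> SA" "a2 \<in> SA" "b \<in> SB"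
      from *[of "(a1, 0)" "(a2, 0)" "(0, b)"] jac_defect_pure(3)[OF this this(3)] this
      show "dA (RA a1 a2 b) = - BA b (brA a1 a2) + brA (BA b a1) a2 + brA a1 (BA b a2)
          + BA (AB a2 b) a1 - BA (AB a1 b) a2" "curvature brA AB a1 a2 b = dB (RA a1 a2 b)"
        by (simp_all add: prod_eq_iff)
    next
      fix b1 b2 a assume "b1 \<in> SB" "b2 \<in> SB" "a \<in> SA"
      from *[of "(0, b1)" "(0, b2)" "(a, 0)"] jac_defect_pure(4)[OF this(3,3,1,2)] this
      show "dB (RB b1 b2 a) = - AB a (brB b1 b2) + brB (AB a b1) b2 + brB b1 (AB a b2)
          + AB (BA b2 a) b1 - AB (BA b1 a) b2" "curvature brB BA b1 b2 a = dA (RB b1 b2 a)"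
        by (simp_all add: prod_eq_iff)
    next
      fix a1 a2 a3 assume "a1 \<in> SA" "a2 \<in> SA" "a3 \<in> SA"
      then show "Jac brA a1 a2 a3 = 0"
        using *[of "(a1, 0)" "(a2, 0)" "(a3, 0)"] jac_defect_pure(1)[of a1 a2 0 0 a3] by (simp add: prod_eq_iff)
    next
      fix b1 b2 b3 assume "b1 \<in> SB" "b2 \<in> SB" "b3 \<in> SB"
      then show "Jac brB b1 b2 b3 = 0"
        using *[of "(0, b1)" "(0, b2)" "(0, b3)"] jac_defect_pure(2)[of 0 0 b1 b2 b3] by (simp add: prod_eq_iff)
    qed
  next
    assume R: ?R
    show ?L unfolding L
    proof (intro ballI)
      fix q1 q2 q3 assume q: "q1 \<in> SA \<times> SB" "q2 \<in> SA \<times> SB" "q3 \<in> SA \<times> SB"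
      show "Q.jac_defect q1 q2 q3 = 0"
      proof (rule alternating3_eq_0I[where F = Q.jac_defect, OF SA SB Q.jac_defect_add Q.jac_defect_skew12 Q.jac_defect_skew23])
        fix a1 a2 a3 assume "a1 \<in> SA" "a2 \<in> SA" "a3 \<in> SA"
        then show "Q.jac_defect (a1, 0) (a2, 0) (a3, 0) = 0"
          using R jac_defect_pure(1)[of a1 a2 0 0 a3] by (simp add: prod_eq_iff)
      next
        fix b1 b2 b3 assume "b1 \<in> SB" "b2 \<in> SB" "b3 \<in> SB"
        then show "Q.jac_defect (0, b1) (0, b2) (0, b3) = 0"
          using R jac_defect_pure(2)[of 0 0 b1 b2 b3] by (simp add: prod_eq_iff)
      next
        fix a1 a2 b assume *: "a1 \<in> SA" "a2 \<in> SA" "b \<in> SB"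
        show "Q.jac_defect (a1, 0) (a2, 0) (0, b) = 0"
          unfolding jac_defect_pure(3)[OF * *(3)] using R * by (simp add: prod_eq_iff)
      next
        fix b1 b2 a assume *: "b1 \<in> SB" "b2 \<in> SB" "a \<in> SA"
        show "Q.jac_defect (0, b1) (0, b2) (a, 0) = 0"
          unfolding jac_defect_pure(4)[OF *(3,3,1,2)] using R * by (simp add: prod_eq_iff)
      qed (assumption | fact q)+
    qed
  qed
qed

lemma curv_defect_pure:
  assumes "a1 \<in> SA" "a2 \<in> SA" "b1 \<in> SB" "b2 \<in> SB" "c \<in> SC"
  shows "Q.curv_defect (a1, 0) (a2, 0) c = curvature brA AC a1 a2 c - RA a1 a2 (dB c)"
    and "Q.curv_defect (0, b1) (0, b2) c = curvature brB BC b1 b2 c - RB b1 b2 (dA c)"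
    and "Q.curv_defect (a1, 0) (0, b1) c = RB b1 (dB c) a1 - RA a1 (dA c) b1
      - (BC b1 (AC a1 c) - AC a1 (BC b1 c) - AC (BA b1 a1) c + BC (AB a1 b1) c)"
  using assms RA_skew[of "dA c" a1 b1]
  by (simp_all add: Q.curv_defect_def br_def nab_def l_def om_def curvature_def algebra_simps)

text \<open>The pure types give the curvature identities on C of the two 2-representations, the
  mixed type gives (M4).\<close>

lemma curvature_nab_iff:
  "(\<forall>q1\<in>SA \<times> SB. \<forall>q2\<in>SA \<times> SB. \<forall>c\<in>SC. curvature br nab q1 q2 c = - om q1 q2 (l c)) \<longleftrightarrow>
   (\<forall>a1\<in>SA. \<forall>a2\<in>SA. \<forall>c\<in>SC. curvature brA AC a1 a2 c = RA a1 a2 (dB c)) \<and>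
   (\<forall>b1\<in>SB. \<forall>b2\<in>SB. \<forall>c\<in>SC. curvature brB BC b1 b2 c = RB b1 b2 (dA c)) \<and>
   (\<forall>a\<in>SA. \<forall>b\<in>SB. \<forall>c\<in>SC. BC b (AC a c) - AC a (BC b c) - AC (BA b a) c + BC (AB a b) c
      = RB b (dB c) a - RA a (dA c) b)"
  (is "?L \<longleftrightarrow> ?R")
proof -
  have L: "?L \<longleftrightarrow> (\<forall>q1\<in>SA \<times> SB. \<forall>q2\<in>SA \<times> SB. \<forall>c\<in>SC. Q.curv_defect q1 q2 c = 0)"
    unfolding Q.curv_defect_def eq_neg_iff_add_eq_0 ..
  show ?thesis
  proof
    assume ?L
    then have *: "Q.curv_defect q1 q2 c = 0" if "q1 \<in> SA \<times> SB" "q2 \<in> SA \<times> SB" "c \<in> SC" for q1 q2 c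
      using that unfolding L by blast
    show ?R
    proof (intro conjI ballI)
      fix a1 a2 c assume "a1 \<in> SA" "a2 \<in> SA" "c \<in> SC"
      then show "curvature brA AC a1 a2 c = RA a1 a2 (dB c)"
        using *[of "(a1, 0)" "(a2, 0)" c] curv_defect_pure(1)[of a1 a2 0 0 c] by simp
    next
      fix b1 b2 c assume "b1 \<in> SB" "b2 \<in> SB" "c \<in> SC"
      then show "curvature brB BC b1 b2 c = RB b1 b2 (dA c)"
        using *[of "(0, b1)" "(0, b2)" c] curv_defect_pure(2)[of 0 0 b1 b2 c] by simp
    next
      fix a b c assume "a \<in> SA" "b \<in> SB" "c \<in> SC"
      then show "BC b (AC a c) - AC a (BC b c) - AC (BA b a) c + BC (AB a b) c = RB b (dB c) a - RA a (dA c) b"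
        using *[of "(a, 0)" "(0, b)" c] curv_defect_pure(3)[of a 0 b 0 c] by simp
    qed
  next
    assume R: ?R
    have aa: "Q.curv_defect (a1, 0) (a2, 0) c = 0" if "a1 \<in> SA" "a2 \<in> SA" "c \<in> SC" for a1 a2 c
      using R that curv_defect_pure(1)[of a1 a2 0 0 c] by simp
    have bb: "Q.curv_defect (0, b1) (0, b2) c = 0" if "b1 \<in> SB" "b2 \<in> SB" "c \<in> SC" for b1 b2 c
      using R that curv_defect_pure(2)[of 0 0 b1 b2 c] by simp
    have ab: "Q.curv_defect (a, 0) (0, b) c = 0" if "a \<in> SA" "b \<in> SB" "c \<in> SC" for a b c
      using R that curv_defect_pure(3)[of a 0 b 0 c] by simp
    have ba: "Q.curv_defect (0, b) (a, 0) c = 0" if "a \<in> SA" "b \<in> SB" "c \<in> SC" for a b c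
      using ab[OF that] Q.curv_defect_skew[of "(0, b)" "(a, 0)" c] that by simp
    show ?L unfolding L
    proof (intro ballI)
      fix q1 q2 c assume q: "q1 \<in> SA \<times> SB" "q2 \<in> SA \<times> SB" "c \<in> SC"
      obtain a1 b1 a2 b2 where e: "q1 = (a1, b1)" "q2 = (a2, b2)" "a1 \<in> SA" "a2 \<in> SA" "b1 \<in> SB" "b2 \<in> SB"
        using q by auto
      \<comment> \<open>Additivity is available in the first argument, so \<open>q2\<close> is split
        after being exchanged with the pure argument \<open>p\<close>.\<close>
      have 1: "Q.curv_defect p q2 c = 0" if "p = (a1, 0) \<or> p = (0, b1)" for p
      proof -
        have p: "p \<in> SA \<times> SB" using that e by auto
        have "Q.curv_defect q2 p c = Q.curv_defect (a2, 0) p c + Q.curv_defect (0, b2) p c"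
          using Q.curv_defect_add[of "(a2, 0)" "(0, b2)" p c] p e q(3) by simp
        also have "\<dots> = 0" using that e q(3) by (auto simp: aa ab ba bb)
        finally show ?thesis using Q.curv_defect_skew[OF p q(2,3)] by simp
      qed
      then show "Q.curv_defect q1 q2 c = 0"
        using Q.curv_defect_add[of "(a1, 0)" "(0, b1)" q2 c] e q(2,3) by simp
    qed
  qed
qed

lemma d3_pure:
  assumes "a1 \<in> SA" "a2 \<in> SA" "b1 \<in> SB" "b2 \<in> SB"
  shows "a3 \<in> SA \<Longrightarrow> a4 \<in> SA \<Longrightarrow> d3 br nab om (a1, 0) (a2, 0) (a3, 0) (a4, 0) = 0"
    and "b3 \<in> SB \<Longrightarrow> b4 \<in> SB \<Longrightarrow> d3 br nab om (0, b1) (0, b2) (0, b3) (0, b4) = 0"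
    and "a3 \<in> SA \<Longrightarrow> d3 br nab om (a1, 0) (a2, 0) (a3, 0) (0, b1) = d2 brA (Hom_conn AB AC) RA a1 a2 a3 b1"
    and "b3 \<in> SB \<Longrightarrow> d3 br nab om (0, b1) (0, b2) (0, b3) (a1, 0) = - d2 brB (Hom_conn BA BC) RB b1 b2 b3 a1"
    and "d3 br nab om (a1, 0) (a2, 0) (0, b1) (0, b2) =
      d1 brB (wedge2_conn BA BC) (\<lambda>b a a'. RA a a' b) b1 b2 a1 a2
        - d1 brA (wedge2_conn AB AC) (\<lambda>a b b'. RB b b' a) a1 a2 b1 b2"
proof -
  note defs = d3_def br_def nab_def om_def d2_def Hom_conn_def d1_def wedge2_conn_def
  show "a3 \<in> SA \<Longrightarrow> a4 \<in> SA \<Longrightarrow> d3 br nab om (a1, 0) (a2, 0) (a3, 0) (a4, 0) = 0"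
    and "b3 \<in> SB \<Longrightarrow> b4 \<in> SB \<Longrightarrow> d3 br nab om (0, b1) (0, b2) (0, b3) (0, b4) = 0"
    using assms by (simp_all add: defs)
  show "d3 br nab om (a1, 0) (a2, 0) (a3, 0) (0, b1) = d2 brA (Hom_conn AB AC) RA a1 a2 a3 b1" if "a3 \<in> SA"
    using assms that RA_skew[of a3 a1 "AB a2 b1"] by (simp add: defs algebra_simps)
  show "d3 br nab om (0, b1) (0, b2) (0, b3) (a1, 0) = - d2 brB (Hom_conn BA BC) RB b1 b2 b3 a1" if "b3 \<in> SB"
    using assms that RB_skew[of b3 b1 "BA b2 a1"] by (simp add: defs algebra_simps)
  show "d3 br nab om (a1, 0) (a2, 0) (0, b1) (0, b2) =
      d1 brB (wedge2_conn BA BC) (\<lambda>b a a'. RA a a' b) b1 b2 a1 a2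
        - d1 brA (wedge2_conn AB AC) (\<lambda>a b b'. RB b b' a) a1 a2 b1 b2"
    \<comment> \<open>\<open>om\<close> lists the arguments of the curvatures in cyclic order, while
      \<open>wedge2_conn\<close> differentiates an argument in its place. The skew-symmetry
      instances reconcile the two orders.\<close>
    using assms RA_skew[of a2 "BA b1 a1" b2] RA_skew[of a2 "BA b2 a1" b1] RA_skew[of a1 "BA b2 a2" b1] RA_skew[of a1 "BA b1 a2" b2]
      RB_skew[of b2 "AB a1 b1" a2] RB_skew[of b2 "AB a2 b1" a1] RB_skew[of b1 "AB a2 b2" a1] RB_skew[of b1 "AB a1 b2" a2]
    by (simp add: defs algebra_simps)
qed

text \<open>The types AAAB and BBBA are the closedness conditions on the two curvatures and AABB is
  (M7). The types AAAA and BBBB hold identically, since \<open>om\<close> vanishes on pure triples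
  and pure pairs have pure brackets.\<close>

lemma d3_om_iff:
  "(\<forall>q1\<in>SA \<times> SB. \<forall>q2\<in>SA \<times> SB. \<forall>q3\<in>SA \<times> SB. \<forall>q4\<in>SA \<times> SB. d3 br nab om q1 q2 q3 q4 = 0) \<longleftrightarrow>
   (\<forall>a1\<in>SA. \<forall>a2\<in>SA. \<forall>a3\<in>SA. \<forall>b\<in>SB. d2 brA (Hom_conn AB AC) RA a1 a2 a3 b = 0) \<and>
   (\<forall>b1\<in>SB. \<forall>b2\<in>SB. \<forall>b3\<in>SB. \<forall>a\<in>SA. d2 brB (Hom_conn BA BC) RB b1 b2 b3 a = 0) \<and>
   (\<forall>a1\<in>SA. \<forall>a2\<in>SA. \<forall>b1\<in>SB. \<forall>b2\<in>SB. d1 brA (wedge2_conn AB AC) (\<lambda>a b b'. RB b b' a) a1 a2 b1 b2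
      = d1 brB (wedge2_conn BA BC) (\<lambda>b a a'. RA a a' b) b1 b2 a1 a2)"
  (is "?L \<longleftrightarrow> ?R")
proof
  assume L: ?L
  have *: "d3 br nab om q1 q2 q3 q4 = 0"
    if "q1 \<in> SA \<times> SB" "q2 \<in> SA \<times> SB" "q3 \<in> SA \<times> SB" "q4 \<in> SA \<times> SB" for q1 q2 q3 q4
    using that L by blast
  show ?R
  proof (intro conjI ballI)
    fix a1 a2 a3 b assume "a1 \<in> SA" "a2 \<in> SA" "a3 \<in> SA" "b \<in> SB"
    then show "d2 brA (Hom_conn AB AC) RA a1 a2 a3 b = 0"
      using *[of "(a1, 0)" "(a2, 0)" "(a3, 0)" "(0, b)"] d3_pure(3)[of a1 a2 b b a3] by simp
  next
    fix b1 b2 b3 a assume "b1 \<in> SB" "b2 \<in> SB" "b3 \<in> SB" "a \<in> SA"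
    then show "d2 brB (Hom_conn BA BC) RB b1 b2 b3 a = 0"
      using *[of "(0, b1)" "(0, b2)" "(0, b3)" "(a, 0)"] d3_pure(4)[of a a b1 b2 b3] by simp
  next
    fix a1 a2 b1 b2 assume "a1 \<in> SA" "a2 \<in> SA" "b1 \<in> SB" "b2 \<in> SB"
    then show "d1 brA (wedge2_conn AB AC) (\<lambda>a b b'. RB b b' a) a1 a2 b1 b2
      = d1 brB (wedge2_conn BA BC) (\<lambda>b a a'. RA a a' b) b1 b2 a1 a2"
      using *[of "(a1, 0)" "(a2, 0)" "(0, b1)" "(0, b2)"] d3_pure(5)[of a1 a2 b1 b2] by simp
  qed
next
  assume R: ?R
  show ?L
  proof (intro ballI)
    fix q1 q2 q3 q4 assume q: "q1 \<in> SA \<times> SB" "q2 \<in> SA \<times> SB" "q3 \<in> SA \<times> SB" "q4 \<in> SA \<times> SB"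
    show "d3 br nab om q1 q2 q3 q4 = 0"
    proof (rule alternating4_eq_0I[where F = "d3 br nab om", OF SA SB Q.d3_add Q.d3_skew12 Q.d3_skew23 Q.d3_skew34])
      fix a1 a2 a3 b assume "a1 \<in> SA" "a2 \<in> SA" "a3 \<in> SA" "b \<in> SB"
      then show "d3 br nab om (a1, 0) (a2, 0) (a3, 0) (0, b) = 0"
        using R d3_pure(3)[of a1 a2 b b a3] by simp
    next
      fix b1 b2 b3 a assume "b1 \<in> SB" "b2 \<in> SB" "b3 \<in> SB" "a \<in> SA"
      then show "d3 br nab om (0, b1) (0, b2) (0, b3) (a, 0) = 0"
        using R d3_pure(4)[of a a b1 b2 b3] by simp
    next
      fix a1 a2 b1 b2 assume "a1 \<in> SA" "a2 \<in> SA" "b1 \<in> SB" "b2 \<in> SB"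
      then show "d3 br nab om (a1, 0) (a2, 0) (0, b1) (0, b2) = 0"
        using R d3_pure(5)[of a1 a2 b1 b2] by simp
    next
      fix a1 a2 a3 a4 assume "a1 \<in> SA" "a2 \<in> SA" "a3 \<in> SA" "a4 \<in> SA"
      then show "d3 br nab om (a1, 0) (a2, 0) (a3, 0) (a4, 0) = 0"
        using d3_pure(1)[of a1 a2 0 0 a3 a4] by simp
    next
      fix b1 b2 b3 b4 assume "b1 \<in> SB" "b2 \<in> SB" "b3 \<in> SB" "b4 \<in> SB"
      then show "d3 br nab om (0, b1) (0, b2) (0, b3) (0, b4) = 0"
        using d3_pure(2)[of 0 0 b1 b2 b3 b4] by simp
    qed (assumption | fact q)+
  qed
qed

lemma nab_l_iff:
  "(\<forall>c1\<in>SC. \<forall>c2\<in>SC. nab (l c1) c2 + nab (l c2) c1 = 0) \<longleftrightarrow>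
   (\<forall>c1\<in>SC. \<forall>c2\<in>SC. AC (dA c1) c2 - BC (dB c2) c1 = - (AC (dA c2) c1 - BC (dB c1) c2))"
  by (intro ball_cong refl) (simp add: nab_def l_def algebra_simps eq_neg_iff_add_eq_0)

text \<open>For pure \<open>q\<close> one component is (M2) or (M3). The other says that a boundary
  map intertwines the connections, which belongs to the definition of a 2-representation.\<close>

lemma br_l_iff:
  "(\<forall>q\<in>SA \<times> SB. \<forall>c\<in>SC. br q (l c) = l (nab q c)) \<longleftrightarrow>
   (\<forall>a\<in>SA. \<forall>c\<in>SC. brA a (dA c) = dA (AC a c) - BA (dB c) a) \<and>
   (\<forall>b\<in>SB. \<forall>c\<in>SC. brB b (dB c) = dB (BC b c) - AB (dA c) b) \<and>
   (\<forall>a\<in>SA. \<forall>c\<in>SC. dB (AC a c) = AB a (dB c)) \<and>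
   (\<forall>b\<in>SB. \<forall>c\<in>SC. dA (BC b c) = BA b (dA c))"
  (is "?L \<longleftrightarrow> ?R")
proof
  assume L: ?L
  have *: "br (a, b) (l c) = l (nab (a, b) c)" if "a \<in> SA" "b \<in> SB" "c \<in> SC" for a b c
    using L that by blast
  show ?R
  proof (intro conjI ballI)
    fix a c assume "a \<in> SA" "c \<in> SC"
    then show "brA a (dA c) = dA (AC a c) - BA (dB c) a" "dB (AC a c) = AB a (dB c)"
      using *[of a 0 c] by (simp_all add: br_def l_def nab_def algebra_simps)
  next
    fix b c assume "b \<in> SB" "c \<in> SC"
    then show "brB b (dB c) = dB (BC b c) - AB (dA c) b" "dA (BC b c) = BA b (dA c)"
      using *[of 0 b c] by (simp_all add: br_def l_def nab_def algebra_simps eq_neg_iff_add_eq_0 neg_eq_iff_add_eq_0)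
  qed
next
  assume R: ?R
  show ?L using R by (auto simp: br_def l_def nab_def)
qed

end


section \<open>Brackets, connections and forms on sections\<close>

lemma fibre_linearD:
  assumes "fibre_linear S T f"
  shows "v \<in> S \<Longrightarrow> f v \<in> T" "v \<in> S \<Longrightarrow> w \<in> S \<Longrightarrow> f (v + w) = f v + f w"
    "v \<in> S \<Longrightarrow> f (k *\<^sub>R v) = k *\<^sub>R f v"
  using assms by (auto simp: fibre_linear_def)

lemma fibre_linear_zero: "fibre_linear S T f \<Longrightarrow> 0 \<in> S \<Longrightarrow> f 0 = 0"
  using fibre_linearD(3)[of S T f 0 0] by simp

lemma fibre_linear_minus: "fibre_linear S T f \<Longrightarrow> v \<in> S \<Longrightarrow> f (- v) = - f v"
  using fibre_linearD(3)[of S T f v "-1"] by simp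

lemma add_subgroup_sections: "vector_bundle M E \<Longrightarrow> add_subgroup (sections M E)"
  by (simp add: add_subgroup_def)

lemma bundle_mapD:
  assumes "bundle_map M E F \<phi>"
  shows "fibre_linear (fib E x) (fib F x) (\<phi> x)" "s \<in> sections M E \<Longrightarrow> app1 \<phi> s \<in> sections M F"
    "s \<in> sections M E \<Longrightarrow> t \<in> sections M E \<Longrightarrow> app1 \<phi> (s + t) = app1 \<phi> s + app1 \<phi> t"
    "s \<in> sections M E \<Longrightarrow> app1 \<phi> (f \<cdot> s) = f \<cdot> app1 \<phi> s"
proof -
  show lin: "fibre_linear (fib E x) (fib F x) (\<phi> x)" for x
    using assms by (simp add: bundle_map_def)
  show "s \<in> sections M E \<Longrightarrow> app1 \<phi> s \<in> sections M F"
    using assms by (simp add: bundle_map_def)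
  show "s \<in> sections M E \<Longrightarrow> t \<in> sections M E \<Longrightarrow> app1 \<phi> (s + t) = app1 \<phi> s + app1 \<phi> t"
    by (simp add: app1_def fun_eq_iff fibre_linearD(2)[OF lin] sections_fib)
  show "s \<in> sections M E \<Longrightarrow> app1 \<phi> (f \<cdot> s) = f \<cdot> app1 \<phi> s"
    by (simp add: app1_def scl_def fibre_linearD(3)[OF lin] sections_fib)
qed

lemma dual_sectionsD:
  assumes "\<gamma> \<in> dual_sections M E"
  shows "fibre_linear (fib E x) UNIV (\<gamma> x)" "s \<in> sections M E \<Longrightarrow> app1 \<gamma> s \<in> C_inf M"
    "s \<in> sections M E \<Longrightarrow> t \<in> sections M E \<Longrightarrow> app1 \<gamma> (s + t) = app1 \<gamma> s + app1 \<gamma> t"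
proof -
  show lin: "fibre_linear (fib E x) UNIV (\<gamma> x)" for x
    using assms by (simp add: dual_sections_def)
  show "s \<in> sections M E \<Longrightarrow> app1 \<gamma> s \<in> C_inf M"
    using assms by (simp add: dual_sections_def)
  show "s \<in> sections M E \<Longrightarrow> t \<in> sections M E \<Longrightarrow> app1 \<gamma> (s + t) = app1 \<gamma> s + app1 \<gamma> t"
    by (simp add: app1_def fun_eq_iff fibre_linearD(2)[OF lin] sections_fib)
qed

lemma Omega2_HomD:
  assumes "R \<in> Omega2_Hom M A E F" and "a1 \<in> fib A x" "a2 \<in> fib A x" "e \<in> fib E x"
  shows "fibre_linear (fib A x) (fib F x) (\<lambda>a. R x a a2 e)" "fibre_linear (fib A x) (fib F x) (\<lambda>a. R x a1 a e)"
    "fibre_linear (fib E x) (fib F x) (R x a1 a2)" "R x a1 a2 e = - R x a2 a1 e"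
proof -
  have "\<forall>x. \<forall>a1\<in>fib A x. \<forall>a2\<in>fib A x. \<forall>e\<in>fib E x.
        fibre_linear (fib A x) (fib F x) (\<lambda>a. R x a a2 e) \<and>
        fibre_linear (fib A x) (fib F x) (\<lambda>a. R x a1 a e) \<and>
        fibre_linear (fib E x) (fib F x) (R x a1 a2) \<and>
        R x a1 a2 e = - R x a2 a1 e"
    using assms(1) unfolding Omega2_Hom_def mem_Collect_eq by (elim conjE)
  from bspec[OF bspec[OF bspec[OF spec[OF this] assms(2)] assms(3)] assms(4)]
  show "fibre_linear (fib A x) (fib F x) (\<lambda>a. R x a a2 e)" "fibre_linear (fib A x) (fib F x) (\<lambda>a. R x a1 a e)"
    "fibre_linear (fib E x) (fib F x) (R x a1 a2)" "R x a1 a2 e = - R x a2 a1 e"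
    by blast+
qed

lemma Omega2_Hom_sections:
  assumes R: "R \<in> Omega2_Hom M A E F"
  shows "a1 \<in> sections M A \<Longrightarrow> a2 \<in> sections M A \<Longrightarrow> e \<in> sections M E \<Longrightarrow> app3 R a1 a2 e \<in> sections M F"
    "a1 \<in> sections M A \<Longrightarrow> a1' \<in> sections M A \<Longrightarrow> a2 \<in> sections M A \<Longrightarrow> e \<in> sections M E \<Longrightarrow>
      app3 R (a1 + a1') a2 e = app3 R a1 a2 e + app3 R a1' a2 e"
    "a1 \<in> sections M A \<Longrightarrow> a2 \<in> sections M A \<Longrightarrow> e \<in> sections M E \<Longrightarrow> e' \<in> sections M E \<Longrightarrow>
      app3 R a1 a2 (e + e') = app3 R a1 a2 e + app3 R a1 a2 e'"
    "a1 \<in> sections M A \<Longrightarrow> a2 \<in> sections M A \<Longrightarrow> e \<in> sections M E \<Longrightarrow> app3 R a1 a2 e = - app3 R a2 a1 e"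
    "a1 \<in> sections M A \<Longrightarrow> a2 \<in> sections M A \<Longrightarrow> e \<in> sections M E \<Longrightarrow> app3 R a1 (f \<cdot> a2) e = f \<cdot> app3 R a1 a2 e"
proof -
  assume a1: "a1 \<in> sections M A" and a2: "a2 \<in> sections M A" and e: "e \<in> sections M E"
  note fibs = sections_fib[OF a1] sections_fib[OF a2] sections_fib[OF e]
  have "\<forall>a1\<in>sections M A. \<forall>a2\<in>sections M A. \<forall>e\<in>sections M E. app3 R a1 a2 e \<in> sections M F"
    using R unfolding Omega2_Hom_def mem_Collect_eq by (elim conjE)
  then show "app3 R a1 a2 e \<in> sections M F"
    using a1 a2 e by simp
  show "app3 R (a1 + a1') a2 e = app3 R a1 a2 e + app3 R a1' a2 e" if "a1' \<in> sections M A"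
    using fibre_linearD(2)[OF Omega2_HomD(1)[OF R fibs] sections_fib[OF a1] sections_fib[OF that]]
    by (simp add: app3_def fun_eq_iff)
  show "app3 R a1 a2 (e + e') = app3 R a1 a2 e + app3 R a1 a2 e'" if "e' \<in> sections M E"
    using fibre_linearD(2)[OF Omega2_HomD(3)[OF R fibs] sections_fib[OF e] sections_fib[OF that]]
    by (simp add: app3_def fun_eq_iff)
  show "app3 R a1 a2 e = - app3 R a2 a1 e"
    by (rule ext) (simp only: app3_def fun_Compl_def Omega2_HomD(4)[OF R fibs])
  show "app3 R a1 (f \<cdot> a2) e = f \<cdot> app3 R a1 a2 e"
    using fibre_linearD(3)[OF Omega2_HomD(2)[OF R fibs] sections_fib[OF a2]]
    by (simp add: app3_def scl_def)
qed

lemma anchor_mapD: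
  assumes "anchor_map M E \<rho>"
  shows "v \<in> fib E x \<Longrightarrow> \<rho> x v \<in> tangent_space M x"
    "f \<in> C_inf M \<Longrightarrow> fibre_linear (fib E x) UNIV (\<lambda>v. \<rho> x v f)"
    "s \<in> sections M E \<Longrightarrow> f \<in> C_inf M \<Longrightarrow> (\<lambda>x. \<rho> x (s x) f) \<in> C_inf M"
  using assms by (simp_all add: anchor_map_def)

lemma tangent_spaceD:
  assumes "D \<in> tangent_space M x" "f \<in> C_inf M"
  shows "g \<in> C_inf M \<Longrightarrow> D (f + g) = D f + D g" "D (\<lambda>y. k * f y) = k * D f"
    "g \<in> C_inf M \<Longrightarrow> D (f * g) = f x * D g + g x * D f"
  using assms by (simp_all add: tangent_space_def)

section \<open>Anchors as derivations, and the laws of brackets and connections\<close>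

lemma skew_dull_anchor: "skew_dull_algebroid M Q L \<Longrightarrow> anchor_map M Q (anchor L)"
  by (simp add: skew_dull_algebroid_def)

lemma act_C_inf: "anchor_map M Q (anchor L) \<Longrightarrow> q \<in> sections M Q \<Longrightarrow> f \<in> C_inf M \<Longrightarrow> act L q f \<in> C_inf M"
  by (simp add: act_def anchor_mapD(3))

lemma act_add: "anchor_map M Q (anchor L) \<Longrightarrow> q \<in> sections M Q \<Longrightarrow> q' \<in> sections M Q \<Longrightarrow> f \<in> C_inf M \<Longrightarrow>
    act L (q + q') f = act L q f + act L q' f"
  using fibre_linearD(2)[OF anchor_mapD(2)] by (fastforce simp: act_def fun_eq_iff sections_fib)

lemma act_minus: "anchor_map M Q (anchor L) \<Longrightarrow> q \<in> sections M Q \<Longrightarrow> f \<in> C_inf M \<Longrightarrow>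
    act L (- q) f = - act L q f"
  using fibre_linear_minus[OF anchor_mapD(2)] by (fastforce simp: act_def fun_eq_iff sections_fib)

lemma act_fun_add:
  assumes "anchor_map M Q (anchor L)" "q \<in> sections M Q" "f \<in> C_inf M" "g \<in> C_inf M"
  shows "act L q (f + g) = act L q f + act L q g"
  using tangent_spaceD(1)[OF anchor_mapD(1)[OF assms(1) sections_fib[OF assms(2)]] assms(3,4)]
  by (simp add: act_def fun_eq_iff)

lemma act_fun_minus:
  assumes "anchor_map M Q (anchor L)" "q \<in> sections M Q" "f \<in> C_inf M"
  shows "act L q (- f) = - act L q f"
  using tangent_spaceD(2)[OF anchor_mapD(1)[OF assms(1) sections_fib[OF assms(2)]] assms(3), where k = "-1"]
  by (simp add: act_def fun_eq_iff fun_Compl_def)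

lemma act_fun_diff:
  assumes "anchor_map M Q (anchor L)" "q \<in> sections M Q" "f \<in> C_inf M" "g \<in> C_inf M"
  shows "act L q (f - g) = act L q f - act L q g"
  using act_fun_add[OF assms(1-3), of "- g"] act_fun_minus[OF assms(1,2,4)] assms(4) by simp

lemma skew_dullD:
  assumes L: "skew_dull_algebroid M Q L" and q: "q \<in> sections M Q" "q1 \<in> sections M Q" "q2 \<in> sections M Q"
  shows "bracket L q1 q2 \<in> sections M Q" "bracket L (q1 + q2) q = bracket L q1 q + bracket L q2 q"
    "bracket L q (q1 + q2) = bracket L q q1 + bracket L q q2"
    "bracket L ((\<lambda>_. k) \<cdot> q1) q2 = (\<lambda>_. k) \<cdot> bracket L q1 q2"
    "bracket L q1 ((\<lambda>_. k) \<cdot> q2) = (\<lambda>_. k) \<cdot> bracket L q1 q2"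
    "bracket L q1 q2 = - bracket L q2 q1"
    "f \<in> C_inf M \<Longrightarrow> act L (bracket L q1 q2) f = act L q1 (act L q2 f) - act L q2 (act L q1 f)"
    "f \<in> C_inf M \<Longrightarrow> bracket L q1 (f \<cdot> q2) = f \<cdot> bracket L q1 q2 + act L q1 f \<cdot> q2"
proof -
  have "\<forall>q\<in>sections M Q. \<forall>q1\<in>sections M Q. \<forall>q2\<in>sections M Q.
        bracket L q1 q2 \<in> sections M Q \<and>
        bracket L (q1 + q2) q = bracket L q1 q + bracket L q2 q \<and>
        bracket L q (q1 + q2) = bracket L q q1 + bracket L q q2 \<and>
        (\<forall>k. bracket L ((\<lambda>_. k) \<cdot> q1) q2 = (\<lambda>_. k) \<cdot> bracket L q1 q2) \<and>
        (\<forall>k. bracket L q1 ((\<lambda>_. k) \<cdot> q2) = (\<lambda>_. k) \<cdot> bracket L q1 q2) \<and>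
        bracket L q1 q2 = - bracket L q2 q1 \<and>
        (\<forall>f\<in>C_inf M. act L (bracket L q1 q2) f = act L q1 (act L q2 f) - act L q2 (act L q1 f)) \<and>
        (\<forall>f\<in>C_inf M. bracket L q1 (f \<cdot> q2) = f \<cdot> bracket L q1 q2 + act L q1 f \<cdot> q2)"
    using L unfolding skew_dull_algebroid_def by (elim conjE)
  note * = bspec[OF bspec[OF bspec[OF this q(1)] q(2)] q(3)]
  from * show "bracket L q1 q2 \<in> sections M Q" "bracket L (q1 + q2) q = bracket L q1 q + bracket L q2 q"
    "bracket L q (q1 + q2) = bracket L q q1 + bracket L q q2" "bracket L q1 q2 = - bracket L q2 q1"
    by blast+
  show "bracket L ((\<lambda>_. k) \<cdot> q1) q2 = (\<lambda>_. k) \<cdot> bracket L q1 q2" using * by (elim conjE allE)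
  show "bracket L q1 ((\<lambda>_. k) \<cdot> q2) = (\<lambda>_. k) \<cdot> bracket L q1 q2" using * by (elim conjE) (erule allE[of _ k], erule allE[of _ k])
  show "f \<in> C_inf M \<Longrightarrow> act L (bracket L q1 q2) f = act L q1 (act L q2 f) - act L q2 (act L q1 f)"
    "f \<in> C_inf M \<Longrightarrow> bracket L q1 (f \<cdot> q2) = f \<cdot> bracket L q1 q2 + act L q1 f \<cdot> q2"
    using * by blast+
qed

lemma connectionD:
  assumes N: "connection M A L E nab" and a: "a \<in> sections M A" and e: "e \<in> sections M E"
  shows "nab a e \<in> sections M E"
    "a' \<in> sections M A \<Longrightarrow> nab (a + a') e = nab a e + nab a' e"
    "e' \<in> sections M E \<Longrightarrow> nab a (e + e') = nab a e + nab a e'"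
    "f \<in> C_inf M \<Longrightarrow> nab (f \<cdot> a) e = f \<cdot> nab a e"
    "nab a ((\<lambda>_. k) \<cdot> e) = (\<lambda>_. k) \<cdot> nab a e"
    "f \<in> C_inf M \<Longrightarrow> nab a (f \<cdot> e) = f \<cdot> nab a e + act L a f \<cdot> e"
proof -
  have *: "nab a e \<in> sections M E \<and>
        nab (a + a') e = nab a e + nab a' e \<and>
        nab a (e + e') = nab a e + nab a e' \<and>
        (\<forall>f\<in>C_inf M. nab (f \<cdot> a) e = f \<cdot> nab a e) \<and>
        (\<forall>k. nab a ((\<lambda>_. k) \<cdot> e) = (\<lambda>_. k) \<cdot> nab a e) \<and>
        (\<forall>f\<in>C_inf M. nab a (f \<cdot> e) = f \<cdot> nab a e + act L a f \<cdot> e)"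
    if "a' \<in> sections M A" "e' \<in> sections M E" for a' e'
    using bspec[OF bspec[OF bspec[OF bspec[OF N[unfolded connection_def] a] that(1)] e] that(2)] .
  note ** = *[OF a e]
  show "a' \<in> sections M A \<Longrightarrow> nab (a + a') e = nab a e + nab a' e" using *[OF _ e] by blast
  show "e' \<in> sections M E \<Longrightarrow> nab a (e + e') = nab a e + nab a e'" using *[OF a] by blast
  show "nab a e \<in> sections M E" using ** by (elim conjE)
  show "f \<in> C_inf M \<Longrightarrow> nab (f \<cdot> a) e = f \<cdot> nab a e" using ** by blast
  show "nab a ((\<lambda>_. k) \<cdot> e) = (\<lambda>_. k) \<cdot> nab a e" using ** by (elim conjE allE)
  show "f \<in> C_inf M \<Longrightarrow> nab a (f \<cdot> e) = f \<cdot> nab a e + act L a f \<cdot> e" using ** by blast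
qed

section \<open>The axiom on the dual connection, restated on C\<close>

lemma curvature_closed:
  assumes "vector_bundle M C" "skew_dull_algebroid M Q L" "connection M Q L C nab"
    "q1 \<in> sections M Q" "q2 \<in> sections M Q" "c \<in> sections M C"
  shows "curvature (bracket L) nab q1 q2 c \<in> sections M C"
  using assms by (simp add: curvature_def connectionD(1)[OF assms(3)] skew_dullD(1)[OF assms(2)])

text \<open>Terms with one derivative of a pairing cancel in pairs. Those with two derivatives
  cancel because the anchor sends the bracket to the commutator, and only the pairing with the
  curvature on C is left.\<close>

lemma curvature_dual_conn:
  assumes L: "skew_dull_algebroid M Q L" and N: "connection M Q L C nab" and C: "vector_bundle M C"
    and q: "q1 \<in> sections M Q" "q2 \<in> sections M Q" and c: "c \<in> sections M C" and \<gamma>: "\<gamma> \<in> dual_sections M C"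
  shows "curvature (bracket L) (dual_conn L nab) q1 q2 (app1 \<gamma>) c = - app1 \<gamma> (curvature (bracket L) nab q1 q2 c)"
proof -
  note anc = skew_dull_anchor[OF L]
  have add: "additive_on (sections M C) (app1 \<gamma>)"
    by (simp add: additive_on_def dual_sectionsD(3)[OF \<gamma>])
  have br: "bracket L q1 q2 \<in> sections M Q" by (rule skew_dullD(1)[OF L q(1) q])
  have gC: "app1 \<gamma> s \<in> C_inf M" if "s \<in> sections M C" for s by (rule dual_sectionsD(2)[OF \<gamma> that])
  note nabC = connectionD(1)[OF N]
  have e1: "act L q1 (act L q2 (app1 \<gamma> c) - app1 \<gamma> (nab q2 c)) =
      act L q1 (act L q2 (app1 \<gamma> c)) - act L q1 (app1 \<gamma> (nab q2 c))"
    by (intro act_fun_diff[OF anc q(1)] act_C_inf[OF anc q(2)] gC nabC q c)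
  have e2: "act L q2 (act L q1 (app1 \<gamma> c) - app1 \<gamma> (nab q1 c)) =
      act L q2 (act L q1 (app1 \<gamma> c)) - act L q2 (app1 \<gamma> (nab q1 c))"
    by (intro act_fun_diff[OF anc q(2)] act_C_inf[OF anc q(1)] gC nabC q c)
  have e3: "act L (bracket L q1 q2) (app1 \<gamma> c) =
      act L q1 (act L q2 (app1 \<gamma> c)) - act L q2 (act L q1 (app1 \<gamma> c))"
    by (rule skew_dullD(7)[OF L q(1) q gC[OF c]])
  have e4: "app1 \<gamma> (curvature (bracket L) nab q1 q2 c) =
      app1 \<gamma> (nab q1 (nab q2 c)) - app1 \<gamma> (nab q2 (nab q1 c)) - app1 \<gamma> (nab (bracket L q1 q2) c)"
    unfolding curvature_def using q c br C by (simp add: additive_on_simps(4)[OF add_subgroup_sections[OF C] add] nabC)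
  show ?thesis
    unfolding curvature_def[of _ "dual_conn L nab"] fun_diff_def[of "_ :: _ \<Rightarrow> _ \<Rightarrow> real"] dual_conn_def
    unfolding e1 e2 e3 e4 by (simp add: algebra_simps)
qed

text \<open>Sections of the dual bundle separate points of the fibres, so equality of all pairings
  is equality of sections. The assumption on \<open>w\<close> keeps the difference a section, as the
  separating functional requires a vector of the fibre.\<close>

lemma dual_curvature_iff:
  fixes M :: "('m::{t2_space,second_countable_topology}) manifold"
  assumes M: "smooth_manifold M" and L: "skew_dull_algebroid M Q L" and N: "connection M Q L C nab"
    and C: "vector_bundle M C"
    and w: "\<And>q1 q2 c. q1 \<in> sections M Q \<Longrightarrow> q2 \<in> sections M Q \<Longrightarrow> c \<in> sections M C \<Longrightarrow> w q1 q2 c \<in> sections M C"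
  shows "(\<forall>q1\<in>sections M Q. \<forall>q2\<in>sections M Q. \<forall>\<gamma>\<in>dual_sections M C. \<forall>c\<in>sections M C.
        curvature (bracket L) (dual_conn L nab) q1 q2 (app1 \<gamma>) c = app1 \<gamma> (w q1 q2 c)) \<longleftrightarrow>
    (\<forall>q1\<in>sections M Q. \<forall>q2\<in>sections M Q. \<forall>c\<in>sections M C. curvature (bracket L) nab q1 q2 c = - w q1 q2 c)"
proof -
  have "(\<forall>\<gamma>\<in>dual_sections M C. curvature (bracket L) (dual_conn L nab) q1 q2 (app1 \<gamma>) c = app1 \<gamma> (w q1 q2 c)) \<longleftrightarrow>
      curvature (bracket L) nab q1 q2 c = - w q1 q2 c"
    if q: "q1 \<in> sections M Q" "q2 \<in> sections M Q" and c: "c \<in> sections M C" for q1 q2 c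
  proof -
    let ?R = "curvature (bracket L) nab q1 q2 c"
    have R: "?R \<in> sections M C" by (rule curvature_closed[OF C L N q c])
    note W = w[OF q c]
    have iff: "curvature (bracket L) (dual_conn L nab) q1 q2 (app1 \<gamma>) c = app1 \<gamma> (w q1 q2 c) \<longleftrightarrow>
        app1 \<gamma> (?R + w q1 q2 c) = 0" if \<gamma>: "\<gamma> \<in> dual_sections M C" for \<gamma>
      unfolding curvature_dual_conn[OF L N C q c \<gamma>] dual_sectionsD(3)[OF \<gamma> R W]
      by (simp add: neg_eq_iff_add_eq_0)
    show ?thesis
    proof
      assume eq: "?R = - w q1 q2 c"
      have "app1 \<gamma> 0 = 0" if "\<gamma> \<in> dual_sections M C" for \<gamma>
        using fibre_linear_zero[OF dual_sectionsD(1)[OF that]] vector_bundle_subspace[OF C]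
        by (simp add: app1_def fun_eq_iff subspace_0)
      then show "\<forall>\<gamma>\<in>dual_sections M C. curvature (bracket L) (dual_conn L nab) q1 q2 (app1 \<gamma>) c = app1 \<gamma> (w q1 q2 c)"
        by (simp add: iff) (simp add: eq)
    next
      assume all: "\<forall>\<gamma>\<in>dual_sections M C. curvature (bracket L) (dual_conn L nab) q1 q2 (app1 \<gamma>) c = app1 \<gamma> (w q1 q2 c)"
      have "?R + w q1 q2 c = 0"
      proof (rule ext, rule ccontr)
        fix x assume "(?R + w q1 q2 c) x \<noteq> 0 x"
        then have ne: "(?R + w q1 q2 c) x \<noteq> 0" by simp
        have "?R + w q1 q2 c \<in> sections M C" using R W C by simp
        from sections_fib[OF this]
        obtain \<gamma> where \<gamma>: "\<gamma> \<in> dual_sections M C" "\<gamma> x ((?R + w q1 q2 c) x) \<noteq> 0"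
          by (rule dual_sections_separate[OF M C _ ne])
        have "app1 \<gamma> (?R + w q1 q2 c) x = 0" using iff[OF \<gamma>(1)] all \<gamma>(1) by simp
        then show False using \<gamma>(2) by (simp add: app1_def)
      qed
      then show "?R = - w q1 q2 c" by (simp add: eq_neg_iff_add_eq_0)
    qed
  qed
  then show ?thesis by blast
qed


section \<open>From matched pairs to split Lie 2-algebroids\<close>

text \<open>
  Replacing \<open>a2\<close> by \<open>f \<cdot> a2\<close> in (M5) shows that the defect of \<open>[\<rho>\<^sub>A a, \<rho>\<^sub>B b] = \<rho>\<^sub>B(\<nabla>\<^sub>a b) - \<rho>\<^sub>A(\<nabla>\<^sub>b a)\<close>
  annihilates \<open>a2\<close>; hence it vanishes wherever the fibre of \<open>A\<close> is nonzero.
\<close>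

lemma anchor_compatible_at:
  fixes M :: "('m::{t2_space,second_countable_topology}) manifold"
  assumes M: "smooth_manifold M" and A: "vector_bundle M A"
    and LA: "skew_dull_algebroid M A LA" and LB: "skew_dull_algebroid M B LB"
    and AB: "connection M A LA B AB" and BA: "connection M B LB A BA"
    and d: "bundle_map M C A d" and R: "R \<in> Omega2_Hom M A B C"
    and M5: "\<forall>a1\<in>sections M A. \<forall>a2\<in>sections M A. \<forall>b\<in>sections M B.
      app1 d (app3 R a1 a2 b) = - BA b (bracket LA a1 a2) + bracket LA (BA b a1) a2 + bracket LA a1 (BA b a2)
        + BA (AB a2 b) a1 - BA (AB a1 b) a2"
    and a: "a \<in> sections M A" and b: "b \<in> sections M B" and f: "f \<in> C_inf M"
    and x: "fib A x \<noteq> {0}"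
  shows "act LB b (act LA a f) x - act LA a (act LB b f) x = act LA (BA b a) f x - act LB (AB a b) f x"
proof -
  have "0 \<in> fib A x" using vector_bundle_subspace[OF A] by (rule subspace_0)
  then obtain v where v: "v \<in> fib A x" "v \<noteq> 0" using x by blast
  obtain s where s: "s \<in> sections M A" "s x = v" by (rule section_through[OF M A v(1)])
  note brA = skew_dullD[OF LA a]
  note ancA = skew_dull_anchor[OF LA] and ancB = skew_dull_anchor[OF LB]
  have in_A [simp]: "bracket LA a s \<in> sections M A" "BA b a \<in> sections M A" "BA b s \<in> sections M A"
    using brA(1)[OF a s(1)] connectionD(1)[OF BA b] a s(1) by auto
  have in_B [simp]: "AB a b \<in> sections M B" "AB s b \<in> sections M B"
    using connectionD(1)[OF AB _ b] a s(1) by auto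
  have in_C [simp]: "act LA a f \<in> C_inf M" "act LB b f \<in> C_inf M"
    using act_C_inf[OF ancA a f] act_C_inf[OF ancB b f] .
  have fs: "f \<cdot> s \<in> sections M A" using A f s(1) by simp
  have 1: "bracket LA a (f \<cdot> s) = f \<cdot> bracket LA a s + act LA a f \<cdot> s"
    by (rule brA(8)[OF a s(1) f])
  have 2: "BA b (bracket LA a (f \<cdot> s)) = f \<cdot> BA b (bracket LA a s) + act LB b f \<cdot> bracket LA a s
      + (act LA a f \<cdot> BA b s + act LB b (act LA a f) \<cdot> s)"
    unfolding 1 using A f s(1)
    by (simp add: connectionD(3)[OF BA b] connectionD(6)[OF BA b])
  have 3: "bracket LA (BA b a) (f \<cdot> s) = f \<cdot> bracket LA (BA b a) s + act LA (BA b a) f \<cdot> s"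
    by (rule skew_dullD(8)[OF LA a in_A(2) s(1) f])
  have 4: "bracket LA a (BA b (f \<cdot> s)) = f \<cdot> bracket LA a (BA b s) + act LA a f \<cdot> BA b s
      + (act LB b f \<cdot> bracket LA a s + act LA a (act LB b f) \<cdot> s)"
    unfolding connectionD(6)[OF BA b s(1) f] using A f s(1) a
    by (simp add: skew_dullD(3)[OF LA a] skew_dullD(8)[OF LA a a])
  have 5: "BA (AB (f \<cdot> s) b) a = f \<cdot> BA (AB s b) a"
    using f by (simp add: connectionD(4)[OF AB s(1) b] connectionD(4)[OF BA in_B(2) a])
  have 6: "BA (AB a b) (f \<cdot> s) = f \<cdot> BA (AB a b) s + act LB (AB a b) f \<cdot> s"
    by (rule connectionD(6)[OF BA in_B(1) s(1) f])
  \<comment> \<open>The curvature side is a fibrewise multilinear expression, so it contributes no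
    derivative of \<open>f\<close>.\<close>
  have 7: "app1 d (app3 R a (f \<cdot> s) b) = f \<cdot> app1 d (app3 R a s b)"
    using Omega2_Hom_sections(1,5)[OF R a s(1) b] bundle_mapD(4)[OF d] by simp
  have "f \<cdot> (- BA b (bracket LA a s) + bracket LA (BA b a) s + bracket LA a (BA b s)
        + BA (AB s b) a - BA (AB a b) s) =
      - BA b (bracket LA a (f \<cdot> s)) + bracket LA (BA b a) (f \<cdot> s) + bracket LA a (BA b (f \<cdot> s))
        + BA (AB (f \<cdot> s) b) a - BA (AB a b) (f \<cdot> s)"
    using M5[rule_format, OF a fs b] M5[rule_format, OF a s(1) b] 7 by simp
  \<comment> \<open>The terms in \<open>BA b s\<close> and in the bracket of \<open>a\<close> with
    \<open>s\<close> that carry a derivative of \<open>f\<close> occur twice with opposite signs.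
    What survives is a function times \<open>s\<close>, and \<open>s\<close> does not vanish at
    \<open>x\<close>.\<close>
  then have "(act LB b (act LA a f) x - act LA a (act LB b f) x
      - (act LA (BA b a) f x - act LB (AB a b) f x)) *\<^sub>R s x = 0"
    unfolding 2 3 4 5 6 by (drule_tac fun_cong[where x = x]) (simp add: scl_def algebra_simps)
  then show ?thesis using s(2) v(2) by simp
qed

lemma tangent_space_add:
  assumes "D \<in> tangent_space M x" "E \<in> tangent_space M x"
  shows "(\<lambda>f. D f + E f) \<in> tangent_space M x"
  unfolding tangent_space_def
  by (simp add: tangent_spaceD[OF assms(1)] tangent_spaceD[OF assms(2)] algebra_simps)

text \<open>Everything in a matched pair except the identities. The algebroids are only dull here:
  their Jacobi identities belong to what the equivalence with the split structure has to
  deliver.\<close>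

locale bicross_data =
  fixes M :: "('m::{t2_space,second_countable_topology}) manifold"
    and A :: "('m, 'a::real_vector) vbundle" and B :: "('m, 'b::real_vector) vbundle"
    and C :: "('m, 'c::real_vector) vbundle"
    and LA :: "('m, 'a) algebroid" and LB :: "('m, 'b) algebroid"
    and rA :: "('m, 'a, 'c, 'b) rep2" and rB :: "('m, 'b, 'c, 'a) rep2"
  assumes M: "smooth_manifold M"
    and A: "vector_bundle M A" and B: "vector_bundle M B" and C: "vector_bundle M C"
    and LA: "skew_dull_algebroid M A LA" and LB: "skew_dull_algebroid M B LB"
    and bdryA: "bundle_map M C B (bdry rA)" and bdryB: "bundle_map M C A (bdry rB)"
    and AC: "connection M A LA C (conn0 rA)" and AB: "connection M A LA B (conn1 rA)"
    and BC: "connection M B LB C (conn0 rB)" and BA: "connection M B LB A (conn1 rB)"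
    and RA: "curv rA \<in> Omega2_Hom M A B C" and RB: "curv rB \<in> Omega2_Hom M B A C"
begin

lemmas subgroups = add_subgroup_sections[OF A] add_subgroup_sections[OF B] add_subgroup_sections[OF C]

lemmas closures [simp] =
  skew_dullD(1)[OF LA sections_zero[OF A]] skew_dullD(1)[OF LB sections_zero[OF B]]
  connectionD(1)[OF AB] connectionD(1)[OF BA] connectionD(1)[OF AC] connectionD(1)[OF BC]
  bundle_mapD(2)[OF bdryA] bundle_mapD(2)[OF bdryB] Omega2_Hom_sections(1)[OF RA] Omega2_Hom_sections(1)[OF RB]

sublocale alg: bicrossed "sections M A" "sections M B" "sections M C" "bracket LA" "bracket LB"
  "conn1 rA" "conn1 rB" "conn0 rA" "conn0 rB" "app1 (bdry rB)" "app1 (bdry rA)" "app3 (curv rA)" "app3 (curv rB)"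
proof
  show "bracket LA a a' = - bracket LA a' a" if "a \<in> sections M A" "a' \<in> sections M A" for a a'
    by (rule skew_dullD(6)[OF LA that(1) that])
  show "bracket LB b b' = - bracket LB b' b" if "b \<in> sections M B" "b' \<in> sections M B" for b b'
    by (rule skew_dullD(6)[OF LB that(1) that])
  show "app3 (curv rA) a a' b = - app3 (curv rA) a' a b"
    if "a \<in> sections M A" "a' \<in> sections M A" "b \<in> sections M B" for a a' b
    by (rule Omega2_Hom_sections(4)[OF RA that])
  show "app3 (curv rB) b b' a = - app3 (curv rB) b' b a"
    if "b \<in> sections M B" "b' \<in> sections M B" "a \<in> sections M A" for b b' a
    by (rule Omega2_Hom_sections(4)[OF RB that])
qed (simp_all add: subgroups additive_on_def skew_dullD(2)[OF LA] skew_dullD(2)[OF LB]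
    connectionD(2,3)[OF AB] connectionD(2,3)[OF BA] connectionD(2,3)[OF AC] connectionD(2,3)[OF BC]
    bundle_mapD(3)[OF bdryA] bundle_mapD(3)[OF bdryB]
    Omega2_Hom_sections(2,3)[OF RA] Omega2_Hom_sections(2,3)[OF RB])

abbreviation T :: "('m, 'a \<times> 'b, 'c) split2" where
  "T \<equiv> bicrossproduct LA LB rA rB"

abbreviation ps :: "('m \<Rightarrow> 'a) \<times> ('m \<Rightarrow> 'b) \<Rightarrow> 'm \<Rightarrow> 'a \<times> 'b" where
  "ps p \<equiv> pair_sec (fst p) (snd p)"

abbreviation SQ :: "(('m \<Rightarrow> 'a) \<times> ('m \<Rightarrow> 'b)) set" where
  "SQ \<equiv> sections M A \<times> sections M B"

text \<open>Turns quantifiers over sections of the sum into quantifiers over pairs of sections, so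
  that the algebraic equivalences apply as rewrite rules.\<close>

lemma sections_sum_eq: "sections M (A \<oplus>\<^sub>V B) = ps ` SQ"
proof
  show "sections M (A \<oplus>\<^sub>V B) \<subseteq> ps ` SQ"
  proof
    fix q assume "q \<in> sections M (A \<oplus>\<^sub>V B)"
    then have "(fst \<circ> q, snd \<circ> q) \<in> SQ" by (simp add: sections_components_smooth[OF M A B])
    moreover have "q = ps (fst \<circ> q, snd \<circ> q)" by (simp add: pair_sec_collapse)
    ultimately show "q \<in> ps ` SQ" by (rule rev_image_eqI)
  qed
  show "ps ` SQ \<subseteq> sections M (A \<oplus>\<^sub>V B)" by (auto intro: pair_sec_in_sections)
qed

lemma ps_eq_iff: "ps p = ps q \<longleftrightarrow> p = q"
  by (simp add: prod_eq_iff)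

lemma bracket_T: "bracket T (ps p) (ps q) = ps (alg.br p q)"
  by (simp add: bicrossproduct_def alg.br_def Let_def)

lemma conn_T: "conn T (ps p) c = alg.nab p c"
  by (simp add: bicrossproduct_def alg.nab_def)

lemma lmap_T: "app1 (lmap T) c = ps (alg.l c)"
  by (simp add: bicrossproduct_def alg.l_def app1_def pair_sec_def)

lemma omega_T: "app3 (omega T) (ps p) (ps q) (ps r) = alg.om p q r"
  by (simp add: bicrossproduct_def alg.om_def app3_def pair_sec_def fun_eq_iff)

lemma act_T: "act T (pair_sec a b) f = act LA a f + act LB b f"
  by (simp add: act_def bicrossproduct_def pair_sec_def fun_eq_iff)

lemma Jac_T: "Jac (bracket T) (ps p) (ps q) (ps r) = ps (Jac alg.br p q r)"
  by (simp add: Jac_def bracket_T pair_sec_add pair_sec_diff)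

lemma curvature_T: "curvature (bracket T) (conn T) (ps p) (ps q) c = curvature alg.br alg.nab p q c"
  by (simp add: curvature_def bracket_T conn_T)

lemma d3_T: "d3 (bracket T) (conn T) (app3 (omega T)) (ps p) (ps q) (ps r) (ps s) =
    d3 alg.br alg.nab alg.om p q r s"
  by (simp add: d3_def bracket_T conn_T omega_T)

lemma bundle_map_T: "bundle_map M C (A \<oplus>\<^sub>V B) (lmap T)"
  unfolding bundle_map_def
proof (intro conjI allI ballI)
  fix x
  note lin = bundle_mapD(1)[OF bdryA, of x] bundle_mapD(1)[OF bdryB, of x]
  have "- w \<in> fib B x" if "w \<in> fib B x" for w
    using vector_bundle_subspace[OF B, of x] that by (rule subspace_neg)
  then show "fibre_linear (fib C x) (fib (A \<oplus>\<^sub>V B) x) (lmap T x)"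
    unfolding fibre_linear_def bicrossproduct_def
    by (simp add: fibre_linearD[OF lin(1)] fibre_linearD[OF lin(2)])
next
  fix c assume "c \<in> sections M C"
  then show "app1 (lmap T) c \<in> sections M (A \<oplus>\<^sub>V B)"
    unfolding lmap_T sections_sum_eq by (intro imageI alg.Q.l_in)
qed

lemma anchor_T: "anchor T x v = (\<lambda>f. anchor LA x (fst v) f + anchor LB x (snd v) f)"
  by (simp add: bicrossproduct_def case_prod_beta)

lemma anchor_map_T: "anchor_map M (A \<oplus>\<^sub>V B) (anchor T)"
  unfolding anchor_map_def
proof (intro conjI allI ballI)
  note anc = skew_dull_anchor[OF LA] skew_dull_anchor[OF LB]
  show "anchor T x v \<in> tangent_space M x" if "v \<in> fib (A \<oplus>\<^sub>V B) x" for x v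
    unfolding anchor_T using that anchor_mapD(1)[OF anc(1), of "fst v" x] anchor_mapD(1)[OF anc(2), of "snd v" x]
    by (intro tangent_space_add) auto
  show "fibre_linear (fib (A \<oplus>\<^sub>V B) x) UNIV (\<lambda>v. anchor T x v f)" if "f \<in> C_inf M" for x f
    using fibre_linearD(2,3)[OF anchor_mapD(2)[OF anc(1) that, of x]]
      fibre_linearD(2,3)[OF anchor_mapD(2)[OF anc(2) that, of x]]
    unfolding anchor_T by (auto simp: fibre_linear_def algebra_simps)
  show "(\<lambda>x. anchor T x (s x) f) \<in> C_inf M" if "s \<in> sections M (A \<oplus>\<^sub>V B)" "f \<in> C_inf M" for s f
    using that(1) act_C_inf[OF anc(1) _ that(2)] act_C_inf[OF anc(2) _ that(2)]
    unfolding sections_sum_eq act_def[symmetric] by (auto simp: act_T)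
qed

lemma connection_T: "connection M (A \<oplus>\<^sub>V B) T C (conn T)"
  unfolding connection_def sections_sum_eq ball_simps
proof (intro ballI)
  fix p p' c c' assume p: "p \<in> SQ" "p' \<in> SQ" and c: "c \<in> sections M C" "c' \<in> sections M C"
  have pc: "fst p \<in> sections M A" "snd p \<in> sections M B" using p(1) by auto
  have add: "ps p + ps p' = ps (p + p')" by (simp add: pair_sec_add)
  have "conn T (f \<cdot> ps p) c = f \<cdot> conn T (ps p) c" if "f \<in> C_inf M" for f
    using connectionD(4)[OF AC pc(1) c(1) that] connectionD(4)[OF BC pc(2) c(1) that]
    by (simp add: bicrossproduct_def pair_sec_scl) (simp add: scl_def fun_eq_iff algebra_simps)
  moreover have "conn T (ps p) (f \<cdot> c) = f \<cdot> conn T (ps p) c + act T (ps p) f \<cdot> c" if "f \<in> C_inf M" for f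
    using connectionD(6)[OF AC pc(1) c(1) that] connectionD(6)[OF BC pc(2) c(1) that]
    by (simp add: conn_T alg.nab_def act_T) (simp add: scl_def fun_eq_iff algebra_simps)
  moreover have "conn T (ps p) ((\<lambda>_. k) \<cdot> c) = (\<lambda>_. k) \<cdot> conn T (ps p) c" for k
    using connectionD(5)[OF AC pc(1) c(1)] connectionD(5)[OF BC pc(2) c(1)]
    by (simp add: conn_T alg.nab_def) (simp add: scl_def fun_eq_iff algebra_simps)
  ultimately show "conn T (ps p) c \<in> sections M C \<and>
        conn T (ps p + ps p') c = conn T (ps p) c + conn T (ps p') c \<and>
        conn T (ps p) (c + c') = conn T (ps p) c + conn T (ps p) c' \<and>
        (\<forall>f\<in>C_inf M. conn T (f \<cdot> ps p) c = f \<cdot> conn T (ps p) c) \<and>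
        (\<forall>k. conn T (ps p) ((\<lambda>_. k) \<cdot> c) = (\<lambda>_. k) \<cdot> conn T (ps p) c) \<and>
        (\<forall>f\<in>C_inf M. conn T (ps p) (f \<cdot> c) = f \<cdot> conn T (ps p) c + act T (ps p) f \<cdot> c)"
    unfolding add using p c alg.Q.nab_in alg.Q.nab_add1 alg.Q.nab_add2 by (simp only: conn_T) blast
qed

text \<open>The alternating form known so far acts on sections. Membership in \<open>Omega3\<close>
  also demands multilinearity in every fibre, scalars included, and this is derived from the
  fibrewise properties of the two curvatures.\<close>

lemma Omega3_T: "omega T \<in> Omega3 M (A \<oplus>\<^sub>V B) C"
  unfolding Omega3_def mem_Collect_eq
proof (rule conjI)
  show "\<forall>q1\<in>sections M (A \<oplus>\<^sub>V B). \<forall>q2\<in>sections M (A \<oplus>\<^sub>V B). \<forall>q3\<in>sections M (A \<oplus>\<^sub>V B).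
      app3 (omega T) q1 q2 q3 \<in> sections M C"
    unfolding sections_sum_eq ball_simps omega_T using alg.Q.om_in by blast
next
  show "\<forall>x. \<forall>q1\<in>fib (A \<oplus>\<^sub>V B) x. \<forall>q2\<in>fib (A \<oplus>\<^sub>V B) x. \<forall>q3\<in>fib (A \<oplus>\<^sub>V B) x.
        fibre_linear (fib (A \<oplus>\<^sub>V B) x) (fib C x) (\<lambda>q. omega T x q q2 q3) \<and>
        fibre_linear (fib (A \<oplus>\<^sub>V B) x) (fib C x) (\<lambda>q. omega T x q1 q q3) \<and>
        fibre_linear (fib (A \<oplus>\<^sub>V B) x) (fib C x) (omega T x q1 q2) \<and>
        omega T x q1 q2 q3 = - omega T x q2 q1 q3 \<and> omega T x q1 q2 q3 = - omega T x q1 q3 q2"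
  proof (intro allI ballI)
    fix x q1 q2 q3
    assume q: "q1 \<in> fib (A \<oplus>\<^sub>V B) x" "q2 \<in> fib (A \<oplus>\<^sub>V B) x" "q3 \<in> fib (A \<oplus>\<^sub>V B) x"
    obtain a1 b1 a2 b2 a3 b3 where e: "q1 = (a1, b1)" "q2 = (a2, b2)" "q3 = (a3, b3)"
      "a1 \<in> fib A x" "a2 \<in> fib A x" "a3 \<in> fib A x" "b1 \<in> fib B x" "b2 \<in> fib B x" "b3 \<in> fib B x"
      using q by auto
    let ?RA = "curv rA x" and ?RB = "curv rB x"
    note RA' = Omega2_HomD[OF RA, of _ x] and RB' = Omega2_HomD[OF RB, of _ x]
    have RA_in: "?RA a a' b \<in> fib C x" if "a \<in> fib A x" "a' \<in> fib A x" "b \<in> fib B x" for a a' b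
      using fibre_linearD(1)[OF RA'(3)[OF that] that(3)] .
    have RB_in: "?RB b b' a \<in> fib C x" if "b \<in> fib B x" "b' \<in> fib B x" "a \<in> fib A x" for b b' a
      using fibre_linearD(1)[OF RB'(3)[OF that] that(3)] .
    have RA_lin: "?RA (a + k *\<^sub>R a'') a' b = ?RA a a' b + k *\<^sub>R ?RA a'' a' b"
      "?RA a' (a + k *\<^sub>R a'') b = ?RA a' a b + k *\<^sub>R ?RA a' a'' b"
      "?RA a a' (b + k *\<^sub>R b') = ?RA a a' b + k *\<^sub>R ?RA a a' b'"
      if "a \<in> fib A x" "a' \<in> fib A x" "a'' \<in> fib A x" "b \<in> fib B x" "b' \<in> fib B x" for a a' a'' b b' k
      using that fibre_linearD(2,3)[OF RA'(1)[OF that(1,2,4)]] fibre_linearD(2,3)[OF RA'(2)[OF that(2,1,4)]]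
        fibre_linearD(2,3)[OF RA'(3)[OF that(1,2,4)]] subspace_scale[OF vector_bundle_subspace[OF A]]
        subspace_scale[OF vector_bundle_subspace[OF B]] by simp_all
    have RB_lin: "?RB (b + k *\<^sub>R b'') b' a = ?RB b b' a + k *\<^sub>R ?RB b'' b' a"
      "?RB b' (b + k *\<^sub>R b'') a = ?RB b' b a + k *\<^sub>R ?RB b' b'' a"
      "?RB b b' (a + k *\<^sub>R a') = ?RB b b' a + k *\<^sub>R ?RB b b' a'"
      if "b \<in> fib B x" "b' \<in> fib B x" "b'' \<in> fib B x" "a \<in> fib A x" "a' \<in> fib A x" for a a' b b' b'' k
      using that fibre_linearD(2,3)[OF RB'(1)[OF that(1,2,4)]] fibre_linearD(2,3)[OF RB'(2)[OF that(2,1,4)]]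
        fibre_linearD(2,3)[OF RB'(3)[OF that(1,2,4)]] subspace_scale[OF vector_bundle_subspace[OF A]]
        subspace_scale[OF vector_bundle_subspace[OF B]] by simp_all
    have om: "omega T x (a, b) (a', b') (a'', b'') = ?RA a a' b'' + ?RA a' a'' b + ?RA a'' a b'
        - ?RB b b' a'' - ?RB b' b'' a - ?RB b'' b a'" for a b a' b' a'' b''
      by (simp add: bicrossproduct_def)
    note subC = vector_bundle_subspace[OF C, of x]
    have om_in: "omega T x (a, b) (a', b') (a'', b'') \<in> fib C x"
      if "a \<in> fib A x" "a' \<in> fib A x" "a'' \<in> fib A x" "b \<in> fib B x" "b' \<in> fib B x" "b'' \<in> fib B x"
      for a b a' b' a'' b''
      unfolding om by (intro subspace_diff[OF subC] subspace_add[OF subC] RA_in RB_in that)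
    have skew12: "omega T x (a, b) (a', b') (a'', b'') = - omega T x (a', b') (a, b) (a'', b'')"
      and skew23: "omega T x (a, b) (a', b') (a'', b'') = - omega T x (a, b) (a'', b'') (a', b')"
      if "a \<in> fib A x" "a' \<in> fib A x" "a'' \<in> fib A x" "b \<in> fib B x" "b' \<in> fib B x" "b'' \<in> fib B x"
      for a b a' b' a'' b''
      unfolding om
      using RA'(4)[OF that(1,2,6)] RA'(4)[OF that(2,3,4)] RA'(4)[OF that(3,1,5)]
        RB'(4)[OF that(4,5,3)] RB'(4)[OF that(5,6,1)] RB'(4)[OF that(6,4,2)] by (simp_all add: algebra_simps)
    \<comment> \<open>A single law covers additivity and homogeneity: k = 1 gives the former, q = 0
      the latter, and k = -1 with both vectors 0 gives F 0 = 0.\<close>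
    have linI: "fibre_linear (fib A x \<times> fib B x) (fib C x) F"
      if F: "\<And>q. q \<in> fib A x \<times> fib B x \<Longrightarrow> F q \<in> fib C x"
        "\<And>q q' k. q \<in> fib A x \<times> fib B x \<Longrightarrow> q' \<in> fib A x \<times> fib B x \<Longrightarrow> F (q + k *\<^sub>R q') = F q + k *\<^sub>R F q'"
      for F
    proof -
      have 0: "0 \<in> fib A x \<times> fib B x"
        using subspace_0[OF vector_bundle_subspace[OF A]] subspace_0[OF vector_bundle_subspace[OF B]]
        by (simp add: zero_prod_def)
      have "F 0 = 0" using F(2)[OF 0 0, of "-1"] by simp
      then show ?thesis
        unfolding fibre_linear_def using F(1) F(2)[of _ _ 1] F(2)[OF 0] by simp
    qed
    have lin1: "fibre_linear (fib A x \<times> fib B x) (fib C x) (\<lambda>q. omega T x q (a', b') (a'', b''))"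
      if "a' \<in> fib A x" "a'' \<in> fib A x" "b' \<in> fib B x" "b'' \<in> fib B x" for a' a'' b' b''
      by (rule linI) (use that in \<open>auto intro!: om_in simp: om RA_lin RB_lin algebra_simps\<close>)
    have lin2: "fibre_linear (fib A x \<times> fib B x) (fib C x) (\<lambda>q. omega T x (a', b') q (a'', b''))"
      if "a' \<in> fib A x" "a'' \<in> fib A x" "b' \<in> fib B x" "b'' \<in> fib B x" for a' a'' b' b''
      by (rule linI) (use that in \<open>auto intro!: om_in simp: om RA_lin RB_lin algebra_simps\<close>)
    have lin3: "fibre_linear (fib A x \<times> fib B x) (fib C x) (omega T x (a', b') (a'', b''))"
      if "a' \<in> fib A x" "a'' \<in> fib A x" "b' \<in> fib B x" "b'' \<in> fib B x" for a' a'' b' b''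
      by (rule linI) (use that in \<open>auto intro!: om_in simp: om RA_lin RB_lin algebra_simps\<close>)
    show "fibre_linear (fib (A \<oplus>\<^sub>V B) x) (fib C x) (\<lambda>q. omega T x q q2 q3) \<and>
        fibre_linear (fib (A \<oplus>\<^sub>V B) x) (fib C x) (\<lambda>q. omega T x q1 q q3) \<and>
        fibre_linear (fib (A \<oplus>\<^sub>V B) x) (fib C x) (omega T x q1 q2) \<and>
        omega T x q1 q2 q3 = - omega T x q2 q1 q3 \<and> omega T x q1 q2 q3 = - omega T x q1 q3 q2"
      unfolding e(1-3) fib_whitney_sum using e(4-9)
      by (intro conjI lin1 lin2 lin3 skew12 skew23)
  qed
qed

end


text \<open>The axioms proper of a split Lie 2-algebroid, with the curvature axiom read on C instead
  of its dual. Separating them from the typing conditions lets them be matched with the identities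
  of a matched pair.\<close>

definition split2_identities :: "'m manifold \<Rightarrow> ('m, 'q::real_vector) vbundle \<Rightarrow> ('m, 'c::real_vector) vbundle \<Rightarrow>
    ('m, 'q, 'c) split2 \<Rightarrow> bool" where
  "split2_identities M Q C S \<longleftrightarrow>
     (\<forall>c1\<in>sections M C. \<forall>c2\<in>sections M C.
        conn S (app1 (lmap S) c1) c2 + conn S (app1 (lmap S) c2) c1 = 0) \<and>
     (\<forall>q\<in>sections M Q. \<forall>c\<in>sections M C.
        bracket S q (app1 (lmap S) c) = app1 (lmap S) (conn S q c)) \<and>
     (\<forall>q1\<in>sections M Q. \<forall>q2\<in>sections M Q. \<forall>q3\<in>sections M Q.
        Jac (bracket S) q1 q2 q3 = app1 (lmap S) (app3 (omega S) q1 q2 q3)) \<and>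
     (\<forall>q1\<in>sections M Q. \<forall>q2\<in>sections M Q. \<forall>c\<in>sections M C.
        curvature (bracket S) (conn S) q1 q2 c = - app3 (omega S) q1 q2 (app1 (lmap S) c)) \<and>
     (\<forall>q1\<in>sections M Q. \<forall>q2\<in>sections M Q. \<forall>q3\<in>sections M Q. \<forall>q4\<in>sections M Q.
        d3 (bracket S) (conn S) (app3 (omega S)) q1 q2 q3 q4 = 0)"

lemma Omega3_sections:
  "w \<in> Omega3 M Q C \<Longrightarrow> q1 \<in> sections M Q \<Longrightarrow> q2 \<in> sections M Q \<Longrightarrow> q3 \<in> sections M Q \<Longrightarrow>
    app3 w q1 q2 q3 \<in> sections M C"
  unfolding Omega3_def mem_Collect_eq by blast

lemma Omega3D:
  assumes "w \<in> Omega3 M Q C" and "q1 \<in> fib Q x" "q2 \<in> fib Q x" "q3 \<in> fib Q x"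
  shows "fibre_linear (fib Q x) (fib C x) (\<lambda>q. w x q q2 q3)" "fibre_linear (fib Q x) (fib C x) (\<lambda>q. w x q1 q q3)"
    "fibre_linear (fib Q x) (fib C x) (w x q1 q2)" "w x q1 q2 q3 = - w x q2 q1 q3" "w x q1 q2 q3 = - w x q1 q3 q2"
proof -
  have "\<forall>x. \<forall>q1\<in>fib Q x. \<forall>q2\<in>fib Q x. \<forall>q3\<in>fib Q x.
        fibre_linear (fib Q x) (fib C x) (\<lambda>q. w x q q2 q3) \<and>
        fibre_linear (fib Q x) (fib C x) (\<lambda>q. w x q1 q q3) \<and>
        fibre_linear (fib Q x) (fib C x) (w x q1 q2) \<and>
        w x q1 q2 q3 = - w x q2 q1 q3 \<and> w x q1 q2 q3 = - w x q1 q3 q2"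
    using assms(1) unfolding Omega3_def mem_Collect_eq by (elim conjE)
  from bspec[OF bspec[OF bspec[OF spec[OF this] assms(2)] assms(3)] assms(4)]
  show "fibre_linear (fib Q x) (fib C x) (\<lambda>q. w x q q2 q3)" "fibre_linear (fib Q x) (fib C x) (\<lambda>q. w x q1 q q3)"
    "fibre_linear (fib Q x) (fib C x) (w x q1 q2)" "w x q1 q2 q3 = - w x q2 q1 q3" "w x q1 q2 q3 = - w x q1 q3 q2"
    by blast+
qed

lemma split_Lie_2_algebroid_iff:
  fixes M :: "('m::{t2_space,second_countable_topology}) manifold"
  assumes M: "smooth_manifold M"
  shows "split_Lie_2_algebroid M Q C S \<longleftrightarrow>
    skew_dull_algebroid M Q S \<and> vector_bundle M C \<and> bundle_map M C Q (lmap S) \<and> connection M Q S C (conn S) \<and>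
    omega S \<in> Omega3 M Q C \<and> split2_identities M Q C S"
proof -
  have *: "(\<forall>q1\<in>sections M Q. \<forall>q2\<in>sections M Q. \<forall>\<gamma>\<in>dual_sections M C. \<forall>c\<in>sections M C.
        curvature (bracket S) (dual_conn S (conn S)) q1 q2 (app1 \<gamma>) c
          = app1 \<gamma> (app3 (omega S) q1 q2 (app1 (lmap S) c))) \<longleftrightarrow>
     (\<forall>q1\<in>sections M Q. \<forall>q2\<in>sections M Q. \<forall>c\<in>sections M C.
        curvature (bracket S) (conn S) q1 q2 c = - app3 (omega S) q1 q2 (app1 (lmap S) c))"
    if "skew_dull_algebroid M Q S" "vector_bundle M C" "bundle_map M C Q (lmap S)" "connection M Q S C (conn S)"
      "omega S \<in> Omega3 M Q C"
    by (rule dual_curvature_iff[OF M that(1,4,2)]) (intro Omega3_sections[OF that(5)] bundle_mapD(2)[OF that(3)])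
  show ?thesis
    unfolding split_Lie_2_algebroid_def split2_identities_def
    \<comment> \<open>The congruence rule makes the typing conjuncts available as hypotheses when
      the clause on the dual connection is replaced.\<close>
    by (intro conj_cong refl) (rule *)
qed

context bicross_data
begin

text \<open>After the passage to pairs, each axiom of the split structure decomposes by type. The
  resulting conditions are those of the two 2-representations and (M1)--(M7), so only a
  propositional regrouping remains.\<close>

lemma split2_identities_T_iff:
  "split2_identities M (A \<oplus>\<^sub>V B) C T \<longleftrightarrow> matched_pair M A B C LA LB rA rB"
proof -
  have "split2_identities M (A \<oplus>\<^sub>V B) C T \<longleftrightarrow>
     (\<forall>c1\<in>sections M C. \<forall>c2\<in>sections M C. alg.nab (alg.l c1) c2 + alg.nab (alg.l c2) c1 = 0) \<and>
     (\<forall>q\<in>SQ. \<forall>c\<in>sections M C. alg.br q (alg.l c) = alg.l (alg.nab q c)) \<and>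
     (\<forall>q1\<in>SQ. \<forall>q2\<in>SQ. \<forall>q3\<in>SQ. Jac alg.br q1 q2 q3 = alg.l (alg.om q1 q2 q3)) \<and>
     (\<forall>q1\<in>SQ. \<forall>q2\<in>SQ. \<forall>c\<in>sections M C. curvature alg.br alg.nab q1 q2 c = - alg.om q1 q2 (alg.l c)) \<and>
     (\<forall>q1\<in>SQ. \<forall>q2\<in>SQ. \<forall>q3\<in>SQ. \<forall>q4\<in>SQ. d3 alg.br alg.nab alg.om q1 q2 q3 q4 = 0)"
    unfolding split2_identities_def sections_sum_eq ball_simps lmap_T conn_T bracket_T omega_T Jac_T
      curvature_T d3_T ps_eq_iff ..
  also have "\<dots> \<longleftrightarrow> matched_pair M A B C LA LB rA rB"
    unfolding alg.nab_l_iff alg.br_l_iff alg.Jac_br_iff alg.curvature_nab_iff alg.d3_om_iff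
      matched_pair_def two_representation_def lie_algebroid_def Let_def
    using LA LB A B C bdryA bdryB AC AB BC BA RA RB by argo
  finally show ?thesis .
qed

text \<open>The condition \<open>compat\<close> is the mixed part of the statement that the anchor
  of the bicrossproduct preserves brackets. The parts with both arguments in A or both in B are
  inherited from the algebroids.\<close>

lemma skew_dull_T:
  assumes compat: "\<And>a b f. a \<in> sections M A \<Longrightarrow> b \<in> sections M B \<Longrightarrow> f \<in> C_inf M \<Longrightarrow>
    act LB b (act LA a f) - act LA a (act LB b f) = act LA (conn1 rB b a) f - act LB (conn1 rA a b) f"
  shows "skew_dull_algebroid M (A \<oplus>\<^sub>V B) T"
  unfolding skew_dull_algebroid_def sections_sum_eq ball_simps
proof (intro conjI ballI allI)
  show "vector_bundle M (A \<oplus>\<^sub>V B)" by (rule vector_bundle_whitney_sum[OF A B])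
  show "anchor_map M (A \<oplus>\<^sub>V B) (anchor T)" by (rule anchor_map_T)
  note ancA = skew_dull_anchor[OF LA] and ancB = skew_dull_anchor[OF LB]
  fix q q1 q2 assume q: "q \<in> SQ" "q1 \<in> SQ" "q2 \<in> SQ"
  have add: "ps p + ps p' = ps (p + p')" for p p' by (simp add: pair_sec_add)
  obtain a1 b1 a2 b2 where e: "q1 = (a1, b1)" "q2 = (a2, b2)"
    and s: "a1 \<in> sections M A" "b1 \<in> sections M B" "a2 \<in> sections M A" "b2 \<in> sections M B"
    using q(2,3) by auto
  show "bracket T (ps q1) (ps q2) \<in> ps ` SQ"
    unfolding bracket_T by (intro imageI alg.Q.br_in q)
  show "bracket T (ps q1 + ps q2) (ps q) = bracket T (ps q1) (ps q) + bracket T (ps q2) (ps q)"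
    unfolding add bracket_T using q by (simp only: alg.Q.br_add1)
  show "bracket T (ps q) (ps q1 + ps q2) = bracket T (ps q) (ps q1) + bracket T (ps q) (ps q2)"
    unfolding add bracket_T using q by (simp only: alg.Q.br_add2)
  show "bracket T (ps q1) (ps q2) = - bracket T (ps q2) (ps q1)"
    unfolding bracket_T pair_sec_uminus using alg.Q.br_skew[OF q(2,3)] by (simp add: prod_eq_iff)
  show "bracket T (ps q1) (f \<cdot> ps q2) = f \<cdot> bracket T (ps q1) (ps q2) + act T (ps q1) f \<cdot> ps q2"
    if f: "f \<in> C_inf M" for f
    unfolding e pair_sec_scl fst_conv snd_conv act_T
    using skew_dullD(8)[OF LA s(1,1,3) f] skew_dullD(8)[OF LB s(2,2,4) f]
      connectionD(4)[OF AB s(3,2) f] connectionD(4)[OF BA s(4,1) f]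
      connectionD(6)[OF AB s(1,4) f] connectionD(6)[OF BA s(2,3) f]
    by (simp add: bicrossproduct_def Let_def pair_sec_add pair_sec_scl)
      (simp add: scl_def fun_eq_iff algebra_simps)
  show "bracket T ((\<lambda>_. k) \<cdot> ps q1) (ps q2) = (\<lambda>_. k) \<cdot> bracket T (ps q1) (ps q2)" for k
    unfolding e pair_sec_scl fst_conv snd_conv
    using skew_dullD(4)[OF LA s(1,1,3)] skew_dullD(4)[OF LB s(2,2,4)]
      connectionD(4)[OF AB s(1,4) C_inf_const] connectionD(4)[OF BA s(2,3) C_inf_const]
      connectionD(5)[OF AB s(3,2)] connectionD(5)[OF BA s(4,1)]
    by (simp add: bicrossproduct_def Let_def pair_sec_scl) (simp add: scl_def fun_eq_iff algebra_simps)
  show "bracket T (ps q1) ((\<lambda>_. k) \<cdot> ps q2) = (\<lambda>_. k) \<cdot> bracket T (ps q1) (ps q2)" for k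
    unfolding e pair_sec_scl fst_conv snd_conv
    using skew_dullD(5)[OF LA s(1,1,3)] skew_dullD(5)[OF LB s(2,2,4)]
      connectionD(4)[OF AB s(3,2) C_inf_const] connectionD(4)[OF BA s(4,1) C_inf_const]
      connectionD(5)[OF AB s(1,4)] connectionD(5)[OF BA s(2,3)]
    by (simp add: bicrossproduct_def Let_def pair_sec_scl) (simp add: scl_def fun_eq_iff algebra_simps)
  show "act T (bracket T (ps q1) (ps q2)) f = act T (ps q1) (act T (ps q2) f) - act T (ps q2) (act T (ps q1) f)"
    if f: "f \<in> C_inf M" for f
  proof -
    have actA: "act LA (x - y) f = act LA x f - act LA y f" if "x \<in> sections M A" "y \<in> sections M A" for x y
      using act_add[OF ancA that(1) _ f, of "- y"] act_minus[OF ancA that(2) f] A that by simp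
    have actB: "act LB (x - y) f = act LB x f - act LB y f" if "x \<in> sections M B" "y \<in> sections M B" for x y
      using act_add[OF ancB that(1) _ f, of "- y"] act_minus[OF ancB that(2) f] B that by simp
    have in_C: "act LA a1 f \<in> C_inf M" "act LA a2 f \<in> C_inf M" "act LB b1 f \<in> C_inf M" "act LB b2 f \<in> C_inf M"
      using act_C_inf[OF ancA _ f] act_C_inf[OF ancB _ f] s by auto
    show ?thesis
      using s in_C f A B compat[OF s(1,4) f] compat[OF s(3,2) f]
      unfolding bracket_T unfolding e alg.br_def fst_conv snd_conv act_T
      by (simp add: actA actB act_add[OF ancA] act_add[OF ancB] act_fun_add[OF ancA] act_fun_add[OF ancB]
          skew_dullD(7)[OF LA s(1)] skew_dullD(7)[OF LB s(2)] algebra_simps)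
  qed
qed

end

lemma bicross_data_if_matched_pair:
  fixes M :: "('m::{t2_space,second_countable_topology}) manifold"
  assumes "smooth_manifold M" "vector_bundle M A" "vector_bundle M B" "vector_bundle M C"
    "matched_pair M A B C LA LB rA rB"
  shows "bicross_data M A B C LA LB rA rB"
  using assms unfolding bicross_data_def matched_pair_def two_representation_def lie_algebroid_def by blast

lemma split_Lie_2_algebroid_bicrossproduct:
  fixes M :: "('m::{t2_space,second_countable_topology}) manifold"
  assumes M: "smooth_manifold M" and A: "vector_bundle M A" and B: "vector_bundle M B" and C: "vector_bundle M C"
    and mp: "matched_pair M A B C LA LB rA rB"
  shows "split_Lie_2_algebroid M (A \<oplus>\<^sub>V B) C (bicrossproduct LA LB rA rB)"
proof -
  interpret bicross_data M A B C LA LB rA rB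
    using bicross_data_if_matched_pair[OF assms] .
  have M5: "\<forall>a1\<in>sections M A. \<forall>a2\<in>sections M A. \<forall>b\<in>sections M B.
      app1 (bdry rB) (app3 (curv rA) a1 a2 b) = - conn1 rB b (bracket LA a1 a2)
        + bracket LA (conn1 rB b a1) a2 + bracket LA a1 (conn1 rB b a2)
        + conn1 rB (conn1 rA a2 b) a1 - conn1 rB (conn1 rA a1 b) a2"
    and M6: "\<forall>b1\<in>sections M B. \<forall>b2\<in>sections M B. \<forall>a\<in>sections M A.
      app1 (bdry rA) (app3 (curv rB) b1 b2 a) = - conn1 rA a (bracket LB b1 b2)
        + bracket LB (conn1 rA a b1) b2 + bracket LB b1 (conn1 rA a b2)
        + conn1 rA (conn1 rB b2 a) b1 - conn1 rA (conn1 rB b1 a) b2"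
    using mp unfolding matched_pair_def Let_def by argo+
  have "act LB b (act LA a f) - act LA a (act LB b f) = act LA (conn1 rB b a) f - act LB (conn1 rA a b) f"
    if a: "a \<in> sections M A" and b: "b \<in> sections M B" and f: "f \<in> C_inf M" for a b f
  proof
    fix x
    note ancA = skew_dull_anchor[OF LA] and ancB = skew_dull_anchor[OF LB]
    \<comment> \<open>A nonzero vector in either fibre at \<open>x\<close> settles the point, by
      (M5) or, with the roles of A and B exchanged, by (M6). If both fibres are zero, linearity
      makes both anchors vanish there.\<close>
    consider "fib A x \<noteq> {0}" | "fib B x \<noteq> {0}" | "fib A x = {0}" "fib B x = {0}" by blast
    then show "(act LB b (act LA a f) - act LA a (act LB b f)) x
        = (act LA (conn1 rB b a) f - act LB (conn1 rA a b) f) x"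
    proof cases
      case 1
      then show ?thesis
        using anchor_compatible_at[OF M A LA LB AB BA bdryB RA M5 a b f] by simp
    next
      case 2
      then show ?thesis
        using anchor_compatible_at[OF M B LB LA BA AB bdryA RB M6 b a f] by (simp add: algebra_simps)
    next
      case 3
      have "act LA s g x = 0" if "s \<in> sections M A" "g \<in> C_inf M" for s g
        using sections_fib[OF that(1), of x] fibre_linear_zero[OF anchor_mapD(2)[OF ancA that(2), of x]] 3(1)
        by (simp add: act_def)
      moreover have "act LB s g x = 0" if "s \<in> sections M B" "g \<in> C_inf M" for s g
        using sections_fib[OF that(1), of x] fibre_linear_zero[OF anchor_mapD(2)[OF ancB that(2), of x]] 3(2)
        by (simp add: act_def)
      ultimately show ?thesis
        using a b f act_C_inf[OF ancA a f] act_C_inf[OF ancB b f] by simp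
    qed
  qed
  from skew_dull_T[OF this] show ?thesis
    unfolding split_Lie_2_algebroid_iff[OF M] split2_identities_T_iff
    using C bundle_map_T connection_T Omega3_T mp by blast
qed


section \<open>From split Lie 2-algebroids to matched pairs\<close>

lemma fst_comp_simps: "fst \<circ> (p + q) = (fst \<circ> p) + (fst \<circ> q)" "fst \<circ> (- p) = - (fst \<circ> p)"
    "fst \<circ> (f \<cdot> p) = f \<cdot> (fst \<circ> p)"
  by (simp_all add: fun_eq_iff scl_def)

lemma snd_comp_simps: "snd \<circ> (p + q) = (snd \<circ> p) + (snd \<circ> q)" "snd \<circ> (- p) = - (snd \<circ> p)"
    "snd \<circ> (f \<cdot> p) = f \<cdot> (snd \<circ> p)"
  by (simp_all add: fun_eq_iff scl_def)

lemma scl_zero_right [simp]: "f \<cdot> (0 :: 'm \<Rightarrow> 'v::real_vector) = 0"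
  by (simp add: scl_def fun_eq_iff)

locale split_on_sum =
  fixes M :: "('m::{t2_space,second_countable_topology}) manifold"
    and A :: "('m, 'a::real_vector) vbundle" and B :: "('m, 'b::real_vector) vbundle"
    and C :: "('m, 'c::real_vector) vbundle" and S :: "('m, 'a \<times> 'b, 'c) split2"
  assumes M: "smooth_manifold M"
    and A: "vector_bundle M A" and B: "vector_bundle M B" and C: "vector_bundle M C"
    and split: "split_Lie_2_algebroid M (A \<oplus>\<^sub>V B) C S"
    and bracket_A: "\<forall>a1\<in>sections M A. \<forall>a2\<in>sections M A.
      \<exists>a\<in>sections M A. bracket S (pair_sec a1 0) (pair_sec a2 0) = pair_sec a 0"
    and bracket_B: "\<forall>b1\<in>sections M B. \<forall>b2\<in>sections M B.
      \<exists>b\<in>sections M B. bracket S (pair_sec 0 b1) (pair_sec 0 b2) = pair_sec 0 b"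
    and omega_A: "\<forall>a1\<in>sections M A. \<forall>a2\<in>sections M A. \<forall>a3\<in>sections M A.
      app3 (omega S) (pair_sec a1 0) (pair_sec a2 0) (pair_sec a3 0) = 0"
    and omega_B: "\<forall>b1\<in>sections M B. \<forall>b2\<in>sections M B. \<forall>b3\<in>sections M B.
      app3 (omega S) (pair_sec 0 b1) (pair_sec 0 b2) (pair_sec 0 b3) = 0"
begin

abbreviation "Q \<equiv> A \<oplus>\<^sub>V B"
abbreviation "LA \<equiv> restrict_A S"
abbreviation "LB \<equiv> restrict_B S"
abbreviation "rA \<equiv> rep_A S"
abbreviation "rB \<equiv> rep_B S"
abbreviation (input) "inA a \<equiv> pair_sec a (0 :: 'm \<Rightarrow> 'b)"
abbreviation (input) "inB b \<equiv> pair_sec (0 :: 'm \<Rightarrow> 'a) b"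

lemma S_dull: "skew_dull_algebroid M Q S" and S_bundle_map: "bundle_map M C Q (lmap S)"
  and S_conn: "connection M Q S C (conn S)" and S_omega: "omega S \<in> Omega3 M Q C"
  and S_identities: "split2_identities M Q C S"
  using split unfolding split_Lie_2_algebroid_iff[OF M] by blast+

lemmas S_anchor = skew_dull_anchor[OF S_dull]

lemma in_Q [simp]: "a \<in> sections M A \<Longrightarrow> b \<in> sections M B \<Longrightarrow> pair_sec a b \<in> sections M Q"
  by (rule pair_sec_in_sections)

lemma zero_in [simp]: "0 \<in> sections M A" "0 \<in> sections M B" "0 \<in> sections M Q"
  using A B by (simp_all add: vector_bundle_whitney_sum)

lemma components [simp]: "q \<in> sections M Q \<Longrightarrow> fst \<circ> q \<in> sections M A" "q \<in> sections M Q \<Longrightarrow> snd \<circ> q \<in> sections M B"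
  using sections_components_smooth[OF M A B] by auto

lemma bracket_S_in [simp]: "q \<in> sections M Q \<Longrightarrow> r \<in> sections M Q \<Longrightarrow> bracket S q r \<in> sections M Q"
  by (rule skew_dullD(1)[OF S_dull zero_in(3)])

lemma inA_add: "inA (a + a') = inA a + inA a'" and inB_add: "inB (b + b') = inB b + inB b'"
  by (simp_all add: pair_sec_add)

lemma inA_scl: "inA (f \<cdot> a) = f \<cdot> inA a" and inB_scl: "inB (f \<cdot> b) = f \<cdot> inB b"
  by (simp_all add: pair_sec_scl)

lemma act_LA: "act LA a f = act S (inA a) f" and act_LB: "act LB b f = act S (inB b) f"
  by (simp_all add: act_def restrict_A_def restrict_B_def pair_sec_def)

lemma bracket_LA: "bracket LA a1 a2 = fst \<circ> bracket S (inA a1) (inA a2)"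
  and bracket_LB: "bracket LB b1 b2 = snd \<circ> bracket S (inB b1) (inB b2)"
  by (simp_all add: restrict_A_def restrict_B_def)

lemma bracket_S_pure:
  "a1 \<in> sections M A \<Longrightarrow> a2 \<in> sections M A \<Longrightarrow> bracket S (inA a1) (inA a2) = inA (bracket LA a1 a2)"
  "b1 \<in> sections M B \<Longrightarrow> b2 \<in> sections M B \<Longrightarrow> bracket S (inB b1) (inB b2) = inB (bracket LB b1 b2)"
  unfolding bracket_LA bracket_LB using bracket_A bracket_B by force+

lemma conn1_rA: "conn1 rA a b = snd \<circ> bracket S (inA a) (inB b)"
  and conn1_rB: "conn1 rB b a = fst \<circ> bracket S (inB b) (inA a)"
  and conn0_rA: "conn0 rA a c = conn S (inA a) c" and conn0_rB: "conn0 rB b c = conn S (inB b) c"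
  by (simp_all add: rep_A_def rep_B_def)

lemma bracket_S_skew: "q \<in> sections M Q \<Longrightarrow> r \<in> sections M Q \<Longrightarrow> bracket S q r = - bracket S r q"
  by (rule skew_dullD(6)[OF S_dull zero_in(3)])

text \<open>The A-component carries a minus sign because \<open>conn1 rB\<close> is read off from
  the bracket in the opposite order.\<close>

lemma bracket_S_mixed:
  assumes "a \<in> sections M A" "b \<in> sections M B"
  shows "bracket S (inA a) (inB b) = pair_sec (- conn1 rB b a) (conn1 rA a b)"
proof -
  have q: "inA a \<in> sections M Q" "inB b \<in> sections M Q" using assms by simp_all
  have "fst \<circ> bracket S (inA a) (inB b) = - conn1 rB b a"
    unfolding conn1_rB bracket_S_skew[OF q] fst_comp_simps ..
  then show ?thesis
    using pair_sec_collapse[of "bracket S (inA a) (inB b)"] by (simp add: conn1_rA)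
qed

lemma zero_in_fib: "0 \<in> fib A x" "0 \<in> fib B x"
  using subspace_0[OF vector_bundle_subspace[OF A]] subspace_0[OF vector_bundle_subspace[OF B]] by auto

lemma fibre_linear_inA: "fibre_linear (fib Q x) T f \<Longrightarrow> fibre_linear (fib A x) T (\<lambda>a. f (a, 0))"
  and fibre_linear_inB: "fibre_linear (fib Q x) T f \<Longrightarrow> fibre_linear (fib B x) T (\<lambda>b. f (0, b))"
  using zero_in_fib[of x] unfolding fibre_linear_def
  by (metis (no_types, lifting) add.right_neutral add_Pair fib_whitney_sum mem_Sigma_iff scaleR_Pair scaleR_zero_right)+

lemma anchor_maps: "anchor_map M A (anchor LA)" "anchor_map M B (anchor LB)"
proof -
  show "anchor_map M A (anchor LA)"
    unfolding anchor_map_def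
  proof (intro conjI allI ballI)
    show "anchor LA x v \<in> tangent_space M x" if "v \<in> fib A x" for x v
      using anchor_mapD(1)[OF S_anchor, of "(v, 0)" x] that zero_in_fib by (simp add: restrict_A_def)
    show "fibre_linear (fib A x) UNIV (\<lambda>v. anchor LA x v f)" if "f \<in> C_inf M" for x f
      using fibre_linear_inA[OF anchor_mapD(2)[OF S_anchor that]] by (simp add: restrict_A_def)
    show "(\<lambda>x. anchor LA x (s x) f) \<in> C_inf M" if "s \<in> sections M A" "f \<in> C_inf M" for s f
      using act_C_inf[OF S_anchor, of "inA s" f] that unfolding act_LA[symmetric] by (simp add: act_def)
  qed
  show "anchor_map M B (anchor LB)"
    unfolding anchor_map_def
  proof (intro conjI allI ballI)
    show "anchor LB x v \<in> tangent_space M x" if "v \<in> fib B x" for x v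
      using anchor_mapD(1)[OF S_anchor, of "(0, v)" x] that zero_in_fib by (simp add: restrict_B_def)
    show "fibre_linear (fib B x) UNIV (\<lambda>v. anchor LB x v f)" if "f \<in> C_inf M" for x f
      using fibre_linear_inB[OF anchor_mapD(2)[OF S_anchor that]] by (simp add: restrict_B_def)
    show "(\<lambda>x. anchor LB x (s x) f) \<in> C_inf M" if "s \<in> sections M B" "f \<in> C_inf M" for s f
      using act_C_inf[OF S_anchor, of "inB s" f] that unfolding act_LB[symmetric] by (simp add: act_def)
  qed
qed

lemma skew_dull_LA: "skew_dull_algebroid M A LA"
  unfolding skew_dull_algebroid_def
proof (intro conjI ballI allI A anchor_maps)
  fix a a1 a2 assume a: "a \<in> sections M A" "a1 \<in> sections M A" "a2 \<in> sections M A"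
  have q: "inA a \<in> sections M Q" "inA a1 \<in> sections M Q" "inA a2 \<in> sections M Q" using a by simp_all
  note S = skew_dullD[OF S_dull q]
  show "bracket LA a1 a2 \<in> sections M A"
    using q by (simp add: bracket_LA)
  show "bracket LA (a1 + a2) a = bracket LA a1 a + bracket LA a2 a"
    unfolding bracket_LA inA_add S(2) fst_comp_simps ..
  show "bracket LA a (a1 + a2) = bracket LA a a1 + bracket LA a a2"
    unfolding bracket_LA inA_add S(3) fst_comp_simps ..
  show "bracket LA ((\<lambda>_. k) \<cdot> a1) a2 = (\<lambda>_. k) \<cdot> bracket LA a1 a2" for k
    unfolding bracket_LA inA_scl S(4) fst_comp_simps ..
  show "bracket LA a1 ((\<lambda>_. k) \<cdot> a2) = (\<lambda>_. k) \<cdot> bracket LA a1 a2" for k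
    unfolding bracket_LA inA_scl S(5) fst_comp_simps ..
  show "bracket LA a1 a2 = - bracket LA a2 a1"
    unfolding bracket_LA S(6) fst_comp_simps ..
  show "act LA (bracket LA a1 a2) f = act LA a1 (act LA a2 f) - act LA a2 (act LA a1 f)"
    if f: "f \<in> C_inf M" for f
    \<comment> \<open>Here it matters that the bracket of two sections of A has no B-component: the
      anchor of its A-part is then the anchor of the whole bracket.\<close>
    unfolding act_LA bracket_S_pure(1)[OF a(2,3), symmetric] by (rule S(7)[OF f])
  show "bracket LA a1 (f \<cdot> a2) = f \<cdot> bracket LA a1 a2 + act LA a1 f \<cdot> a2" if f: "f \<in> C_inf M" for f
    unfolding bracket_LA inA_scl S(8)[OF f] fst_comp_simps act_LA fst_pair_sec ..
qed

lemma skew_dull_LB: "skew_dull_algebroid M B LB"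
  unfolding skew_dull_algebroid_def
proof (intro conjI ballI allI B anchor_maps)
  fix b b1 b2 assume b: "b \<in> sections M B" "b1 \<in> sections M B" "b2 \<in> sections M B"
  have q: "inB b \<in> sections M Q" "inB b1 \<in> sections M Q" "inB b2 \<in> sections M Q" using b by simp_all
  note S = skew_dullD[OF S_dull q]
  show "bracket LB b1 b2 \<in> sections M B"
    using q by (simp add: bracket_LB)
  show "bracket LB (b1 + b2) b = bracket LB b1 b + bracket LB b2 b"
    unfolding bracket_LB inB_add S(2) snd_comp_simps ..
  show "bracket LB b (b1 + b2) = bracket LB b b1 + bracket LB b b2"
    unfolding bracket_LB inB_add S(3) snd_comp_simps ..
  show "bracket LB ((\<lambda>_. k) \<cdot> b1) b2 = (\<lambda>_. k) \<cdot> bracket LB b1 b2" for k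
    unfolding bracket_LB inB_scl S(4) snd_comp_simps ..
  show "bracket LB b1 ((\<lambda>_. k) \<cdot> b2) = (\<lambda>_. k) \<cdot> bracket LB b1 b2" for k
    unfolding bracket_LB inB_scl S(5) snd_comp_simps ..
  show "bracket LB b1 b2 = - bracket LB b2 b1"
    unfolding bracket_LB S(6) snd_comp_simps ..
  show "act LB (bracket LB b1 b2) f = act LB b1 (act LB b2 f) - act LB b2 (act LB b1 f)"
    if f: "f \<in> C_inf M" for f
    unfolding act_LB bracket_S_pure(2)[OF b(2,3), symmetric] by (rule S(7)[OF f])
  show "bracket LB b1 (f \<cdot> b2) = f \<cdot> bracket LB b1 b2 + act LB b1 f \<cdot> b2" if f: "f \<in> C_inf M" for f
    unfolding bracket_LB inB_scl S(8)[OF f] snd_comp_simps act_LB snd_pair_sec ..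
qed

lemma connections_C: "connection M A LA C (conn0 rA)" "connection M B LB C (conn0 rB)"
  unfolding connection_def conn0_rA conn0_rB inA_add inB_add inA_scl inB_scl act_LA act_LB
  by (intro ballI allI conjI connectionD[OF S_conn] in_Q zero_in; assumption)+

lemma bracket_S_scl_left:
  assumes "q \<in> sections M Q" "r \<in> sections M Q" "f \<in> C_inf M"
  shows "bracket S (f \<cdot> q) r = f \<cdot> bracket S q r - act S r f \<cdot> q"
proof -
  have "f \<cdot> q \<in> sections M Q"
    using assms(1,3) vector_bundle_whitney_sum[OF A B] by simp
  then have "bracket S (f \<cdot> q) r = - (f \<cdot> bracket S r q + act S r f \<cdot> q)"
    using bracket_S_skew[of "f \<cdot> q" r] skew_dullD(8)[OF S_dull zero_in(3) assms(2,1,3)] assms(2) by simp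
  also have "\<dots> = f \<cdot> (- bracket S r q) - act S r f \<cdot> q"
    by (simp add: scl_def fun_eq_iff)
  finally show ?thesis using bracket_S_skew[OF assms(1,2)] by simp
qed

text \<open>Multiplying \<open>a\<close> by a function produces, besides the scaled bracket, an
  anchor term proportional to \<open>inA a\<close>. Projection to B removes it, so the mixed bracket
  is linear over functions in \<open>a\<close>, while the anchor term in \<open>b\<close> survives
  as the Leibniz rule.\<close>

lemma connection_AB: "connection M A LA B (conn1 rA)"
  unfolding connection_def
proof (intro ballI conjI allI)
  fix a a' b b' assume s: "a \<in> sections M A" "a' \<in> sections M A" "b \<in> sections M B" "b' \<in> sections M B"
  have q: "inA a \<in> sections M Q" "inA a' \<in> sections M Q" "inB b \<in> sections M Q" "inB b' \<in> sections M Q"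
    using s by simp_all
  show "conn1 rA a b \<in> sections M B" using q by (simp add: conn1_rA)
  show "conn1 rA (a + a') b = conn1 rA a b + conn1 rA a' b"
    unfolding conn1_rA inA_add skew_dullD(2)[OF S_dull q(3,1,2)] snd_comp_simps ..
  show "conn1 rA a (b + b') = conn1 rA a b + conn1 rA a b'"
    unfolding conn1_rA inB_add skew_dullD(3)[OF S_dull q(1,3,4)] snd_comp_simps ..
  show "conn1 rA (f \<cdot> a) b = f \<cdot> conn1 rA a b" if "f \<in> C_inf M" for f
    unfolding conn1_rA inA_scl bracket_S_scl_left[OF q(1,3) that] diff_conv_add_uminus snd_comp_simps by simp
  show "conn1 rA a ((\<lambda>_. k) \<cdot> b) = (\<lambda>_. k) \<cdot> conn1 rA a b" for k
    unfolding conn1_rA inB_scl skew_dullD(5)[OF S_dull q(1,1,3)] snd_comp_simps ..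
  show "conn1 rA a (f \<cdot> b) = f \<cdot> conn1 rA a b + act LA a f \<cdot> b" if "f \<in> C_inf M" for f
    unfolding conn1_rA inB_scl skew_dullD(8)[OF S_dull q(1,1,3) that] snd_comp_simps act_LA by simp
qed

lemma connection_BA: "connection M B LB A (conn1 rB)"
  unfolding connection_def
proof (intro ballI conjI allI)
  fix b b' a a' assume s: "b \<in> sections M B" "b' \<in> sections M B" "a \<in> sections M A" "a' \<in> sections M A"
  have q: "inB b \<in> sections M Q" "inB b' \<in> sections M Q" "inA a \<in> sections M Q" "inA a' \<in> sections M Q"
    using s by simp_all
  show "conn1 rB b a \<in> sections M A" using q by (simp add: conn1_rB)
  show "conn1 rB (b + b') a = conn1 rB b a + conn1 rB b' a"
    unfolding conn1_rB inB_add skew_dullD(2)[OF S_dull q(3,1,2)] fst_comp_simps ..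
  show "conn1 rB b (a + a') = conn1 rB b a + conn1 rB b a'"
    unfolding conn1_rB inA_add skew_dullD(3)[OF S_dull q(1,3,4)] fst_comp_simps ..
  show "conn1 rB (f \<cdot> b) a = f \<cdot> conn1 rB b a" if "f \<in> C_inf M" for f
    unfolding conn1_rB inB_scl bracket_S_scl_left[OF q(1,3) that] diff_conv_add_uminus fst_comp_simps by simp
  show "conn1 rB b ((\<lambda>_. k) \<cdot> a) = (\<lambda>_. k) \<cdot> conn1 rB b a" for k
    unfolding conn1_rB inA_scl skew_dullD(5)[OF S_dull q(1,1,3)] fst_comp_simps ..
  show "conn1 rB b (f \<cdot> a) = f \<cdot> conn1 rB b a + act LB b f \<cdot> a" if "f \<in> C_inf M" for f
    unfolding conn1_rB inA_scl skew_dullD(8)[OF S_dull q(1,1,3) that] fst_comp_simps act_LB by simp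
qed

lemma bundle_maps: "bundle_map M C B (bdry rA)" "bundle_map M C A (bdry rB)"
proof -
  note lin = bundle_mapD(1)[OF S_bundle_map]
  have neg: "- w \<in> fib B x" if "w \<in> fib B x" for w x
    using vector_bundle_subspace[OF B, of x] that by (rule subspace_neg)
  have "app1 (bdry rA) c = - (snd \<circ> app1 (lmap S) c)" "app1 (bdry rB) c = fst \<circ> app1 (lmap S) c" for c
    by (simp_all add: app1_def rep_A_def rep_B_def fun_eq_iff)
  then have "app1 (bdry rA) c \<in> sections M B" "app1 (bdry rB) c \<in> sections M A" if "c \<in> sections M C" for c
    using bundle_mapD(2)[OF S_bundle_map that] B by simp_all
  moreover have "fibre_linear (fib C x) (fib B x) (bdry rA x)" "fibre_linear (fib C x) (fib A x) (bdry rB x)" for x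
    using fibre_linearD[OF lin[of x]] neg[of _ x]
    by (auto simp: fibre_linear_def rep_A_def rep_B_def mem_Times_iff)
  ultimately show "bundle_map M C B (bdry rA)" "bundle_map M C A (bdry rB)"
    by (simp_all add: bundle_map_def)
qed

lemma fibre_linear_uminus:
  assumes "fibre_linear (fib E x) (fib C x) f"
  shows "fibre_linear (fib E x) (fib C x) (\<lambda>v. - f v)"
  using assms subspace_neg[OF vector_bundle_subspace[OF C]] by (simp add: fibre_linear_def)

lemma curv_A: "curv rA \<in> Omega2_Hom M A B C"
  unfolding Omega2_Hom_def mem_Collect_eq
proof (intro conjI allI ballI)
  show "app3 (curv rA) a1 a2 b \<in> sections M C"
    if "a1 \<in> sections M A" "a2 \<in> sections M A" "b \<in> sections M B" for a1 a2 b
  proof -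
    have "app3 (curv rA) a1 a2 b = app3 (omega S) (inA a1) (inA a2) (inB b)"
      by (simp add: app3_def rep_A_def pair_sec_def)
    then show ?thesis
      using Omega3_sections[OF S_omega, of "inA a1" "inA a2" "inB b"] that by simp
  qed
  fix x a1 a2 b assume v: "a1 \<in> fib A x" "a2 \<in> fib A x" "b \<in> fib B x"
  have q: "(a1, 0) \<in> fib Q x" "(a2, 0) \<in> fib Q x" "(0, b) \<in> fib Q x" using v zero_in_fib by simp_all
  note w = Omega3D[OF S_omega q]
  show "fibre_linear (fib A x) (fib C x) (\<lambda>a. curv rA x a a2 b)" "fibre_linear (fib A x) (fib C x) (\<lambda>a. curv rA x a1 a b)"
    "fibre_linear (fib B x) (fib C x) (curv rA x a1 a2)" "curv rA x a1 a2 b = - curv rA x a2 a1 b"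
    using fibre_linear_inA[OF w(1)] fibre_linear_inA[OF w(2)] fibre_linear_inB[OF w(3)] w(4)
    by (simp_all add: rep_A_def)
qed

lemma curv_B: "curv rB \<in> Omega2_Hom M B A C"
  unfolding Omega2_Hom_def mem_Collect_eq
proof (intro conjI allI ballI)
  show "app3 (curv rB) b1 b2 a \<in> sections M C"
    if "b1 \<in> sections M B" "b2 \<in> sections M B" "a \<in> sections M A" for b1 b2 a
  proof -
    have "app3 (curv rB) b1 b2 a = - app3 (omega S) (inB b1) (inB b2) (inA a)"
      by (simp add: app3_def rep_B_def pair_sec_def fun_eq_iff)
    then show ?thesis
      using Omega3_sections[OF S_omega, of "inB b1" "inB b2" "inA a"] that C by simp
  qed
  fix x b1 b2 a assume v: "b1 \<in> fib B x" "b2 \<in> fib B x" "a \<in> fib A x"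
  have q: "(0, b1) \<in> fib Q x" "(0, b2) \<in> fib Q x" "(a, 0) \<in> fib Q x" using v zero_in_fib by simp_all
  note w = Omega3D[OF S_omega q]
  show "fibre_linear (fib B x) (fib C x) (\<lambda>b. curv rB x b b2 a)" "fibre_linear (fib B x) (fib C x) (\<lambda>b. curv rB x b1 b a)"
    "fibre_linear (fib A x) (fib C x) (curv rB x b1 b2)"
    using fibre_linear_uminus[OF fibre_linear_inB[OF w(1)]] fibre_linear_uminus[OF fibre_linear_inB[OF w(2)]]
      fibre_linear_uminus[OF fibre_linear_inA[OF w(3)]]
    by (simp_all add: rep_B_def)
  show "curv rB x b1 b2 a = - curv rB x b2 b1 a"
    unfolding rep_B_def rep2.simps w(4) ..
qed

text \<open>From here on \<open>T\<close> denotes the bicrossproduct of the restricted data, and the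
  equivalence with matched pairs is available for it.\<close>

sublocale bicross_data M A B C LA LB rA rB
  by unfold_locales (fact M A B C skew_dull_LA skew_dull_LB bundle_maps connections_C connection_AB connection_BA
      curv_A curv_B)+

end


section \<open>The given structure is the bicrossproduct of its restrictions\<close>

context split_on_sum
begin

lemma pair_sec_split: "pair_sec a b = inA a + inB b"
  by (simp add: pair_sec_add)

lemma bracket_S_eq_T:
  assumes "q1 \<in> sections M Q" "q2 \<in> sections M Q"
  shows "bracket S q1 q2 = bracket T q1 q2"
proof -
  obtain a1 b1 a2 b2 where e: "q1 = pair_sec a1 b1" "q2 = pair_sec a2 b2"
    and s: "a1 \<in> sections M A" "b1 \<in> sections M B" "a2 \<in> sections M A" "b2 \<in> sections M B"
    using assms unfolding sections_sum_eq by auto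
  have q: "inA a1 \<in> sections M Q" "inB b1 \<in> sections M Q" "inA a2 \<in> sections M Q" "inB b2 \<in> sections M Q"
    using s by simp_all
  have "bracket S q1 q2 = bracket S (inA a1) q2 + bracket S (inB b1) q2"
    unfolding e(1) pair_sec_split[of a1 b1] by (rule skew_dullD(2)[OF S_dull assms(2) q(1,2)])
  also have "bracket S (inA a1) q2 = bracket S (inA a1) (inA a2) + bracket S (inA a1) (inB b2)"
    unfolding e(2) pair_sec_split[of a2 b2] by (rule skew_dullD(3)[OF S_dull q(1,3,4)])
  also have "bracket S (inB b1) q2 = bracket S (inB b1) (inA a2) + bracket S (inB b1) (inB b2)"
    unfolding e(2) pair_sec_split[of a2 b2] by (rule skew_dullD(3)[OF S_dull q(2,3,4)])
  also have "bracket S (inB b1) (inA a2) = - pair_sec (- conn1 rB b1 a2) (conn1 rA a2 b1)"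
    unfolding bracket_S_skew[OF q(2,3)] bracket_S_mixed[OF s(3,2)] ..
  finally show ?thesis
    unfolding bracket_S_mixed[OF s(1,4)] bracket_S_pure(1)[OF s(1,3)] bracket_S_pure(2)[OF s(2,4)] e
    by (simp add: bicrossproduct_def Let_def pair_sec_add pair_sec_uminus algebra_simps)
qed

lemma lmap_S_eq_T: "lmap S x c = lmap T x c"
  by (simp add: bicrossproduct_def rep_A_def rep_B_def)

lemma conn_S_eq_T:
  assumes "q \<in> sections M Q" "c \<in> sections M C"
  shows "conn S q c = conn T q c"
proof -
  obtain a b where e: "q = pair_sec a b" and s: "a \<in> sections M A" "b \<in> sections M B"
    using assms(1) unfolding sections_sum_eq by auto
  have q: "inA a \<in> sections M Q" "inB b \<in> sections M Q" using s by simp_all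
  show ?thesis
    using connectionD(2)[OF S_conn q(1) assms(2) q(2)]
    unfolding e pair_sec_split[of a b, symmetric] by (simp add: bicrossproduct_def rep_A_def rep_B_def)
qed

text \<open>The hypotheses concern sections, whereas forms are compared fibre by fibre; vectors are
  therefore extended to sections.\<close>

lemma omega_S_pure:
  "a1 \<in> fib A x \<Longrightarrow> a2 \<in> fib A x \<Longrightarrow> a3 \<in> fib A x \<Longrightarrow> omega S x (a1, 0) (a2, 0) (a3, 0) = 0"
  "b1 \<in> fib B x \<Longrightarrow> b2 \<in> fib B x \<Longrightarrow> b3 \<in> fib B x \<Longrightarrow> omega S x (0, b1) (0, b2) (0, b3) = 0"
proof -
  assume v: "a1 \<in> fib A x" "a2 \<in> fib A x" "a3 \<in> fib A x"
  obtain s1 where s1: "s1 \<in> sections M A" "s1 x = a1" by (rule section_through[OF M A v(1)])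
  obtain s2 where s2: "s2 \<in> sections M A" "s2 x = a2" by (rule section_through[OF M A v(2)])
  obtain s3 where s3: "s3 \<in> sections M A" "s3 x = a3" by (rule section_through[OF M A v(3)])
  have "app3 (omega S) (inA s1) (inA s2) (inA s3) = 0" using omega_A s1(1) s2(1) s3(1) by blast
  from fun_cong[OF this, of x] show "omega S x (a1, 0) (a2, 0) (a3, 0) = 0"
    using s1 s2 s3 by (simp add: app3_def pair_sec_def)
next
  assume v: "b1 \<in> fib B x" "b2 \<in> fib B x" "b3 \<in> fib B x"
  obtain s1 where s1: "s1 \<in> sections M B" "s1 x = b1" by (rule section_through[OF M B v(1)])
  obtain s2 where s2: "s2 \<in> sections M B" "s2 x = b2" by (rule section_through[OF M B v(2)])
  obtain s3 where s3: "s3 \<in> sections M B" "s3 x = b3" by (rule section_through[OF M B v(3)])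
  have "app3 (omega S) (inB s1) (inB s2) (inB s3) = 0" using omega_B s1(1) s2(1) s3(1) by blast
  from fun_cong[OF this, of x] show "omega S x (0, b1) (0, b2) (0, b3) = 0"
    using s1 s2 s3 by (simp add: app3_def pair_sec_def)
qed

lemma omega_S_eq_T:
  assumes "q1 \<in> fib Q x" "q2 \<in> fib Q x" "q3 \<in> fib Q x"
  shows "omega S x q1 q2 q3 = omega T x q1 q2 q3"
proof -
  let ?w = "omega S x"
  obtain a1 b1 a2 b2 a3 b3 where e: "q1 = (a1, b1)" "q2 = (a2, b2)" "q3 = (a3, b3)"
    and v: "a1 \<in> fib A x" "a2 \<in> fib A x" "a3 \<in> fib A x" "b1 \<in> fib B x" "b2 \<in> fib B x" "b3 \<in> fib B x"
    using assms by auto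
  have q: "(a1, 0) \<in> fib Q x" "(a2, 0) \<in> fib Q x" "(a3, 0) \<in> fib Q x"
    "(0, b1) \<in> fib Q x" "(0, b2) \<in> fib Q x" "(0, b3) \<in> fib Q x"
    using v zero_in_fib by simp_all
  have dec: "(a, b) = (a, 0) + (0, b)" for a :: 'a and b :: 'b by simp
  have 1: "?w (a1, b1) r s = ?w (a1, 0) r s + ?w (0, b1) r s" if "r \<in> fib Q x" "s \<in> fib Q x" for r s
    unfolding dec[of a1 b1] by (rule fibre_linearD(2)[OF Omega3D(1)[OF S_omega q(1) that] q(1,4)])
  have 2: "?w r (a2, b2) s = ?w r (a2, 0) s + ?w r (0, b2) s" if "r \<in> fib Q x" "s \<in> fib Q x" for r s
    unfolding dec[of a2 b2] by (rule fibre_linearD(2)[OF Omega3D(2)[OF S_omega that(1) q(2) that(2)] q(2,5)])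
  have 3: "?w r s (a3, b3) = ?w r s (a3, 0) + ?w r s (0, b3)" if "r \<in> fib Q x" "s \<in> fib Q x" for r s
    unfolding dec[of a3 b3] by (rule fibre_linearD(2)[OF Omega3D(3)[OF S_omega that q(3)] q(3,6)])
  \<comment> \<open>Cyclic shifts are even, hence without sign. They put three of the surviving
    terms into the order AAB and three into the order BBA.\<close>
  have cyc: "?w r s t = ?w t r s" if "r \<in> fib Q x" "s \<in> fib Q x" "t \<in> fib Q x" for r s t
    using Omega3D(5)[OF S_omega that] Omega3D(4)[OF S_omega that(1,3,2)] by simp
  have "?w q1 q2 q3 = ?w (a1, 0) (a2, 0) (0, b3) + ?w (a1, 0) (0, b2) (a3, 0) + ?w (a1, 0) (0, b2) (0, b3)
      + ?w (0, b1) (a2, 0) (a3, 0) + ?w (0, b1) (a2, 0) (0, b3) + ?w (0, b1) (0, b2) (a3, 0)"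
    using assms(2,3) unfolding e by (simp add: 1 2 3 q v omega_S_pure del: fib_whitney_sum)
  also have "\<dots> = ?w (a1, 0) (a2, 0) (0, b3) + ?w (a2, 0) (a3, 0) (0, b1) + ?w (a3, 0) (a1, 0) (0, b2)
      + ?w (0, b1) (0, b2) (a3, 0) + ?w (0, b2) (0, b3) (a1, 0) + ?w (0, b3) (0, b1) (a2, 0)"
    using cyc[OF q(1,5,3)] cyc[OF q(2,3,4)] cyc[OF q(5,6,1)] cyc[OF q(4,2,6)] by simp
  finally show ?thesis
    unfolding e by (simp add: bicrossproduct_def rep_A_def rep_B_def)
qed

lemma same_split2_T: "same_split2 M Q C S T"
  unfolding same_split2_def
proof (intro conjI allI ballI)
  fix x q f assume q: "q \<in> fib Q x" and f: "f \<in> C_inf M"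
  obtain a b where e: "q = (a, b)" "a \<in> fib A x" "b \<in> fib B x" using q by auto
  have "anchor S x ((a, 0) + (0, b)) f = anchor S x (a, 0) f + anchor S x (0, b) f"
    using e zero_in_fib by (intro fibre_linearD(2)[OF anchor_mapD(2)[OF S_anchor f]]) simp_all
  then show "anchor S x q f = anchor T x q f"
    unfolding e(1) by (simp add: bicrossproduct_def restrict_A_def restrict_B_def)
qed (simp_all add: bracket_S_eq_T lmap_S_eq_T conn_S_eq_T omega_S_eq_T del: fib_whitney_sum)

text \<open>Bracket and connection of \<open>S\<close> and \<open>T\<close> are known to agree on
  smooth sections only. The identities transfer because every intermediate term in them is again a
  section, which the closure rules \<open>lq\<close>, \<open>nC\<close> and \<open>wC\<close>
  provide.\<close>

lemma matched_pair_restrict: "matched_pair M A B C LA LB rA rB"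
proof -
  have l: "app1 (lmap T) c = app1 (lmap S) c" for c
    by (simp add: app1_def lmap_S_eq_T)
  have w: "app3 (omega T) q1 q2 q3 = app3 (omega S) q1 q2 q3"
    if "q1 \<in> sections M Q" "q2 \<in> sections M Q" "q3 \<in> sections M Q" for q1 q2 q3
    using omega_S_eq_T[OF that[THEN sections_fib]] by (simp add: app3_def)
  note lq = bundle_mapD(2)[OF S_bundle_map]
  note nC = connectionD(1)[OF S_conn]
  note wC = Omega3_sections[OF S_omega]
  have "split2_identities M Q C T"
    using S_identities unfolding split2_identities_def
    by (simp add: l w lq nC wC Jac_def curvature_def d3_def flip: bracket_S_eq_T conn_S_eq_T)
  then show ?thesis unfolding split2_identities_T_iff .
qed

end

theorem theorem5p1:
  fixes M :: "('m::{t2_space,second_countable_topology}) manifold"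
    and A :: "('m, 'a::real_vector) vbundle"
    and B :: "('m, 'b::real_vector) vbundle"
    and C :: "('m, 'c::real_vector) vbundle"
  assumes "smooth_manifold M"
    and "vector_bundle M A" and "vector_bundle M B" and "vector_bundle M C"
  shows
    "(\<forall>LA LB rA rB. matched_pair M A B C LA LB rA rB \<longrightarrow>
        split_Lie_2_algebroid M (A \<oplus>\<^sub>V B) C (bicrossproduct LA LB rA rB))
     \<and>
     (\<forall>S. split_Lie_2_algebroid M (A \<oplus>\<^sub>V B) C S \<and>
        (\<forall>a1\<in>sections M A. \<forall>a2\<in>sections M A.
           \<exists>a\<in>sections M A. bracket S (pair_sec a1 0) (pair_sec a2 0) = pair_sec a 0) \<and>
        (\<forall>b1\<in>sections M B. \<forall>b2\<in>sections M B.
           \<exists>b\<in>sections M B. bracket S (pair_sec 0 b1) (pair_sec 0 b2) = pair_sec 0 b) \<and>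
        (\<forall>a1\<in>sections M A. \<forall>a2\<in>sections M A. \<forall>a3\<in>sections M A.
           app3 (omega S) (pair_sec a1 0) (pair_sec a2 0) (pair_sec a3 0) = 0) \<and>
        (\<forall>b1\<in>sections M B. \<forall>b2\<in>sections M B. \<forall>b3\<in>sections M B.
           app3 (omega S) (pair_sec 0 b1) (pair_sec 0 b2) (pair_sec 0 b3) = 0) \<longrightarrow>
        lie_algebroid M A (restrict_A S) \<and> lie_algebroid M B (restrict_B S) \<and>
        matched_pair M A B C (restrict_A S) (restrict_B S) (rep_A S) (rep_B S) \<and>
        same_split2 M (A \<oplus>\<^sub>V B) C S
          (bicrossproduct (restrict_A S) (restrict_B S) (rep_A S) (rep_B S)))"
proof (intro conjI allI impI)
  fix LA LB rA rB assume "matched_pair M A B C LA LB rA rB"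
  then show "split_Lie_2_algebroid M (A \<oplus>\<^sub>V B) C (bicrossproduct LA LB rA rB)"
    by (rule split_Lie_2_algebroid_bicrossproduct[OF assms])
next
  fix S :: "('m, 'a \<times> 'b, 'c) split2"
  assume S: "split_Lie_2_algebroid M (A \<oplus>\<^sub>V B) C S \<and>
        (\<forall>a1\<in>sections M A. \<forall>a2\<in>sections M A.
           \<exists>a\<in>sections M A. bracket S (pair_sec a1 0) (pair_sec a2 0) = pair_sec a 0) \<and>
        (\<forall>b1\<in>sections M B. \<forall>b2\<in>sections M B.
           \<exists>b\<in>sections M B. bracket S (pair_sec 0 b1) (pair_sec 0 b2) = pair_sec 0 b) \<and>
        (\<forall>a1\<in>sections M A. \<forall>a2\<in>sections M A. \<forall>a3\<in>sections M A.
           app3 (omega S) (pair_sec a1 0) (pair_sec a2 0) (pair_sec a3 0) = 0) \<and>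
        (\<forall>b1\<in>sections M B. \<forall>b2\<in>sections M B. \<forall>b3\<in>sections M B.
           app3 (omega S) (pair_sec 0 b1) (pair_sec 0 b2) (pair_sec 0 b3) = 0)"
  interpret split_on_sum M A B C S
    unfolding split_on_sum_def using S assms by (intro conjI) (elim conjE, assumption)+
  show "matched_pair M A B C (restrict_A S) (restrict_B S) (rep_A S) (rep_B S)"
    by (rule matched_pair_restrict)
  \<comment> \<open>A 2-representation includes the Lie algebroid property of the acting bundle, so
    both Jacobi identities are already contained in the matched pair.\<close>
  then show "lie_algebroid M A (restrict_A S)" "lie_algebroid M B (restrict_B S)"
    unfolding matched_pair_def two_representation_def by argo+
  show "same_split2 M (A \<oplus>\<^sub>V B) C S
      (bicrossproduct (restrict_A S) (restrict_B S) (rep_A S) (rep_B S))"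
    by (rule same_split2_T)
qed

end
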